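(* Let $A\in\mathbb{R}^{n\times n}$, $B\in\mathbb{R}^{n\times m}$, let $U\subset\mathbb{R}^m$ be a compact and convex neighborhood of $0\in\mathbb{R}^m$, and consider the linear control system $\dot x(t)=Ax(t)+Bu(t)$, $u\in\mathcal{U}$, on $\mathbb{R}^n$. This system has a unique chain control set $E$ in $\mathbb{R}^n$, and it is given by $$E=\overline{D_0}+L^0,$$ where $D_0$ is the control set containing $0\in\mathbb{R}^n$ and $L^0$ is the center Lyapunov space of $A$.
   Context: $\mathcal{U}=\{u\in L^\infty(\mathbb{R},\mathbb{R}^m): u(t)\in U \text{ for almost all } t\in\mathbb{R}\}$, and $\varphi(t,x_0,u)$, $t\in\mathbb{R}$, denotes the solution with $x(0)=x_0$ and control $u\in\mathcal{U}$. Reachable set: $\mathbf{R}(x)=\{y: \exists u\in\mathcal{U}\ \exists T>0: y=\varphi(T,x,u)\}$. Control set: a nonvoid set $D\subset\mathbb{R}^n$ such that (i) for all $x\in D$ there is $u\in\mathcal{U}$ with $\varphi(t,x,u)\in D$ for all $t\ge 0$, (ii) $D\subset\overline{\mathbf{R}(x)}$ for all $x\in D$, and (iii) $D$ is maximal (with respect to inclusion) with properties (i) and (ii). There is a unique control set $D_0$ with $0\in D_0$. Controlled chain: for $\varepsilon,T>0$, a controlled $(\varepsilon,T)$-chain from $x$ to $y$ consists of $k\in\mathbb{N}$, points $x_0=x,x_1,\ldots,x_k=y$, controls $u_0,\ldots,u_{k-1}\in\mathcal{U}$ and times $t_0,\ldots,t_{k-1}\ge T$ with $d(\varphi(t_j,x_j,u_j),x_{j+1})<\varepsilon$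 for all $j=0,\ldots,k-1$ (here $d$ is the metric on $\mathbb{R}^n$ given by a norm). Chain control set: a nonvoid set $E$ such that for all $x,y\in E$ and all $\varepsilon,T>0$ there is a controlled $(\varepsilon,T)$-chain from $x$ to $y$, and $E$ is maximal with this property. The center Lyapunov space $L^0$ of $A$ is the sum of the (real) generalized eigenspaces of $A$ for eigenvalues with vanishing real part. *)

theory Defs
  imports "HOL-Analysis.Analysis" "HOL-Library.Set_Algebras"
begin

section \<open>Linear control systems\<close>

text \<open>
  Controls are functions rather than classes modulo null sets; all notions below only depend
  on the class, because controls enter trajectories through integrals only.
\<close>

definition admissible_controls :: "(real^'m) set \<Rightarrow> (real \<Rightarrow> real^'m) set" where
  "admissible_controls U =
    {u. u \<in> borel_measurable lebesgue \<and>
        (\<exists>C. AE t in lebesgue. norm (u t) \<le> C) \<and>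
        (AE t in lebesgue. u t \<in> U)}"

text \<open>
  Caratheodory solutions on the whole real line, in integrated form. Quantifying over all
  intervals \<open>[a, b]\<close> covers negative times; continuity of \<open>x\<close> is implied.
\<close>

definition is_trajectory ::
  "real^'n^'n \<Rightarrow> real^'m^'n \<Rightarrow> real^'n \<Rightarrow> (real \<Rightarrow> real^'m) \<Rightarrow> (real \<Rightarrow> real^'n) \<Rightarrow> bool" where
  "is_trajectory A B x0 u x \<longleftrightarrow>
    x 0 = x0 \<and>
    (\<forall>a b. a \<le> b \<longrightarrow> ((\<lambda>s. A *v x s + B *v u s) has_integral (x b - x a)) {a..b})"

text \<open>For admissible controls the trajectory exists and is unique.\<close>

definition flow ::
  "real^'n^'n \<Rightarrow> real^'m^'n \<Rightarrow> real \<Rightarrow> real^'n \<Rightarrow> (real \<Rightarrow> real^'m) \<Rightarrow> real^'n" where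
  "flow A B t x0 u = (THE x. is_trajectory A B x0 u x) t"

definition reachable_set ::
  "real^'n^'n \<Rightarrow> real^'m^'n \<Rightarrow> (real^'m) set \<Rightarrow> real^'n \<Rightarrow> (real^'n) set" where
  "reachable_set A B U x =
    {y. \<exists>u \<in> admissible_controls U. \<exists>T>0. y = flow A B T x u}"


section \<open>Control sets\<close>

definition pre_control_set ::
  "real^'n^'n \<Rightarrow> real^'m^'n \<Rightarrow> (real^'m) set \<Rightarrow> (real^'n) set \<Rightarrow> bool" where
  "pre_control_set A B U D \<longleftrightarrow>
    (\<forall>x\<in>D. \<exists>u \<in> admissible_controls U. \<forall>t\<ge>0. flow A B t x u \<in> D) \<and>
    (\<forall>x\<in>D. D \<subseteq> closure (reachable_set A B U x))"

definition control_set ::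
  "real^'n^'n \<Rightarrow> real^'m^'n \<Rightarrow> (real^'m) set \<Rightarrow> (real^'n) set \<Rightarrow> bool" where
  "control_set A B U D \<longleftrightarrow>
    D \<noteq> {} \<and> pre_control_set A B U D \<and>
    (\<forall>D'. pre_control_set A B U D' \<and> D \<subseteq> D' \<longrightarrow> D' = D)"

text \<open>Well defined if \<open>0 \<in> U\<close>: exactly one control set contains the origin.\<close>

definition zero_control_set ::
  "real^'n^'n \<Rightarrow> real^'m^'n \<Rightarrow> (real^'m) set \<Rightarrow> (real^'n) set" where
  "zero_control_set A B U = (THE D. control_set A B U D \<and> 0 \<in> D)"


section \<open>Chain control sets\<close>

text \<open>
  The metric underlying chains comes from an arbitrary norm \<open>N\<close>, which need not be the
  Euclidean one attached to the type. Nonnegativity follows from the three conditions.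
\<close>

definition is_norm :: "('a::real_vector \<Rightarrow> real) \<Rightarrow> bool" where
  "is_norm N \<longleftrightarrow>
    (\<forall>x. N x = 0 \<longleftrightarrow> x = 0) \<and>
    (\<forall>x y. N (x + y) \<le> N x + N y) \<and>
    (\<forall>c x. N (c *\<^sub>R x) = \<bar>c\<bar> * N x)"

text \<open>
  Chains have at least one step (\<open>k \<ge> 1\<close>). Trivial chains of length 0 would make every
  singleton chain transitive.
\<close>

definition controlled_chain ::
  "(real^'n \<Rightarrow> real) \<Rightarrow> real^'n^'n \<Rightarrow> real^'m^'n \<Rightarrow> (real^'m) set \<Rightarrow>
    real \<Rightarrow> real \<Rightarrow> real^'n \<Rightarrow> real^'n \<Rightarrow> bool" where
  "controlled_chain N A B U \<epsilon> T x y \<longleftrightarrow>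
    (\<exists>(k::nat) (p :: nat \<Rightarrow> real^'n) (u :: nat \<Rightarrow> real \<Rightarrow> real^'m) (t :: nat \<Rightarrow> real).
      k \<ge> 1 \<and> p 0 = x \<and> p k = y \<and>
      (\<forall>j<k. u j \<in> admissible_controls U \<and> t j \<ge> T \<and>
             N (flow A B (t j) (p j) (u j) - p (Suc j)) < \<epsilon>))"

definition chain_transitive ::
  "(real^'n \<Rightarrow> real) \<Rightarrow> real^'n^'n \<Rightarrow> real^'m^'n \<Rightarrow> (real^'m) set \<Rightarrow> (real^'n) set \<Rightarrow> bool" where
  "chain_transitive N A B U E \<longleftrightarrow>
    (\<forall>x\<in>E. \<forall>y\<in>E. \<forall>\<epsilon>>0. \<forall>T>0. controlled_chain N A B U \<epsilon> T x y)"

definition chain_control_set ::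
  "(real^'n \<Rightarrow> real) \<Rightarrow> real^'n^'n \<Rightarrow> real^'m^'n \<Rightarrow> (real^'m) set \<Rightarrow> (real^'n) set \<Rightarrow> bool" where
  "chain_control_set N A B U E \<longleftrightarrow>
    E \<noteq> {} \<and> chain_transitive N A B U E \<and>
    (\<forall>E'. chain_transitive N A B U E' \<and> E \<subseteq> E' \<longrightarrow> E' = E)"


section \<open>Center Lyapunov space\<close>

definition complexify :: "real^'n^'n \<Rightarrow> complex^'n^'n" where
  "complexify A = (\<chi> i j. complex_of_real (A $ i $ j))"

definition eigenvalues :: "real^'n^'n \<Rightarrow> complex set" where
  "eigenvalues A = {\<mu>. \<exists>v. v \<noteq> 0 \<and> complexify A *v v = \<mu> *s v}"

definition generalized_eigenspace :: "real^'n^'n \<Rightarrow> complex \<Rightarrow> (complex^'n) set" where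
  "generalized_eigenspace A \<mu> =
    {v. \<exists>k. ((\<lambda>w. complexify A *v w - \<mu> *s w) ^^ k) v = 0}"

text \<open>
  Spanned by the real and imaginary parts of the complex generalized eigenvectors. For real
  \<open>\<mu>\<close> this is the usual generalized eigenspace in \<open>real^'n\<close>; conjugate eigenvalues give
  the same space.
\<close>

definition real_generalized_eigenspace :: "real^'n^'n \<Rightarrow> complex \<Rightarrow> (real^'n) set" where
  "real_generalized_eigenspace A \<mu> =
    span (\<Union>v \<in> generalized_eigenspace A \<mu>. {\<chi> i. Re (v $ i), \<chi> i. Im (v $ i)})"

text \<open>The sum of a family of subspaces is the span of their union.\<close>

definition center_Lyapunov_space :: "real^'n^'n \<Rightarrow> (real^'n) set" where
  "center_Lyapunov_space A =
    span (\<Union>\<mu> \<in> {\<mu> \<in> eigenvalues A. Re \<mu> = 0}. real_generalized_eigenspace A \<mu>)"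

end

theory Submission
  imports Defs "HOL-Computational_Algebra.Fundamental_Theorem_Algebra"
begin

text \<open>
  Write \<open>\<Phi> t = e\<^sup>t\<^sup>A\<close> and let \<open>R t\<close> be the set of points reached from the origin in time \<open>t\<close>, so that
  trajectories are \<open>\<Phi> t x + r\<close> with \<open>r \<in> R t\<close>. Reversing time turns \<open>(\<Phi>, R)\<close> into the system
  \<open>\<Phi>' t = \<Phi> (- t)\<close>, \<open>R' t = - \<Phi> (- t) (R t)\<close>, whose reachable points are the points that can be steered
  to the origin; this system has the same formal properties as the original one. Hence everything
  is proved once for an abstract pair \<open>(\<Phi>, R)\<close>, the locale \<open>reachability\<close>, and used in both
  directions of time.

  Let \<open>V\<^sup>+\<close> be the space of points whose backward orbit grows subexponentially; for the flow of a
  matrix it is the sum of the unstable and the center space. Put \<open>E\<^sup>- = closure (Reach + V\<^sup>+)\<close>, where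
  \<open>Reach\<close> is the union of all \<open>R t\<close>, let \<open>E\<^sup>+\<close> be the same set for the reversed system, and let
  \<open>E = E\<^sup>- \<inter> E\<^sup>+\<close>. The set \<open>E\<close> is the chain control set, for three reasons.

  First, points that are chain recurrent lie in \<open>E\<close>. The set \<open>E\<^sup>-\<close> is invariant under the control
  system and under translation by \<open>V\<^sup>+\<close>, and modulo \<open>V\<^sup>+\<close> the maps \<open>\<Phi> t\<close> are contractions for large
  \<open>t\<close>. Along a chain the distance to \<open>E\<^sup>-\<close> is therefore halved up to an error of order \<open>\<epsilon>\<close>, so a
  point that returns to itself along \<open>\<epsilon>\<close>-chains has distance \<open>O(\<epsilon>)\<close> for every \<open>\<epsilon>\<close>
  (\<open>recurrent_in_chain_hull\<close>).

  Second, every point of \<open>E\<close> can be joined to the origin and back by chains. Chains from the origin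
  with jumps smaller than \<open>\<epsilon>\<close> reach the iterated sums \<open>\<Phi> T (\<dots>) + Q\<close> with \<open>Q = R T + ball 0 \<epsilon>\<close>. The
  key result \<open>subexponential_in_closure_accumulate\<close> says that the closure of the union of these
  sums contains \<open>V\<^sup>+ \<inter> span Q\<close>: on \<open>span Q\<close>, a functional that is bounded on all the sums decays
  exponentially under the adjoint of \<open>\<Phi> T\<close>, so it must vanish on the vectors of \<open>span Q\<close> whose
  backward orbit grows subexponentially. As \<open>Q\<close> spans the whole
  space, chains reach every point of \<open>E\<^sup>-\<close> (\<open>chain_hull_chain_transitive\<close>).

  Third, \<open>E\<close> is \<open>closure D\<^sub>0 + L\<^sup>0\<close>. The same key result without jumps, \<open>Q = R T\<close>, shows that
  \<open>closure Reach\<close> is invariant under translation by \<open>V\<^sup>+ \<inter> span Reach\<close>. For \<open>x \<in> E\<close> this places the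
  sum \<open>z\<close> of the stable and the unstable part of \<open>x\<close> in the closure of \<open>Reach\<close> and in the closure of
  the set of points controllable to the origin. Both sets are convex with the origin in their
  relative interior, so \<open>z\<close> lies in the closure of their intersection, which consists of loops through
  the origin and is contained in \<open>D\<^sub>0\<close>; and \<open>x - z\<close> lies in \<open>L\<^sup>0\<close> (\<open>chain_hull_subset\<close>). Conversely
  \<open>D\<^sub>0\<close> is chain recurrent, and \<open>E\<close> is closed and invariant under translation by \<open>L\<^sup>0\<close>.

  The link to the generalized eigenspaces is that the vectors with decaying, with backward decaying
  and with subexponential orbits are spanned by the generalized eigenvectors for eigenvalues with
  negative, positive and vanishing real part (\<open>center_Lyapunov_space_eq\<close>).
\<close>

section \<open>Convex sets swept out by a linear map\<close>

text \<open>
  A line contained in a closed convex set is a direction in which the set is invariant: the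
  points \<open>(1 - 1/n) x + (1/n) (n v)\<close> of the set tend to \<open>x + v\<close>.
\<close>

lemma mem_closure_add_subspace:
  fixes K V :: "'a::euclidean_space set"
  assumes K: "closed K" "convex K" and V: "subspace V" "V \<subseteq> K"
    and x: "x \<in> K" and v: "v \<in> V"
  shows "x + v \<in> K"
proof -
  let ?y = "\<lambda>n. (1 - 1 / real (Suc n)) *\<^sub>R x + (1 / real (Suc n)) *\<^sub>R (real (Suc n) *\<^sub>R v)"
  have "?y n \<in> K" for n
  proof (rule convexD[OF K(2) x])
    show "real (Suc n) *\<^sub>R v \<in> K" using V v subspace_scale by blast
  qed (auto simp: divide_simps)
  moreover have "?y \<longlonglongrightarrow> x + v"
  proof -
    have "(\<lambda>n. (1 - 1 / real (Suc n)) *\<^sub>R x + v) \<longlonglongrightarrow> (1 - 0) *\<^sub>R x + v"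
      by (intro tendsto_intros LIMSEQ_Suc[OF lim_1_over_n])
    then show ?thesis by simp
  qed
  ultimately show ?thesis by (rule closed_sequentially[OF K(1)])
qed

text \<open>
  The condition \<open>- k Q \<subseteq> Q\<close> replaces symmetry, which a reachable set lacks because the control
  range need not be symmetric: a relative interior point \<open>z\<close> and the point \<open>- k z\<close> have the origin
  between them.
\<close>

lemma zero_in_rel_interior:
  fixes Q :: "'a::euclidean_space set"
  assumes Q: "convex Q" "0 \<in> Q" and k: "0 < k" "\<And>q. q \<in> Q \<Longrightarrow> - (k *\<^sub>R q) \<in> Q"
  shows "0 \<in> rel_interior Q"
proof -
  obtain z where z: "z \<in> rel_interior Q"
    using rel_interior_eq_empty[OF Q(1)] Q(2) by auto
  then have "- (k *\<^sub>R z) \<in> Q" using k(2) rel_interior_subset[of Q] by auto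
  from rel_interior_convex_shrink[OF Q(1) z this, of "k / (1 + k)"] k
  have "- (k *\<^sub>R z) - (k / (1 + k)) *\<^sub>R (- (k *\<^sub>R z) - z) \<in> rel_interior Q" by auto
  moreover have "- (k *\<^sub>R z) - c *\<^sub>R (- (k *\<^sub>R z) - z) = (c * (1 + k) - k) *\<^sub>R z" for c
    by (simp add: algebra_simps)
  moreover have "(k / (1 + k)) * (1 + k) - k = 0" using k(1) by simp
  ultimately show ?thesis by simp
qed

lemma cball_Int_span_subset:
  fixes Q :: "'a::euclidean_space set"
  assumes Q: "convex Q" "0 \<in> Q" and k: "0 < k" "\<And>q. q \<in> Q \<Longrightarrow> - (k *\<^sub>R q) \<in> Q"
  shows "\<exists>c>0. \<forall>y\<in>span Q. norm y \<le> c \<longrightarrow> y \<in> Q"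
proof -
  have "0 \<in> rel_interior Q" by (rule zero_in_rel_interior[OF assms])
  then obtain e where "e > 0" "cball 0 e \<inter> affine hull Q \<subseteq> Q"
    by (auto simp: mem_rel_interior_cball)
  moreover have "affine hull Q = span Q"
    by (rule affine_hull_span_0[OF hull_inc[OF Q(2)]])
  ultimately show ?thesis by (intro exI[of _ e]) (auto simp: subset_iff)
qed

text \<open>
  Expanding in an orthonormal basis turns pointwise estimates for a family of linear maps into an
  estimate with one constant for the whole subspace.
\<close>

lemma uniform_bound_on_subspace:
  fixes W :: "'a::euclidean_space set" and f :: "'i \<Rightarrow> 'a \<Rightarrow> 'b::real_normed_vector"
  assumes W: "subspace W" and lin: "\<And>i. i \<in> I \<Longrightarrow> linear (f i)"
    and g: "\<And>i. i \<in> I \<Longrightarrow> 0 \<le> g i"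
    and bd: "\<And>x. x \<in> W \<Longrightarrow> \<exists>C. \<forall>i\<in>I. norm (f i x) \<le> C * g i"
  shows "\<exists>K>0. \<forall>x\<in>W. \<forall>i\<in>I. norm (f i x) \<le> K * norm x * g i"
proof -
  obtain B where B: "B \<subseteq> W" "pairwise orthogonal B" "\<And>x. x \<in> B \<Longrightarrow> norm x = 1"
      "independent B" "span B = W"
    by (rule orthonormal_basis_subspace[OF W]) blast
  have fin: "finite B" by (rule independent_imp_finite[OF B(4)])
  from bd B(1) have "\<forall>b\<in>B. \<exists>C. \<forall>i\<in>I. norm (f i b) \<le> C * g i" by blast
  then obtain C where C: "\<And>b i. b \<in> B \<Longrightarrow> i \<in> I \<Longrightarrow> norm (f i b) \<le> C b * g i" by metis
  define K where "K = 1 + (\<Sum>b\<in>B. \<bar>C b\<bar>)"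
  have "norm (f i x) \<le> K * norm x * g i" if x: "x \<in> W" and i: "i \<in> I" for x i
  proof -
    have ex: "x = (\<Sum>b\<in>B. (x \<bullet> b) *\<^sub>R b)"
    proof -
      have "x \<in> span B" using x B by simp
      then obtain u where u: "x = (\<Sum>b\<in>B. u b *\<^sub>R b)" by (auto simp: span_finite[OF fin])
      have "x \<bullet> b = u b" if "b \<in> B" for b
      proof -
        have "x \<bullet> b = (\<Sum>a\<in>B. u a * (a \<bullet> b))" by (simp add: u inner_sum_left)
        also have "\<dots> = (\<Sum>a\<in>B. if a = b then u a else 0)"
          using B(2,3) that by (intro sum.cong) (auto simp: pairwise_def orthogonal_def dot_square_norm)
        finally show ?thesis using that fin by simp
      qed
      then show ?thesis using u by simp
    qed
    have "norm (f i x) = norm (\<Sum>b\<in>B. (x \<bullet> b) *\<^sub>R f i b)"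
      by (subst ex) (simp add: linear_sum[OF lin[OF i]] linear_scale[OF lin[OF i]])
    also have "\<dots> \<le> (\<Sum>b\<in>B. norm x * (\<bar>C b\<bar> * g i))"
    proof (rule sum_norm_le)
      fix b assume b: "b \<in> B"
      have "\<bar>x \<bullet> b\<bar> \<le> norm x" using Cauchy_Schwarz_ineq2[of x b] B(3)[OF b] by simp
      moreover have "norm (f i b) \<le> \<bar>C b\<bar> * g i"
        using C[OF b i] g[OF i] by (meson abs_ge_self mult_right_mono order_trans)
      ultimately show "norm ((x \<bullet> b) *\<^sub>R f i b) \<le> norm x * (\<bar>C b\<bar> * g i)"
        by (simp add: mult_mono)
    qed
    also have "\<dots> = (\<Sum>b\<in>B. \<bar>C b\<bar>) * norm x * g i"
      by (simp add: sum_distrib_left sum_distrib_right mult_ac)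
    also have "\<dots> \<le> K * norm x * g i"
      using g[OF i] by (auto simp: K_def intro!: mult_right_mono)
    finally show ?thesis .
  qed
  moreover have "K > 0" by (simp add: K_def add_pos_nonneg sum_nonneg)
  ultimately show ?thesis by blast
qed

text \<open>
  The points reached from the origin in \<open>k\<close> steps \<open>x \<mapsto> M x + q\<close> with \<open>q \<in> Q\<close>. It models both
  reachable sets, with \<open>Q = R T\<close>, and chains, where \<open>Q\<close> also contains the jumps.
\<close>

primrec accumulate :: "('a::real_vector \<Rightarrow> 'a) \<Rightarrow> 'a set \<Rightarrow> nat \<Rightarrow> 'a set" where
  "accumulate M Q 0 = {0}"
| "accumulate M Q (Suc k) = {M a + q | a q. a \<in> accumulate M Q k \<and> q \<in> Q}"

lemma accumulate_mono_Suc: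
  assumes "linear M" "0 \<in> Q"
  shows "accumulate M Q k \<subseteq> accumulate M Q (Suc k)"
proof (induction k)
  case 0
  then show ?case using assms linear_0[OF assms(1)] by (auto intro!: exI[of _ 0])
next
  case (Suc k)
  show ?case
  proof
    fix x assume "x \<in> accumulate M Q (Suc k)"
    then obtain a q where "x = M a + q" "a \<in> accumulate M Q k" "q \<in> Q" by auto
    moreover have "a \<in> accumulate M Q (Suc k)" using Suc calculation by blast
    ultimately show "x \<in> accumulate M Q (Suc (Suc k))" by (subst accumulate.simps(2)) blast
  qed
qed

lemma accumulate_mono:
  assumes "linear M" "0 \<in> Q" "j \<le> k"
  shows "accumulate M Q j \<subseteq> accumulate M Q k"
  using lift_Suc_mono_le[of "accumulate M Q", OF accumulate_mono_Suc[OF assms(1,2)] assms(3)] .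

lemma convex_accumulate:
  assumes "linear M" "convex Q"
  shows "convex (accumulate M Q k)"
proof (induction k)
  case (Suc k)
  have "accumulate M Q (Suc k) = (\<Union>x\<in>M ` accumulate M Q k. \<Union>y\<in>Q. {x + y})" by auto
  then show ?case
    using convex_sums[OF convex_linear_image[OF assms(1) Suc] assms(2)] by simp
qed auto

lemma convex_UN_accumulate:
  assumes "linear M" "convex Q" "0 \<in> Q"
  shows "convex (\<Union>k. accumulate M Q k)"
  unfolding convex_def
proof safe
  fix x y and i j :: nat and u v :: real
  assume 1: "x \<in> accumulate M Q i" "y \<in> accumulate M Q j" "0 \<le> u" "0 \<le> v" "u + v = 1"
  have "x \<in> accumulate M Q (max i j)" "y \<in> accumulate M Q (max i j)"
    using 1 accumulate_mono[OF assms(1,3), of i "max i j"] accumulate_mono[OF assms(1,3), of j "max i j"] by auto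
  then have "u *\<^sub>R x + v *\<^sub>R y \<in> accumulate M Q (max i j)"
    using 1 by (intro convexD[OF convex_accumulate[OF assms(1,2)]])
  then show "u *\<^sub>R x + v *\<^sub>R y \<in> (\<Union>k. accumulate M Q k)" by blast
qed

lemma accumulate_sym:
  assumes "linear M" and "\<And>q. q \<in> Q \<Longrightarrow> - (\<kappa> *\<^sub>R q) \<in> Q" and "x \<in> accumulate M Q k"
  shows "- (\<kappa> *\<^sub>R x) \<in> accumulate M Q k"
  using assms(3)
proof (induction k arbitrary: x)
  case (Suc k)
  then obtain a q where x: "x = M a + q" "a \<in> accumulate M Q k" "q \<in> Q" by auto
  have "- (\<kappa> *\<^sub>R x) = M (- (\<kappa> *\<^sub>R a)) + - (\<kappa> *\<^sub>R q)"
    by (simp add: x linear_neg[OF assms(1)] linear_scale[OF assms(1)] algebra_simps)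
  then show ?case using Suc.IH[OF x(2)] assms(2)[OF x(3)] by (subst accumulate.simps(2)) blast
qed auto

lemma accumulate_step_in_UN:
  assumes "y \<in> (\<Union>k. accumulate M Q k)" "q \<in> Q"
  shows "M y + q \<in> (\<Union>k. accumulate M Q k)"
proof -
  obtain k where "y \<in> accumulate M Q k" using assms(1) by blast
  then have "M y + q \<in> accumulate M Q (Suc k)" using assms(2) by auto
  then show ?thesis by blast
qed

text \<open>
  Suppose that \<open>x\<close> can be separated from the union \<open>S\<close> of the accumulated sets by a functional
  \<open>h\<close>. Let \<open>W\<close> be the space of functionals bounded on \<open>S\<close> and \<open>p\<close> the support function of \<open>S\<close>. From
  \<open>M S + Q \<subseteq> S\<close>, and since \<open>Q\<close> contains a ball of \<open>span Q\<close> of radius \<open>c\<close>, one gets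
  \<open>p (M\<^sup>* g) \<le> p g - c \<bar>g\<bar>\<close>, where \<open>\<bar>g\<bar>\<close> is the norm of the part of \<open>g\<close> seen by \<open>span Q\<close>. As \<open>W\<close> is
  finite-dimensional, \<open>p g \<le> K \<bar>g\<bar>\<close>, hence \<open>p (M\<^sup>* g) \<le> \<theta> p g\<close> with \<open>\<theta> < 1\<close>. Thus
  \<open>h \<bullet> x = (M\<^sup>*)\<^sup>k h \<bullet> N\<^sup>k x\<close> is a product of an exponentially decaying and a subexponential factor, so it
  is not positive, while separation from \<open>0 \<in> S\<close> makes it positive.
\<close>

theorem subexponential_in_closure_accumulate:
  fixes M N :: "'a::euclidean_space \<Rightarrow> 'a"
  assumes M: "linear M" and MN: "\<And>y. M (N y) = y"
    and MC: "M ` span Q \<subseteq> span Q" and NC: "N ` span Q \<subseteq> span Q"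
    and Q: "convex Q" "0 \<in> Q" and \<kappa>: "0 < \<kappa>" "\<And>q. q \<in> Q \<Longrightarrow> - (\<kappa> *\<^sub>R q) \<in> Q"
    and x: "x \<in> span Q"
    and grow: "\<And>\<eta>. 0 < \<eta> \<Longrightarrow> \<exists>D. \<forall>k. norm ((N ^^ k) x) \<le> D * exp (\<eta> * real k)"
  shows "x \<in> closure (\<Union>k. accumulate M Q k)"
proof (rule ccontr)
  define S where "S = (\<Union>k. accumulate M Q k)"
  have SQ: "Q \<subseteq> S"
  proof
    fix q assume "q \<in> Q"
    then have "q \<in> accumulate M Q (Suc 0)" by (auto simp: linear_0[OF M])
    then show "q \<in> S" unfolding S_def by blast
  qed
  have S0: "0 \<in> S" using SQ Q by blast
  have stepS: "M y + q \<in> S" if "y \<in> S" "q \<in> Q" for y q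
    using accumulate_step_in_UN that unfolding S_def by blast
  have acc_C: "accumulate M Q k \<subseteq> span Q" for k
  proof (induction k)
    case (Suc k)
    show ?case
    proof
      fix y assume "y \<in> accumulate M Q (Suc k)"
      then obtain a q where "y = M a + q" "a \<in> accumulate M Q k" "q \<in> Q" by auto
      then show "y \<in> span Q" using Suc MC by (auto intro: span_add span_base)
    qed
  qed (auto simp: span_zero)
  then have SC: "S \<subseteq> span Q" unfolding S_def by blast
  have symS: "- (\<kappa> *\<^sub>R y) \<in> S" if "y \<in> S" for y
    using that accumulate_sym[OF M \<kappa>(2)] unfolding S_def by blast
  assume "x \<notin> closure (\<Union>k. accumulate M Q k)"
  then have "x \<notin> closure S" by (simp add: S_def)
  moreover have "convex (closure S)" unfolding S_def by (intro convex_closure convex_UN_accumulate M Q)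
  ultimately obtain a b where ab: "a \<bullet> x < b" "\<forall>y\<in>closure S. a \<bullet> y > b"
    using separating_hyperplane_closed_point[OF _ closed_closure] by blast
  define h where "h = - a"
  have hx: "h \<bullet> x > - b" using ab(1) by (simp add: h_def)
  have hS: "h \<bullet> y < - b" if "y \<in> S" for y
  proof -
    have "a \<bullet> y > b" using ab(2) that closure_subset by blast
    then show ?thesis by (simp add: h_def)
  qed
  define W where "W = {g. \<exists>c. \<forall>y\<in>S. \<bar>g \<bullet> y\<bar> \<le> c}"
  have subW: "subspace W"
    unfolding subspace_def W_def
  proof (safe, goal_cases)
    case (2 g g' c c')
    then have "\<forall>y\<in>S. \<bar>(g + g') \<bullet> y\<bar> \<le> c + c'"
      by (auto simp: inner_add_left intro: order_trans[OF abs_triangle_ineq] add_mono)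
    then show ?case by blast
  next
    case (3 r g c)
    then have "\<forall>y\<in>S. \<bar>(r *\<^sub>R g) \<bullet> y\<bar> \<le> \<bar>r\<bar> * c"
      by (auto simp: abs_mult intro: mult_left_mono)
    then show ?case by blast
  qed auto
  obtain K0 where K0: "K0 > 0"
      "\<And>g y. g \<in> W \<Longrightarrow> y \<in> S \<Longrightarrow> norm (g \<bullet> y) \<le> K0 * norm g * 1"
  proof -
    have "\<exists>K>0. \<forall>g\<in>W. \<forall>y\<in>S. norm (g \<bullet> y) \<le> K * norm g * 1"
      by (rule uniform_bound_on_subspace[OF subW]) (auto simp: W_def intro!: linearI inner_add_left)
    then show ?thesis using that by blast
  qed
  obtain c where c: "c > 0" "\<And>y. y \<in> span Q \<Longrightarrow> norm y \<le> c \<Longrightarrow> y \<in> Q"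
    using cball_Int_span_subset[OF Q \<kappa>] by blast
  \<comment> \<open>Enlarging the constant to at least \<open>c\<close> keeps the contraction factor nonnegative.\<close>
  define K where "K = max K0 c"
  have K: "K > 0" "K \<ge> c" "K \<ge> K0" using K0 by (auto simp: K_def)
  define \<theta> where "\<theta> = 1 - c / K"
  have \<theta>: "0 \<le> \<theta>" "\<theta> < 1" using K c by (auto simp: \<theta>_def)
  define p where "p g = (SUP y\<in>S. g \<bullet> y)" for g
  have bdd: "bdd_above ((\<lambda>y. g \<bullet> y) ` S)" if "g \<in> W" for g
    using that abs_le_D1 unfolding W_def bdd_above_def by blast
  have p_upper: "g \<bullet> y \<le> p g" if "g \<in> W" "y \<in> S" for g y
    unfolding p_def using bdd[OF that(1)] that(2) by (rule cSUP_upper2) simp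
  have p_nonneg: "0 \<le> p g" if "g \<in> W" for g using p_upper[OF that S0] by simp
  have contract: "adjoint M g \<in> W \<and> p (adjoint M g) \<le> \<theta> * p g" if g: "g \<in> W" for g
  proof
    have adj: "adjoint M g \<bullet> y = g \<bullet> M y" for y
      using adjoint_works[OF M, of y g] by (simp add: inner_commute)
    show "adjoint M g \<in> W"
    proof -
      obtain d where "\<forall>y\<in>S. \<bar>g \<bullet> y\<bar> \<le> d" using g unfolding W_def by blast
      then have "\<forall>y\<in>S. \<bar>adjoint M g \<bullet> y\<bar> \<le> d" using stepS Q(2) by (fastforce simp: adj)
      then show ?thesis unfolding W_def by blast
    qed
    obtain w z where wz: "w \<in> span Q" "\<And>v. v \<in> span Q \<Longrightarrow> orthogonal z v" "g = w + z"
      by (rule orthogonal_subspace_decomp_exists[of Q g]) (rule that)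
    have gw: "g \<bullet> v = w \<bullet> v" if "v \<in> span Q" for v
      using wz that by (simp add: orthogonal_def inner_add_left)
    have "w \<in> W" using g gw SC unfolding W_def by fastforce
    have pK: "p g \<le> K * norm w"
      unfolding p_def
    proof (rule cSUP_least)
      fix y assume y: "y \<in> S"
      have "g \<bullet> y = w \<bullet> y" using gw SC y by blast
      also have "\<dots> \<le> K0 * norm w" using K0(2)[OF \<open>w \<in> W\<close> y] by simp
      also have "\<dots> \<le> K * norm w" using K by (intro mult_right_mono) auto
      finally show "g \<bullet> y \<le> K * norm w" .
    qed (use S0 in auto)
    \<comment> \<open>The element of the ball on which \<open>g\<close> is largest; for \<open>w = 0\<close> division by zero makes it \<open>0\<close>.\<close>
    define q where "q = (c / norm w) *\<^sub>R w"
    have qC: "q \<in> span Q" unfolding q_def using wz(1) by (rule span_scale)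
    have "q \<in> Q" using c qC by (auto simp: q_def)
    have gq: "g \<bullet> q = c * norm w"
      unfolding gw[OF qC] by (cases "w = 0") (auto simp: q_def dot_square_norm power2_eq_square)
    show "p (adjoint M g) \<le> \<theta> * p g"
      unfolding p_def[of "adjoint M g"]
    proof (rule cSUP_least)
      fix y assume "y \<in> S"
      have "adjoint M g \<bullet> y + c * norm w = g \<bullet> (M y + q)" by (simp add: adj inner_add_right gq)
      also have "\<dots> \<le> p g" using p_upper[OF g stepS[OF \<open>y \<in> S\<close> \<open>q \<in> Q\<close>]] .
      finally have "adjoint M g \<bullet> y \<le> p g - c * norm w" by simp
      moreover have "(c / K) * p g \<le> (c / K) * (K * norm w)"
        using pK c K by (intro mult_left_mono) auto
      ultimately show "adjoint M g \<bullet> y \<le> \<theta> * p g" using K by (simp add: \<theta>_def algebra_simps)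
    qed (use S0 in auto)
  qed
  have hW: "h \<in> W"
  proof -
    have "\<bar>h \<bullet> y\<bar> \<le> max (- b) (- b / \<kappa>)" if "y \<in> S" for y
    proof -
      have "\<kappa> * (- (h \<bullet> y)) \<le> - b" using hS[OF symS[OF that]] by simp
      then have "- (h \<bullet> y) \<le> - b / \<kappa>" using \<kappa> by (simp add: field_simps)
      then show ?thesis using hS[OF that] by auto
    qed
    then show ?thesis unfolding W_def by blast
  qed
  define hk where "hk k = (adjoint M ^^ k) h" for k
  have hk: "hk k \<in> W \<and> p (hk k) \<le> \<theta> ^ k * p h" for k
  proof (induction k)
    case 0
    then show ?case using hW by (simp add: hk_def)
  next
    case (Suc k)
    have "hk (Suc k) = adjoint M (hk k)" by (simp add: hk_def)
    moreover have "\<theta> * p (hk k) \<le> \<theta> * (\<theta> ^ k * p h)" using Suc \<theta> by (simp add: mult_left_mono)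
    ultimately show ?case using contract[of "hk k"] Suc by (fastforce simp: mult_ac)
  qed
  have hx_eq: "h \<bullet> x = hk k \<bullet> (N ^^ k) x" for k
  proof (induction k)
    case (Suc k)
    have "hk (Suc k) \<bullet> (N ^^ Suc k) x = hk k \<bullet> M (N ((N ^^ k) x))"
      using adjoint_works[OF M, of "N ((N ^^ k) x)" "hk k"] by (simp add: hk_def inner_commute)
    then show ?case using Suc MN by simp
  qed (simp add: hk_def)
  have NkC: "(N ^^ k) x \<in> span Q" for k
    using x NC by (induction k) auto
  have bound: "h \<bullet> x \<le> norm ((N ^^ k) x) / c * (\<theta> ^ k * p h)" for k
  proof (cases "(N ^^ k) x = 0")
    case True
    then show ?thesis using hx_eq[of k] by simp
  next
    case False
    define y where "y = (N ^^ k) x"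
    have "(c / norm y) *\<^sub>R y \<in> Q"
      using c NkC[of k] by (auto simp: y_def intro!: c(2) span_scale)
    then have "hk k \<bullet> ((c / norm y) *\<^sub>R y) \<le> p (hk k)" using hk SQ p_upper by blast
    also have "\<dots> \<le> \<theta> ^ k * p h" using hk by blast
    finally have "(norm y / c) * ((c / norm y) * (hk k \<bullet> y)) \<le> (norm y / c) * (\<theta> ^ k * p h)"
      using c by (intro mult_left_mono) auto
    moreover have "(norm y / c) * ((c / norm y) * (hk k \<bullet> y)) = hk k \<bullet> y"
      using c False by (simp add: y_def)
    ultimately show ?thesis using hx_eq[of k] by (simp add: y_def)
  qed
  \<comment> \<open>A growth rate so small that the decay by powers of \<open>\<theta>\<close> wins.\<close>
  define \<eta> where "\<eta> = (if \<theta> = 0 then 1 else - ln \<theta> / 2)"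
  have \<eta>: "\<eta> > 0" and lt1: "exp \<eta> * \<theta> < 1"
  proof -
    show "\<eta> > 0" using \<theta> by (auto simp: \<eta>_def)
    show "exp \<eta> * \<theta> < 1"
    proof (cases "\<theta> = 0")
      case False
      then have "\<theta> > 0" using \<theta> by simp
      then have "exp \<eta> * \<theta> = exp (\<eta> + ln \<theta>)" by (simp add: exp_add)
      also have "\<dots> < 1" using \<open>\<theta> > 0\<close> \<theta> by (simp add: \<eta>_def)
      finally show ?thesis .
    qed simp
  qed
  obtain D where D: "\<And>k. norm ((N ^^ k) x) \<le> D * exp (\<eta> * real k)" using grow[OF \<eta>] by blast
  have "h \<bullet> x \<le> (D / c * p h) * (exp \<eta> * \<theta>) ^ k" for k
  proof -
    have "norm ((N ^^ k) x) / c * (\<theta> ^ k * p h) \<le> (D * exp (\<eta> * real k)) / c * (\<theta> ^ k * p h)"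
      using c \<theta> p_nonneg[OF hW] D by (intro mult_right_mono divide_right_mono) auto
    also have "\<dots> = (D / c * p h) * (exp \<eta> * \<theta>) ^ k"
      by (simp add: power_mult_distrib exp_of_nat_mult mult.commute[of \<eta>])
    finally show ?thesis using bound[of k] by linarith
  qed
  moreover have "(\<lambda>k. (D / c * p h) * (exp \<eta> * \<theta>) ^ k) \<longlonglongrightarrow> (D / c * p h) * 0"
    using lt1 \<theta> by (intro tendsto_mult tendsto_const LIMSEQ_realpow_zero) auto
  ultimately have "h \<bullet> x \<le> D / c * p h * 0" by (intro LIMSEQ_le_const) auto
  then have "h \<bullet> x \<le> 0" by simp
  moreover have "0 < - b" using hS[OF S0] by simp
  ultimately show False using hx by linarith
qed

section \<open>Growth of the orbits of a linear group\<close>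

definition stable_space :: "(real \<Rightarrow> 'a::real_normed_vector \<Rightarrow> 'a) \<Rightarrow> 'a set" where
  "stable_space \<Phi> = {x. \<exists>a>0. \<exists>C. \<forall>t\<ge>0. norm (\<Phi> t x) \<le> C * exp (- (a * t))}"

definition subexponential_space :: "(real \<Rightarrow> 'a::real_normed_vector \<Rightarrow> 'a) \<Rightarrow> 'a set" where
  "subexponential_space \<Phi> = {x. \<forall>\<eta>>0. \<exists>C. \<forall>t\<ge>0. norm (\<Phi> t x) \<le> C * exp (\<eta> * t)}"

definition backward :: "(real \<Rightarrow> 'a \<Rightarrow> 'a) \<Rightarrow> real \<Rightarrow> 'a \<Rightarrow> 'a" where
  "backward \<Phi> t = \<Phi> (- t)"

lemma backward_backward [simp]: "backward (backward \<Phi>) = \<Phi>"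
  by (simp add: backward_def fun_eq_iff)

text \<open>
  For the flow of a matrix this is the center Lyapunov space.
\<close>

definition neutral_space :: "(real \<Rightarrow> 'a::real_normed_vector \<Rightarrow> 'a) \<Rightarrow> 'a set" where
  "neutral_space \<Phi> = subexponential_space \<Phi> \<inter> subexponential_space (backward \<Phi>)"

lemma tendsto_exp_decay: "a > 0 \<Longrightarrow> ((\<lambda>t. c * exp (- (a * t))) \<longlongrightarrow> 0) at_top" for a c :: real
proof -
  assume "a > 0"
  then have "filterlim (\<lambda>t. a * t) at_top at_top"
    by (intro filterlim_tendsto_pos_mult_at_top[OF tendsto_const _ filterlim_ident])
  then have "filterlim (\<lambda>t. - (a * t)) at_bot at_top" by (simp add: filterlim_uminus_at_bot)
  then have "((\<lambda>t. exp (- (a * t))) \<longlongrightarrow> 0) at_top" by (rule filterlim_compose[OF exp_at_bot])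
  then show ?thesis by (rule tendsto_mult_right_zero)
qed

lemma subspace_stable_space:
  assumes lin: "\<And>t. linear (\<Phi> t)"
  shows "subspace (stable_space \<Phi>)"
  unfolding subspace_def
proof (intro conjI allI ballI)
  show "0 \<in> stable_space \<Phi>"
    unfolding stable_space_def
    by (rule CollectI, rule exI[of _ 1], auto simp: linear_0[OF lin] intro: exI[of _ 0])
next
  fix x y assume "x \<in> stable_space \<Phi>" "y \<in> stable_space \<Phi>"
  then obtain a C b D where a: "a > 0" "\<And>t. t \<ge> 0 \<Longrightarrow> norm (\<Phi> t x) \<le> C * exp (- (a * t))"
    and b: "b > 0" "\<And>t. t \<ge> 0 \<Longrightarrow> norm (\<Phi> t y) \<le> D * exp (- (b * t))"
    unfolding stable_space_def by blast
  have "norm (\<Phi> t (x + y)) \<le> (\<bar>C\<bar> + \<bar>D\<bar>) * exp (- (min a b * t))" if "t \<ge> 0" for t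
  proof -
    have "C * exp (- (a * t)) \<le> \<bar>C\<bar> * exp (- (min a b * t))"
      using that by (intro mult_mono) (auto intro: mult_right_mono)
    moreover have "D * exp (- (b * t)) \<le> \<bar>D\<bar> * exp (- (min a b * t))"
      using that by (intro mult_mono) (auto intro: mult_right_mono)
    ultimately show ?thesis
      using a(2)[OF that] b(2)[OF that] norm_triangle_ineq[of "\<Phi> t x" "\<Phi> t y"]
      by (simp add: linear_add[OF lin] distrib_right)
  qed
  then show "x + y \<in> stable_space \<Phi>"
    unfolding stable_space_def using a(1) b(1) min_less_iff_conj by blast
next
  fix c x assume "x \<in> stable_space \<Phi>"
  then obtain a C where a: "a > 0" "\<And>t. t \<ge> 0 \<Longrightarrow> norm (\<Phi> t x) \<le> C * exp (- (a * t))"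
    unfolding stable_space_def by blast
  have "norm (\<Phi> t (c *\<^sub>R x)) \<le> (\<bar>c\<bar> * C) * exp (- (a * t))" if "t \<ge> 0" for t
    using mult_left_mono[OF a(2)[OF that], of "\<bar>c\<bar>"] by (simp add: linear_scale[OF lin] mult.assoc)
  then show "c *\<^sub>R x \<in> stable_space \<Phi>"
    unfolding stable_space_def using a(1) by blast
qed

lemma subspace_subexponential_space:
  assumes lin: "\<And>t. linear (\<Phi> t)"
  shows "subspace (subexponential_space \<Phi>)"
  unfolding subspace_def
proof (intro conjI allI ballI)
  show "0 \<in> subexponential_space \<Phi>"
    unfolding subexponential_space_def by (auto simp: linear_0[OF lin] intro!: exI[of _ 0])
next
  fix x y assume *: "x \<in> subexponential_space \<Phi>" "y \<in> subexponential_space \<Phi>"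
  show "x + y \<in> subexponential_space \<Phi>"
    unfolding subexponential_space_def
  proof safe
    fix \<eta> :: real assume "\<eta> > 0"
    then obtain C D where "\<And>t. t \<ge> 0 \<Longrightarrow> norm (\<Phi> t x) \<le> C * exp (\<eta> * t)"
      and "\<And>t. t \<ge> 0 \<Longrightarrow> norm (\<Phi> t y) \<le> D * exp (\<eta> * t)"
      using * unfolding subexponential_space_def by blast
    then have "norm (\<Phi> t (x + y)) \<le> (C + D) * exp (\<eta> * t)" if "t \<ge> 0" for t
      unfolding linear_add[OF lin] distrib_right
      using that norm_triangle_le add_mono by blast
    then show "\<exists>C. \<forall>t\<ge>0. norm (\<Phi> t (x + y)) \<le> C * exp (\<eta> * t)" by blast
  qed
next
  fix c x assume *: "x \<in> subexponential_space \<Phi>"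
  show "c *\<^sub>R x \<in> subexponential_space \<Phi>"
    unfolding subexponential_space_def
  proof safe
    fix \<eta> :: real assume "\<eta> > 0"
    then obtain C where C: "\<And>t. t \<ge> 0 \<Longrightarrow> norm (\<Phi> t x) \<le> C * exp (\<eta> * t)"
      using * unfolding subexponential_space_def by blast
    have "norm (\<Phi> t (c *\<^sub>R x)) \<le> (\<bar>c\<bar> * C) * exp (\<eta> * t)" if "t \<ge> 0" for t
      using mult_left_mono[OF C[OF that], of "\<bar>c\<bar>"] by (simp add: linear_scale[OF lin] mult.assoc)
    then show "\<exists>C. \<forall>t\<ge>0. norm (\<Phi> t (c *\<^sub>R x)) \<le> C * exp (\<eta> * t)" by blast
  qed
qed

lemma stable_subset_subexponential: "stable_space \<Phi> \<subseteq> subexponential_space \<Phi>"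
proof
  fix x assume "x \<in> stable_space \<Phi>"
  then obtain a C where a: "a > 0" "\<And>t. t \<ge> 0 \<Longrightarrow> norm (\<Phi> t x) \<le> C * exp (- (a * t))"
    unfolding stable_space_def by blast
  have "norm (\<Phi> t x) \<le> \<bar>C\<bar> * exp (\<eta> * t)" if "\<eta> > 0" "t \<ge> 0" for \<eta> t
  proof -
    have "C * exp (- (a * t)) \<le> \<bar>C\<bar> * exp (\<eta> * t)"
    proof (rule mult_mono)
      show "exp (- (a * t)) \<le> exp (\<eta> * t)"
        using that a(1) by (simp add: order_trans[of _ 0])
    qed auto
    then show ?thesis using a(2)[OF that(2)] by linarith
  qed
  then show "x \<in> subexponential_space \<Phi>" unfolding subexponential_space_def by blast
qed

text \<open>
  The last assumption is the only spectral information that the argument needs: stable, unstable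
  and neutral vectors span every invariant subspace. It is required for all invariant subspaces, not
  just for the whole space, because it is applied to the subspace spanned by the reachable set.
\<close>

locale linear_group =
  fixes \<Phi> :: "real \<Rightarrow> 'a::euclidean_space \<Rightarrow> 'a"
  assumes linear_group: "linear (\<Phi> t)"
    and group_0 [simp]: "\<Phi> 0 x = x"
    and group_add: "\<Phi> (s + t) x = \<Phi> s (\<Phi> t x)"
    and spectral_splitting: "\<lbrakk>subspace C; \<And>t. \<Phi> t ` C \<subseteq> C; x \<in> C\<rbrakk> \<Longrightarrow>
      \<exists>s\<in>C \<inter> stable_space \<Phi>. \<exists>u\<in>C \<inter> stable_space (backward \<Phi>). x - s - u \<in> neutral_space \<Phi>"
begin

lemma group_inverse [simp]: "\<Phi> (- t) (\<Phi> t x) = x" "\<Phi> t (\<Phi> (- t) x) = x"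
  using group_add[of "- t" t x] group_add[of t "- t" x] by simp_all

lemma reversed_group: "linear_group (backward \<Phi>)"
proof
  fix C x assume C: "subspace C" "\<And>t. backward \<Phi> t ` C \<subseteq> C" "x \<in> C"
  have "\<Phi> t ` C \<subseteq> C" for t using C(2)[of "- t"] by (simp add: backward_def)
  from spectral_splitting[OF C(1) this C(3)] obtain s u where
    "s \<in> C \<inter> stable_space \<Phi>" "u \<in> C \<inter> stable_space (backward \<Phi>)" "x - s - u \<in> neutral_space \<Phi>"
    by blast
  moreover have "x - u - s = x - s - u" by simp
  ultimately show "\<exists>s\<in>C \<inter> stable_space (backward \<Phi>). \<exists>u\<in>C \<inter> stable_space (backward (backward \<Phi>)).
      x - s - u \<in> neutral_space (backward \<Phi>)"
    unfolding neutral_space_def by (metis Int_commute backward_backward)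
qed (simp_all add: backward_def linear_add[OF linear_group] linear_scale[OF linear_group] flip: group_add add.commute)

abbreviation "Lstab \<equiv> stable_space \<Phi>"
text \<open>
  The space \<open>V\<^sup>+\<close> of the introduction. It contains the unstable and the neutral vectors.
\<close>

abbreviation "Vunst \<equiv> subexponential_space (backward \<Phi>)"

lemma subspace_Lstab: "subspace Lstab" and subspace_Vunst: "subspace Vunst"
  by (intro subspace_stable_space subspace_subexponential_space; simp add: linear_group backward_def)+

lemma Vunst_invariant:
  assumes "x \<in> Vunst" shows "\<Phi> t x \<in> Vunst"
  unfolding subexponential_space_def
proof safe
  fix \<eta> :: real assume "\<eta> > 0"
  then obtain C where C: "\<And>s. s \<ge> 0 \<Longrightarrow> norm (\<Phi> (- s) x) \<le> C * exp (\<eta> * s)"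
    using assms unfolding subexponential_space_def backward_def by blast
  obtain K where K: "\<And>y. norm (\<Phi> t y) \<le> norm y * K" "K > 0"
    using bounded_linear.pos_bounded[OF linear_conv_bounded_linear[THEN iffD1, OF linear_group[of t]]]
    by blast
  have "norm (backward \<Phi> s (\<Phi> t x)) \<le> (C * K) * exp (\<eta> * s)" if "s \<ge> 0" for s
  proof -
    have "backward \<Phi> s (\<Phi> t x) = \<Phi> t (\<Phi> (- s) x)"
      by (simp add: backward_def group_add[symmetric])
    then have "norm (backward \<Phi> s (\<Phi> t x)) \<le> norm (\<Phi> (- s) x) * K" using K(1) by simp
    also have "\<dots> \<le> (C * exp (\<eta> * s)) * K" using C[OF that] K(2) by (intro mult_right_mono) auto
    finally show ?thesis by (simp add: mult_ac)
  qed
  then show "\<exists>C. \<forall>s\<ge>0. norm (backward \<Phi> s (\<Phi> t x)) \<le> C * exp (\<eta> * s)" by blast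
qed

text \<open>
  A vector \<open>x = \<Phi> (- t) (\<Phi> t x)\<close> with exponentially decaying forward orbit would need exponential
  backward growth, and on the subspace of subexponential vectors the growth is uniform.
\<close>

lemma Lstab_Int_Vunst: 
  assumes "x \<in> Lstab" "x \<in> Vunst" shows "x = 0"
proof -
  obtain a C where a: "a > 0" "\<And>t. t \<ge> 0 \<Longrightarrow> norm (\<Phi> t x) \<le> C * exp (- (a * t))"
    using assms(1) unfolding stable_space_def by blast
  have "\<exists>D. \<forall>t\<in>{0..}. norm (backward \<Phi> t y) \<le> D * exp (a / 2 * t)" if "y \<in> Vunst" for y
    using that half_gt_zero[OF a(1)] unfolding subexponential_space_def by blast
  then have "\<exists>K>0. \<forall>y\<in>Vunst. \<forall>t\<in>{0..}. norm (backward \<Phi> t y) \<le> K * norm y * exp (a / 2 * t)"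
    by (intro uniform_bound_on_subspace[OF subspace_Vunst]) (auto simp: backward_def linear_group)
  then obtain K where K: "K > 0" and
    K': "\<And>y t. y \<in> Vunst \<Longrightarrow> t \<in> {0..} \<Longrightarrow> norm (backward \<Phi> t y) \<le> K * norm y * exp (a / 2 * t)"
    by blast
  have "norm x \<le> K * C * exp (- (a / 2 * t))" if "t \<ge> 0" for t
  proof -
    have "norm x \<le> K * norm (\<Phi> t x) * exp (a / 2 * t)"
      using K'[OF Vunst_invariant[OF assms(2)], of t t] that by (simp add: backward_def)
    also have "\<dots> \<le> K * (C * exp (- (a * t))) * exp (a / 2 * t)"
      using a(2)[OF that] K by (intro mult_right_mono mult_left_mono) auto
    also have "\<dots> = K * C * exp (- (a / 2 * t))"
      by (simp add: mult_exp_exp)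
    finally show ?thesis .
  qed
  then have "eventually (\<lambda>t. norm x \<le> K * C * exp (- (a / 2 * t))) at_top"
    by (intro eventually_at_top_linorderI[of 0]) blast
  moreover have "((\<lambda>t. K * C * exp (- (a / 2 * t))) \<longlongrightarrow> 0) at_top"
    using a(1) by (intro tendsto_exp_decay) simp
  ultimately have "norm x \<le> 0" by (intro tendsto_lowerbound) auto
  then show ?thesis by simp
qed

lemma splitting_Lstab_Vunst:
  assumes "subspace C" "\<And>t. \<Phi> t ` C \<subseteq> C" "x \<in> C"
  obtains s where "s \<in> C \<inter> Lstab" "x - s \<in> C \<inter> Vunst"
proof -
  obtain s u where su: "s \<in> C \<inter> stable_space \<Phi>" "u \<in> C \<inter> stable_space (backward \<Phi>)"
    "x - s - u \<in> neutral_space \<Phi>" using spectral_splitting[OF assms] by blast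
  have "(x - s - u) + u \<in> Vunst"
    using su stable_subset_subexponential[of "backward \<Phi>"]
    by (intro subspace_add[OF subspace_Vunst]) (auto simp: neutral_space_def)
  moreover have "x - s \<in> C" using su assms subspace_diff by blast
  ultimately show ?thesis using su that by simp
qed

text \<open>
  The projection onto the stable space along the vectors of subexponential backward growth. It
  restricts to every invariant subspace because the splitting exists there and is unique.
\<close>

lemma stable_projection:
  obtains P a D where "linear P" "a > 0" "D \<ge> 0" "\<And>x. x - P x \<in> Vunst" "\<And>x. P x \<in> Lstab"
    "\<And>v. v \<in> Vunst \<Longrightarrow> P v = 0"
    "\<And>x t. t \<ge> 0 \<Longrightarrow> norm (\<Phi> t (P x)) \<le> D * norm x * exp (- (a * t))"
    "\<forall>C. subspace C \<longrightarrow> (\<forall>t. \<Phi> t ` C \<subseteq> C) \<longrightarrow> P ` C \<subseteq> C"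
proof -
  have "\<exists>s. s \<in> Lstab \<and> x - s \<in> Vunst" for x
    using splitting_Lstab_Vunst[of UNIV x] by auto
  then obtain p where p: "\<And>x. p x \<in> Lstab" "\<And>x. x - p x \<in> Vunst" by metis
  have uniq: "p x = s" if "s \<in> Lstab" "x - s \<in> Vunst" for x s
  proof -
    have "p x - s \<in> Lstab" using p that subspace_Lstab subspace_diff by blast
    moreover have "(x - s) - (x - p x) \<in> Vunst" using p that subspace_Vunst subspace_diff by blast
    ultimately show ?thesis using Lstab_Int_Vunst[of "p x - s"] by simp
  qed
  have lin: "linear p"
  proof (rule linearI)
    fix x y show "p (x + y) = p x + p y"
    proof (rule uniq)
      have "(x - p x) + (y - p y) \<in> Vunst" using p subspace_Vunst subspace_add by blast
      then show "x + y - (p x + p y) \<in> Vunst" by (simp add: algebra_simps)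
    qed (use p subspace_Lstab subspace_add in blast)
  next
    fix c x show "p (c *\<^sub>R x) = c *\<^sub>R p x"
    proof (rule uniq)
      have "c *\<^sub>R (x - p x) \<in> Vunst" using p subspace_Vunst subspace_scale by blast
      then show "c *\<^sub>R x - c *\<^sub>R p x \<in> Vunst" by (simp add: algebra_simps)
    qed (use p subspace_Lstab subspace_scale in blast)
  qed
  have "\<forall>b\<in>Basis. \<exists>a>0. \<exists>C. \<forall>t\<ge>0. norm (\<Phi> t (p b)) \<le> C * exp (- (a * t))"
    using p(1) unfolding stable_space_def by blast
  then obtain \<alpha> C where \<alpha>: "\<And>b::'a. b \<in> Basis \<Longrightarrow> \<alpha> b > (0::real)"
    and C: "\<And>b t. b \<in> Basis \<Longrightarrow> t \<ge> 0 \<Longrightarrow> norm (\<Phi> t (p b)) \<le> C b * exp (- (\<alpha> b * t))"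
    by metis
  define a where "a = Min (\<alpha> ` Basis)"
  have a: "a > 0" "\<And>b. b \<in> Basis \<Longrightarrow> a \<le> \<alpha> b"
    using \<alpha> by (auto simp: a_def Min_gr_iff)
  define D where "D = (\<Sum>b\<in>Basis. \<bar>C b\<bar>)"
  have "norm (\<Phi> t (p x)) \<le> D * norm x * exp (- (a * t))" if t: "t \<ge> 0" for x t
  proof -
    have "\<Phi> t (p x) = \<Phi> t (p (\<Sum>b\<in>Basis. (x \<bullet> b) *\<^sub>R b))" by (simp add: euclidean_representation)
    also have "\<dots> = (\<Sum>b\<in>Basis. (x \<bullet> b) *\<^sub>R \<Phi> t (p b))"
      by (simp add: linear_sum[OF lin] linear_scale[OF lin] linear_sum[OF linear_group]
          linear_scale[OF linear_group])
    finally have eq: "\<Phi> t (p x) = (\<Sum>b\<in>Basis. (x \<bullet> b) *\<^sub>R \<Phi> t (p b))" .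
    have "norm (\<Phi> t (p x)) \<le> (\<Sum>b\<in>Basis. norm x * (\<bar>C b\<bar> * exp (- (a * t))))"
      unfolding eq
    proof (rule sum_norm_le)
      fix b :: 'a assume b: "b \<in> Basis"
      have "norm (\<Phi> t (p b)) \<le> C b * exp (- (\<alpha> b * t))" using C[OF b t] .
      also have "\<dots> \<le> \<bar>C b\<bar> * exp (- (a * t))"
        using a(2)[OF b] t by (intro mult_mono) (auto intro: mult_right_mono)
      finally show "norm ((x \<bullet> b) *\<^sub>R \<Phi> t (p b)) \<le> norm x * (\<bar>C b\<bar> * exp (- (a * t)))"
        using Basis_le_norm[OF b, of x] by (simp add: mult_mono)
    qed
    also have "\<dots> = D * norm x * exp (- (a * t))"
      by (simp add: D_def sum_distrib_left sum_distrib_right mult_ac)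
    finally show ?thesis .
  qed
  moreover have "\<forall>C. subspace C \<longrightarrow> (\<forall>t. \<Phi> t ` C \<subseteq> C) \<longrightarrow> p ` C \<subseteq> C"
  proof (intro allI impI image_subsetI)
    fix C x assume C: "subspace C" "\<forall>t. \<Phi> t ` C \<subseteq> C" "x \<in> C"
    obtain s where s: "s \<in> C \<inter> Lstab" "x - s \<in> C \<inter> Vunst"
      using splitting_Lstab_Vunst[OF C(1) _ C(3)] C(2) by blast
    then have "p x = s" by (intro uniq) auto
    then show "p x \<in> C" using s by simp
  qed
  moreover have "p v = 0" if "v \<in> Vunst" for v
    using that subspace_0[OF subspace_Lstab] by (intro uniq) auto
  ultimately show ?thesis
    using that[of p a D] lin a(1) p by (auto simp: D_def sum_nonneg)
qed

end

section \<open>Abstract reachable sets, chains and recurrence\<close>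

definition total_reach :: "(real \<Rightarrow> 'a set) \<Rightarrow> 'a set" where
  "total_reach R = (\<Union>t\<in>{0..}. R t)"

text \<open>
  If \<open>R t\<close> is reached from the origin at time \<open>t\<close>, these are the points \<open>x\<close> with
  \<open>0 \<in> \<Phi> t x + R t\<close>, which can be steered to the origin in time \<open>t\<close>.
\<close>

definition backward_reach :: "(real \<Rightarrow> 'a::real_vector \<Rightarrow> 'a) \<Rightarrow> (real \<Rightarrow> 'a set) \<Rightarrow> real \<Rightarrow> 'a set" where
  "backward_reach \<Phi> R t = (\<lambda>r. - \<Phi> (- t) r) ` R t"

definition stable_hull :: "(real \<Rightarrow> 'a::real_normed_vector \<Rightarrow> 'a) \<Rightarrow> (real \<Rightarrow> 'a set) \<Rightarrow> 'a set" where
  "stable_hull \<Phi> R = closure {r + v |r v. r \<in> total_reach R \<and> v \<in> subexponential_space (backward \<Phi>)}"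

text \<open>
  The candidate for the chain control set. The first set bounds the stable part of a point, the
  second one its unstable part, and nothing restricts the neutral part.
\<close>

definition chain_hull :: "(real \<Rightarrow> 'a::real_normed_vector \<Rightarrow> 'a) \<Rightarrow> (real \<Rightarrow> 'a set) \<Rightarrow> 'a set" where
  "chain_hull \<Phi> R = stable_hull \<Phi> R \<inter> stable_hull (backward \<Phi>) (backward_reach \<Phi> R)"

definition jump_step ::
    "(real \<Rightarrow> 'a::real_normed_vector \<Rightarrow> 'a) \<Rightarrow> (real \<Rightarrow> 'a set) \<Rightarrow> real \<Rightarrow> real \<Rightarrow> 'a \<Rightarrow> 'a \<Rightarrow> bool" where
  "jump_step \<Phi> R \<epsilon> T x y \<longleftrightarrow> (\<exists>t\<ge>T. \<exists>r\<in>R t. norm (\<Phi> t x + r - y) < \<epsilon>)"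

text \<open>
  Time reversal moves the jump from the end of a step to its beginning. Steps with a jump at both
  ends cover both directions of time.
\<close>

definition two_sided_step ::
    "(real \<Rightarrow> 'a::real_normed_vector \<Rightarrow> 'a) \<Rightarrow> (real \<Rightarrow> 'a set) \<Rightarrow> real \<Rightarrow> real \<Rightarrow> 'a \<Rightarrow> 'a \<Rightarrow> bool" where
  "two_sided_step \<Phi> R \<epsilon> T x y \<longleftrightarrow>
    (\<exists>t\<ge>T. \<exists>r\<in>R t. \<exists>d e. norm d < \<epsilon> \<and> norm e < \<epsilon> \<and> y = \<Phi> t (x + d) + r + e)"

definition timed_step ::
    "(real \<Rightarrow> 'a::real_normed_vector \<Rightarrow> 'a) \<Rightarrow> (real \<Rightarrow> 'a set) \<Rightarrow> real \<Rightarrow> real \<Rightarrow> 'a \<Rightarrow> 'a \<Rightarrow> bool" where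
  "timed_step \<Phi> R \<epsilon> T x y \<longleftrightarrow> (\<exists>r\<in>R T. norm (\<Phi> T x + r - y) < \<epsilon>)"

lemma tranclp_le:
  assumes "r\<^sup>+\<^sup>+ x y" "r \<le> s" shows "s\<^sup>+\<^sup>+ x y"
  using assms(1)
proof (induction rule: tranclp_induct)
  case (step y z)
  then show ?case using assms(2) by (meson predicate2D tranclp.trancl_into_trancl)
qed (use assms(2) in auto)

locale reachability = linear_group \<Phi> for \<Phi> :: "real \<Rightarrow> 'a::euclidean_space \<Rightarrow> 'a" +
  fixes R :: "real \<Rightarrow> 'a set" and \<kappa> :: real
  assumes \<kappa>: "0 < \<kappa>"
    and convex_R: "0 \<le> t \<Longrightarrow> convex (R t)"
    and zero_R: "0 \<le> t \<Longrightarrow> 0 \<in> R t"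
    and R_sym: "0 \<le> t \<Longrightarrow> r \<in> R t \<Longrightarrow> - (\<kappa> *\<^sub>R r) \<in> R t"
    and R_add: "0 \<le> s \<Longrightarrow> 0 \<le> t \<Longrightarrow> R (s + t) = {\<Phi> t a + b |a b. a \<in> R s \<and> b \<in> R t}"
begin

lemma reversed: "reachability (backward \<Phi>) (backward_reach \<Phi> R) \<kappa>"
proof -
  interpret rev: linear_group "backward \<Phi>" by (rule reversed_group)
  show ?thesis
  proof
    fix t :: real assume t: "0 \<le> t"
    have "linear (\<lambda>r. - \<Phi> (- t) r)" by (intro linear_compose_neg linear_group)
    then show "convex (backward_reach \<Phi> R t)"
      unfolding backward_reach_def by (rule convex_linear_image[OF _ convex_R[OF t]])
    show "0 \<in> backward_reach \<Phi> R t"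
      unfolding backward_reach_def using zero_R[OF t] by (force simp: linear_0[OF linear_group])
    show "- (\<kappa> *\<^sub>R r) \<in> backward_reach \<Phi> R t" if "r \<in> backward_reach \<Phi> R t" for r
      using that R_sym[OF t] unfolding backward_reach_def
      by (force simp: linear_neg[OF linear_group] linear_scale[OF linear_group])
  next
    fix s t :: real assume st: "0 \<le> s" "0 \<le> t"
    have eq: "- \<Phi> (- (t + s)) (\<Phi> s a + b) = backward \<Phi> t (- \<Phi> (- s) b) + - \<Phi> (- t) a" for a b
      by (simp add: backward_def linear_add[OF linear_group] linear_neg[OF linear_group]
          group_add[symmetric])
    have "backward_reach \<Phi> R (s + t) = (\<lambda>r. - \<Phi> (- (t + s)) r) ` {\<Phi> s a + b |a b. a \<in> R t \<and> b \<in> R s}"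
      unfolding backward_reach_def using R_add[OF st(2,1)] by (simp add: add.commute)
    also have "\<dots> = {backward \<Phi> t (- \<Phi> (- s) b) + - \<Phi> (- t) a |a b. a \<in> R t \<and> b \<in> R s}"
      unfolding eq[symmetric] by blast
    also have "\<dots> = {backward \<Phi> t a + b |a b. a \<in> backward_reach \<Phi> R s \<and> b \<in> backward_reach \<Phi> R t}"
      unfolding backward_reach_def by blast
    finally show "backward_reach \<Phi> R (s + t) =
      {backward \<Phi> t a + b |a b. a \<in> backward_reach \<Phi> R s \<and> b \<in> backward_reach \<Phi> R t}" .
  qed (rule \<kappa>)
qed

lemma backward_backward_reach: "0 \<le> t \<Longrightarrow> backward_reach (backward \<Phi>) (backward_reach \<Phi> R) t = R t"
  by (auto simp: backward_reach_def backward_def image_image linear_neg[OF linear_group])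

lemma R_mono: assumes "0 \<le> s" "s \<le> t" shows "R s \<subseteq> R t"
proof
  fix x assume "x \<in> R s"
  then have "\<Phi> s 0 + x \<in> R ((t - s) + s)"
    using assms zero_R[of "t - s"] by (subst R_add) auto
  then show "x \<in> R t" by (simp add: linear_0[OF linear_group])
qed

lemma zero_reach: "0 \<in> total_reach R"
  unfolding total_reach_def using zero_R[of 0] by auto

lemma reach_step:
  assumes "x \<in> total_reach R" "0 \<le> t" "r \<in> R t"
  shows "\<Phi> t x + r \<in> total_reach R"
proof -
  obtain s where s: "0 \<le> s" "x \<in> R s" using assms(1) unfolding total_reach_def by auto
  then have "\<Phi> t x + r \<in> R (s + t)" using assms by (auto simp: R_add)
  then show ?thesis unfolding total_reach_def using s assms by (auto intro!: bexI[of _ "s + t"])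
qed

lemma convex_reach: "convex (total_reach R)"
  unfolding convex_def
proof (intro ballI allI impI)
  fix x y and u v :: real
  assume 1: "x \<in> total_reach R" "y \<in> total_reach R" "0 \<le> u" "0 \<le> v" "u + v = 1"
  then obtain s t where st: "0 \<le> s" "x \<in> R s" "0 \<le> t" "y \<in> R t" unfolding total_reach_def by auto
  then have "x \<in> R (max s t)" "y \<in> R (max s t)" using R_mono[of s "max s t"] R_mono[of t "max s t"] by auto
  then have "u *\<^sub>R x + v *\<^sub>R y \<in> R (max s t)" using st 1 by (intro convexD convex_R) auto
  then show "u *\<^sub>R x + v *\<^sub>R y \<in> total_reach R"
    unfolding total_reach_def using st by (auto intro!: bexI[of _ "max s t"])
qed

lemma reach_sym: "r \<in> total_reach R \<Longrightarrow> - (\<kappa> *\<^sub>R r) \<in> total_reach R"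
  unfolding total_reach_def using R_sym by auto

text \<open>
  For positive times invariance follows from steering with the zero control; a dimension count
  gives the inverse maps.
\<close>

lemma span_reach_invariant: "\<Phi> t ` span (total_reach R) \<subseteq> span (total_reach R)"
proof -
  let ?C = "span (total_reach R)"
  have pos: "\<Phi> s ` ?C \<subseteq> ?C" if "0 \<le> s" for s
  proof -
    have "\<Phi> s ` total_reach R \<subseteq> total_reach R" using reach_step[OF _ that zero_R[OF that]] by auto
    then have "span (\<Phi> s ` total_reach R) \<subseteq> ?C" by (rule span_mono)
    then show ?thesis by (simp add: linear_span_image[OF linear_group])
  qed
  show ?thesis
  proof (cases "0 \<le> t")
    case False
    have inj: "inj_on (\<Phi> (- t)) ?C"
      by (intro inj_onI) (metis group_inverse(2))
    have "\<Phi> (- t) ` ?C = ?C"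
    proof (rule subspace_dim_equal)
      show "subspace (\<Phi> (- t) ` ?C)" by (intro linear_subspace_image linear_group subspace_span)
      have "dim (\<Phi> (- t) ` ?C) = dim ?C"
        by (rule dim_image_eq[OF linear_group]) (use inj in \<open>simp only: span_span\<close>)
      then show "dim ?C \<le> dim (\<Phi> (- t) ` ?C)" by simp
    qed (use pos[of "- t"] False in auto)
    then have "\<Phi> t ` ?C = \<Phi> t ` \<Phi> (- t) ` ?C" by simp
    also have "\<dots> = ?C" by (simp add: image_image)
    finally show ?thesis by simp
  qed (rule pos)
qed

text \<open>
  The sets \<open>R t\<close> increase with \<open>t\<close>, and a finite basis of the span is reached in finite time.
\<close>

lemma span_R_eq_span_reach: "\<exists>T>0. span (R T) = span (total_reach R)"
proof -
  obtain B where B: "B \<subseteq> total_reach R" "independent B" "total_reach R \<subseteq> span B"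
    using maximal_independent_subset[of "total_reach R"] by blast
  then have fin: "finite B" using independent_imp_finite by blast
  have "\<forall>b\<in>B. \<exists>t\<ge>0. b \<in> R t" using B(1) unfolding total_reach_def by auto
  then obtain \<tau> where \<tau>: "\<And>b. b \<in> B \<Longrightarrow> 0 \<le> \<tau> b \<and> b \<in> R (\<tau> b)" by metis
  define T where "T = 1 + (\<Sum>b\<in>B. \<tau> b)"
  have "T > 0" unfolding T_def using \<tau> by (intro add_pos_nonneg sum_nonneg) auto
  have "B \<subseteq> R T"
  proof
    fix b assume b: "b \<in> B"
    have "\<tau> b \<le> (\<Sum>b\<in>B. \<tau> b)" using \<tau> by (intro member_le_sum b fin) auto
    then have "R (\<tau> b) \<subseteq> R T" using \<tau>[OF b] by (intro R_mono) (auto simp: T_def)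
    then show "b \<in> R T" using \<tau>[OF b] by auto
  qed
  then have "span (total_reach R) \<subseteq> span (R T)"
    using B(3) span_mono span_span by (metis order_trans)
  moreover have "R T \<subseteq> total_reach R" unfolding total_reach_def using \<open>T > 0\<close> less_imp_le by blast
  ultimately show ?thesis using \<open>T > 0\<close> span_mono by blast
qed

lemma funpow_group: "(\<Phi> t ^^ k) x = \<Phi> (real k * t) x"
  by (induction k) (auto simp: group_add[symmetric] algebra_simps)

lemma Vunst_discrete:
  assumes "x \<in> Vunst" "T > 0" "\<eta> > 0"
  shows "\<exists>D. \<forall>k. norm ((\<Phi> (- T) ^^ k) x) \<le> D * exp (\<eta> * real k)"
proof -
  have "\<eta> / T > 0" using assms by simp
  then obtain D where D: "\<And>t. t \<ge> 0 \<Longrightarrow> norm (\<Phi> (- t) x) \<le> D * exp (\<eta> / T * t)"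
    using assms(1) unfolding subexponential_space_def backward_def by blast
  have "norm ((\<Phi> (- T) ^^ k) x) \<le> D * exp (\<eta> * real k)" for k
    using D[of "real k * T"] assms by (simp add: funpow_group)
  then show ?thesis by blast
qed

lemma closure_accumulate_contains:
  assumes T: "T > 0" and Q: "convex Q" "0 \<in> Q" and k: "0 < k" "\<And>q. q \<in> Q \<Longrightarrow> - (k *\<^sub>R q) \<in> Q"
    and inv: "\<And>t. \<Phi> t ` span Q \<subseteq> span Q" and x: "x \<in> span Q" "x \<in> Vunst"
  shows "x \<in> closure (\<Union>k. accumulate (\<Phi> T) Q k)"
  by (rule subexponential_in_closure_accumulate[where N = "\<Phi> (- T)", OF linear_group _ inv inv Q k x(1)
        Vunst_discrete[OF x(2) T]]) simp_all

lemma accumulate_R_subset: "0 \<le> T \<Longrightarrow> accumulate (\<Phi> T) (R T) k \<subseteq> R (real k * T)"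
proof (induction k)
  case 0
  then show ?case using zero_R[of 0] by simp
next
  case (Suc k)
  have "R (real (Suc k) * T) = {\<Phi> T a + b |a b. a \<in> R (real k * T) \<and> b \<in> R T}"
    using R_add[of "real k * T" T] Suc.prems by (simp add: algebra_simps)
  then show ?case using Suc.IH[OF Suc.prems] by (simp only: accumulate.simps) blast
qed

text \<open>
  Unstable and neutral directions inside the span of the reachable set are completely reachable:
  the bounded controls produce a ball of fixed size in each time interval, and the dynamics does not
  shrink it fast enough to keep the accumulated sets bounded in such a direction.
\<close>

theorem Vunst_in_closure_reach:
  assumes "x \<in> span (total_reach R)" "x \<in> Vunst"
  shows "x \<in> closure (total_reach R)"
proof -
  obtain T where T: "T > 0" "span (R T) = span (total_reach R)" using span_R_eq_span_reach by blast
  have "x \<in> closure (\<Union>k. accumulate (\<Phi> T) (R T) k)"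
    using T assms span_reach_invariant \<kappa>
    by (intro closure_accumulate_contains[of T "R T" \<kappa>] convex_R zero_R R_sym) auto
  moreover have "(\<Union>k. accumulate (\<Phi> T) (R T) k) \<subseteq> total_reach R"
    using accumulate_R_subset[of T] T(1) unfolding total_reach_def by fastforce
  ultimately show ?thesis using closure_mono by blast
qed

text \<open>
  Admitting jumps adds a ball to \<open>R T\<close>, so that the span becomes the whole space. All directions
  in \<open>V\<^sup>+\<close> then become available, not only those in the span of the reachable set.
\<close>

lemma stable_hull_subset_closure_accumulate:
  assumes T: "T > 0" and \<epsilon>: "\<epsilon> > 0" and x: "x \<in> stable_hull \<Phi> R"
  defines "Q \<equiv> {r + e |r e. r \<in> R T \<and> e \<in> ball 0 \<epsilon>}"
  shows "x \<in> closure (\<Union>k. accumulate (\<Phi> T) Q k)"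
proof -
  let ?S = "\<Union>k. accumulate (\<Phi> T) Q k"
  have "Q = (\<Union>x\<in>R T. \<Union>y\<in>ball 0 \<epsilon>. {x + y})" unfolding Q_def by blast
  then have convQ: "convex Q" using convex_sums[OF convex_R convex_ball] T by simp
  have RQ: "R T \<subseteq> Q" using \<epsilon> by (force simp: Q_def)
  have ballQ: "ball 0 \<epsilon> \<subseteq> Q" using zero_R[of T] T by (force simp: Q_def)
  have Q0: "0 \<in> Q" using ballQ \<epsilon> by auto
  define k where "k = min 1 \<kappa>"
  have k: "0 < k" "k \<le> 1" using \<kappa> by (auto simp: k_def)
  have symQ: "- (k *\<^sub>R q) \<in> Q" if qQ: "q \<in> Q" for q
  proof -
    obtain r e where q: "q = r + e" "r \<in> R T" "norm e < \<epsilon>" using qQ by (auto simp: Q_def)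
    have "(k / \<kappa>) *\<^sub>R (- (\<kappa> *\<^sub>R r)) + (1 - k / \<kappa>) *\<^sub>R 0 \<in> R T"
      using T q(2) k \<kappa> by (intro convexD convex_R R_sym zero_R) (auto simp: k_def divide_simps)
    then have "- (k *\<^sub>R r) \<in> R T" using \<kappa> by simp
    moreover have "k * norm e \<le> 1 * norm e" using k by (intro mult_right_mono) auto
    then have "- (k *\<^sub>R e) \<in> ball 0 \<epsilon>" using q(3) k by simp
    moreover have "- (k *\<^sub>R q) = - (k *\<^sub>R r) + - (k *\<^sub>R e)" by (simp add: q(1) scaleR_add_right)
    ultimately show ?thesis unfolding Q_def by blast
  qed
  have spanQ: "span Q = UNIV"
  proof -
    have "0 \<in> interior (ball 0 \<epsilon>)" using \<epsilon> by simp
    then have "interior (span Q) \<noteq> {}"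
      using ballQ interior_mono[of "ball 0 \<epsilon>" "span Q"] span_superset[of Q] by blast
    then have "\<not> dim (span Q) < DIM('a)" using empty_interior_lowdim by blast
    then have "dim Q = DIM('a)" using dim_subset_UNIV[of Q] by simp
    then show ?thesis by (simp add: dim_eq_full)
  qed
  have VS: "Vunst \<subseteq> closure ?S"
    using closure_accumulate_contains[OF T convQ Q0 k(1) symQ] spanQ by auto
  have RS: "R (real j * T) \<subseteq> ?S" if "j > 0" for j
    using that
  proof (induction j rule: nat_induct_non_zero)
    case 1
    have "R T \<subseteq> accumulate (\<Phi> T) Q (Suc 0)" using RQ by (auto simp: linear_0[OF linear_group])
    then have "R T \<subseteq> ?S" by blast
    then show ?case by simp
  next
    case (Suc j)
    have "R (real (Suc j) * T) = {\<Phi> T a + b |a b. a \<in> R (real j * T) \<and> b \<in> R T}"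
      using R_add[of "real j * T" T] T by (simp add: algebra_simps)
    moreover have "\<Phi> T a + b \<in> ?S" if "a \<in> R (real j * T)" "b \<in> R T" for a b
      using that Suc.IH RQ by (intro accumulate_step_in_UN) auto
    ultimately show ?case by (simp only:) blast
  qed
  have reachS: "total_reach R \<subseteq> ?S"
  proof
    fix y assume "y \<in> total_reach R"
    then obtain t where t: "0 \<le> t" "y \<in> R t" unfolding total_reach_def by auto
    obtain j :: nat where j: "t / T < real j" using reals_Archimedean2 by blast
    have "0 \<le> t / T" using t(1) T by simp
    then have "j > 0" using j by (intro Nat.gr0I) auto
    have "t \<le> real j * T" using j T by (simp add: divide_simps)
    then have "y \<in> R (real j * T)" using R_mono[OF t(1)] t(2) by auto
    then show "y \<in> ?S" using RS[OF \<open>j > 0\<close>] by auto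
  qed
  have "convex ?S" by (intro convex_UN_accumulate linear_group convQ Q0)
  then have "r + v \<in> closure ?S" if "r \<in> total_reach R" "v \<in> Vunst" for r v
    using that reachS VS closure_subset[of ?S]
    by (intro mem_closure_add_subspace[OF _ _ subspace_Vunst]) (auto intro: convex_closure)
  then have "{r + v |r v. r \<in> total_reach R \<and> v \<in> Vunst} \<subseteq> closure ?S" by blast
  then have "stable_hull \<Phi> R \<subseteq> closure ?S" unfolding stable_hull_def by (intro closure_minimal) auto
  then show ?thesis using x by blast
qed

lemma chain_from_zero:
  assumes T: "T > 0" and \<epsilon>: "\<epsilon> > 0" and x: "x \<in> stable_hull \<Phi> R"
  shows "(timed_step \<Phi> R \<epsilon> T)\<^sup>+\<^sup>+ 0 x"
proof -
  define Q where "Q = {r + e |r e. r \<in> R T \<and> e \<in> ball 0 (\<epsilon> / 2)}"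
  have "0 \<in> Q" using zero_R[of T] T \<epsilon> by (force simp: Q_def)
  have "x \<in> closure (\<Union>k. accumulate (\<Phi> T) Q k)"
    unfolding Q_def using stable_hull_subset_closure_accumulate[OF T _ x, of "\<epsilon> / 2"] \<epsilon> by simp
  then obtain y where y: "y \<in> (\<Union>k. accumulate (\<Phi> T) Q k)" "dist y x < \<epsilon> / 2"
    using \<epsilon> closure_approachable[of x] by (meson half_gt_zero)
  then obtain k where "y \<in> accumulate (\<Phi> T) Q k" by blast
  then have "y \<in> accumulate (\<Phi> T) Q (Suc k)"
    using accumulate_mono_Suc[OF linear_group \<open>0 \<in> Q\<close>] by blast
  then obtain a r e where a: "a \<in> accumulate (\<Phi> T) Q k" and yeq: "y = \<Phi> T a + (r + e)"
    and r: "r \<in> R T" "norm e < \<epsilon> / 2" by (auto simp: Q_def)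
  have steps: "(timed_step \<Phi> R \<epsilon> T)\<^sup>*\<^sup>* 0 b" if "b \<in> accumulate (\<Phi> T) Q j" for b j
    using that
  proof (induction j arbitrary: b)
    case (Suc j)
    then obtain c r e where c: "c \<in> accumulate (\<Phi> T) Q j" "b = \<Phi> T c + (r + e)"
      "r \<in> R T" "norm e < \<epsilon> / 2" by (auto simp: Q_def)
    have "norm (\<Phi> T c + r - b) < \<epsilon>" using c(2,4) \<epsilon> by (simp add: algebra_simps)
    then have "timed_step \<Phi> R \<epsilon> T c b" unfolding timed_step_def using c(3) by blast
    then show ?case using Suc.IH[OF c(1)] by (rule rtranclp.rtrancl_into_rtrancl[rotated])
  qed simp
  have "norm (\<Phi> T a + r - x) = norm ((y - x) - e)" by (simp add: yeq algebra_simps)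
  also have "\<dots> \<le> norm (y - x) + norm e" by (rule norm_triangle_ineq4)
  also have "\<dots> < \<epsilon>" using y(2) r(2) by (simp add: dist_norm)
  finally have "timed_step \<Phi> R \<epsilon> T a x" unfolding timed_step_def using r(1) by blast
  then show ?thesis using steps[OF a] by (rule rtranclp_into_tranclp1[rotated])
qed

text \<open>
  Reading a chain of the reversed system backwards moves each jump in front of the flow map; the
  norm of \<open>\<Phi> T\<close> accounts for the change of size.
\<close>

lemma chain_to_zero:
  assumes T: "T > 0" and \<epsilon>: "\<epsilon> > 0" and x: "x \<in> stable_hull (backward \<Phi>) (backward_reach \<Phi> R)"
  shows "(timed_step \<Phi> R \<epsilon> T)\<^sup>+\<^sup>+ x 0"
proof -
  interpret rev: reachability "backward \<Phi>" "backward_reach \<Phi> R" \<kappa> by (rule reversed)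
  obtain K where K: "K > 0" "\<And>y. norm (\<Phi> T y) \<le> norm y * K"
    using bounded_linear.pos_bounded[OF linear_conv_bounded_linear[THEN iffD1, OF linear_group[of T]]]
    by blast
  let ?rev = "timed_step (backward \<Phi>) (backward_reach \<Phi> R) (\<epsilon> / K) T"
  have "?rev\<^sup>+\<^sup>+ 0 x" using rev.chain_from_zero[OF T _ x] K \<epsilon> by simp
  moreover have "?rev \<le> (timed_step \<Phi> R \<epsilon> T)\<inverse>\<inverse>"
  proof (intro predicate2I conversepI)
    fix y z assume "?rev y z"
    then obtain r where r: "r \<in> R T" "norm (\<Phi> (- T) y + - \<Phi> (- T) r - z) < \<epsilon> / K"
      unfolding timed_step_def backward_reach_def backward_def by blast
    have "\<Phi> T z + r - y = - \<Phi> T (\<Phi> (- T) y + - \<Phi> (- T) r - z)"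
      by (simp add: linear_add[OF linear_group] linear_diff[OF linear_group] linear_neg[OF linear_group])
    then have "norm (\<Phi> T z + r - y) \<le> norm (\<Phi> (- T) y + - \<Phi> (- T) r - z) * K"
      using K(2) by simp
    also have "\<dots> < \<epsilon>" using r(2) K(1) by (simp add: field_simps)
    finally show "timed_step \<Phi> R \<epsilon> T z y" unfolding timed_step_def using r(1) by blast
  qed
  ultimately have "((timed_step \<Phi> R \<epsilon> T)\<inverse>\<inverse>)\<^sup>+\<^sup>+ 0 x" by (rule tranclp_le)
  then show ?thesis by (simp add: tranclp_converse)
qed

theorem chain_hull_chain_transitive:
  assumes "T > 0" "\<epsilon> > 0" "x \<in> chain_hull \<Phi> R" "y \<in> chain_hull \<Phi> R"
  shows "(jump_step \<Phi> R \<epsilon> T)\<^sup>+\<^sup>+ x y"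
proof -
  have "(timed_step \<Phi> R \<epsilon> T)\<^sup>+\<^sup>+ x y"
    using chain_to_zero[OF assms(1,2)] chain_from_zero[OF assms(1,2)] assms(3,4)
    unfolding chain_hull_def by (meson IntD1 IntD2 tranclp_trans)
  moreover have "timed_step \<Phi> R \<epsilon> T \<le> jump_step \<Phi> R \<epsilon> T"
    unfolding timed_step_def jump_step_def by blast
  ultimately show ?thesis by (rule tranclp_le)
qed

lemma stable_hull_step:
  assumes "0 \<le> t" "r \<in> R t" "v \<in> Vunst" "x \<in> stable_hull \<Phi> R"
  shows "\<Phi> t x + r + v \<in> stable_hull \<Phi> R"
proof -
  let ?H = "{r + v |r v. r \<in> total_reach R \<and> v \<in> Vunst}"
  have "\<Phi> t y + r + v \<in> ?H" if yH: "y \<in> ?H" for y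
  proof -
    obtain q w where qw: "y = q + w" "q \<in> total_reach R" "w \<in> Vunst" using yH by auto
    then have "\<Phi> t y + r + v = (\<Phi> t q + r) + (\<Phi> t w + v)" "\<Phi> t q + r \<in> total_reach R"
      "\<Phi> t w + v \<in> Vunst"
      using reach_step assms Vunst_invariant subspace_add[OF subspace_Vunst]
      by (auto simp: linear_add[OF linear_group])
    then show ?thesis by blast
  qed
  then have "(\<lambda>y. \<Phi> t y + r + v) ` ?H \<subseteq> closure ?H" using closure_subset[of ?H] by blast
  moreover have "continuous_on (closure ?H) (\<lambda>y. \<Phi> t y + r + v)"
    by (intro continuous_intros linear_continuous_on linear_conv_bounded_linear[THEN iffD1] linear_group)
  ultimately have "(\<lambda>y. \<Phi> t y + r + v) ` closure ?H \<subseteq> closure ?H"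
    by (intro image_closure_subset) auto
  then show ?thesis using assms(4) unfolding stable_hull_def by blast
qed

lemma zero_stable_hull: "0 \<in> stable_hull \<Phi> R"
  unfolding stable_hull_def
  using zero_reach subspace_0[OF subspace_Vunst] by (intro subsetD[OF closure_subset]) force

text \<open>
  For a time \<open>T\<close> after which \<open>\<Phi> t\<close> halves the stable parts, one step of a chain maps the distance
  \<open>d\<close> to the closed set \<open>stable_hull\<close> to at most \<open>d / 2 + 2 \<epsilon>\<close>. This yields \<open>d / 2 + 4 \<epsilon>\<close> along any
  chain, and a closed chain forces \<open>d \<le> 8 \<epsilon>\<close>.
\<close>

lemma two_sided_recurrent_in_stable_hull:
  assumes rec: "\<And>\<epsilon> T. \<epsilon> > 0 \<Longrightarrow> T > 0 \<Longrightarrow> (two_sided_step \<Phi> R \<epsilon> T)\<^sup>+\<^sup>+ x x"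
  shows "x \<in> stable_hull \<Phi> R"
proof -
  let ?H = "stable_hull \<Phi> R" and ?d = "\<lambda>y. infdist y (stable_hull \<Phi> R)"
  have H: "closed ?H" unfolding stable_hull_def by (rule closed_closure)
  have H0: "?H \<noteq> {}" using zero_stable_hull by force
  obtain P a D where P: "linear P" "a > 0" "D \<ge> 0" "\<And>x. x - P x \<in> Vunst"
    "\<And>x t. t \<ge> 0 \<Longrightarrow> norm (\<Phi> t (P x)) \<le> D * norm x * exp (- (a * t))"
    by (rule stable_projection) (rule that)
  obtain T where T: "T > 0" "\<And>t. t \<ge> T \<Longrightarrow> D * exp (- (a * t)) \<le> 1 / 2"
  proof -
    have "((\<lambda>t. D * exp (- (a * t))) \<longlongrightarrow> 0) at_top" by (rule tendsto_exp_decay[OF P(2)])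
    then have "eventually (\<lambda>t. D * exp (- (a * t)) < 1 / 2) at_top"
      by (rule order_tendstoD) simp
    then obtain T0 where "\<And>t. t \<ge> T0 \<Longrightarrow> D * exp (- (a * t)) < 1 / 2"
      by (auto simp: eventually_at_top_linorder)
    then show ?thesis by (intro that[of "max T0 1"]) (auto intro: less_imp_le)
  qed
  have contract: "?d z \<le> ?d y / 2 + 2 * \<epsilon>" if step: "two_sided_step \<Phi> R \<epsilon> T y z" and \<epsilon>: "\<epsilon> > 0" for y z \<epsilon>
  proof -
    obtain t r d e where t: "t \<ge> T" "r \<in> R t" "norm d < \<epsilon>" "norm e < \<epsilon>"
      "z = \<Phi> t (y + d) + r + e" using step unfolding two_sided_step_def by blast
    have "t \<ge> 0" using t T by simp
    obtain h where h: "h \<in> ?H" "?d (y + d) = dist (y + d) h"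
      by (rule infdist_attains_inf[OF H H0]) (rule that)
    define w where "w = y + d - h"
    have "\<Phi> t h + r + \<Phi> t (w - P w) \<in> ?H"
      by (intro stable_hull_step Vunst_invariant P(4) h(1) t(2) \<open>t \<ge> 0\<close>)
    then have "?d z \<le> dist z (\<Phi> t h + r + \<Phi> t (w - P w))" by (rule infdist_le)
    also have "z - (\<Phi> t h + r + \<Phi> t (w - P w)) = \<Phi> t (P w) + e"
      by (simp add: t(5) w_def linear_add[OF linear_group] linear_diff[OF linear_group] algebra_simps)
    then have "dist z (\<Phi> t h + r + \<Phi> t (w - P w)) \<le> norm (\<Phi> t (P w)) + norm e"
      by (simp add: dist_norm norm_triangle_ineq)
    also have "\<dots> \<le> norm w / 2 + \<epsilon>"
      using P(5)[OF \<open>t \<ge> 0\<close>, of w] mult_right_mono[OF T(2)[OF t(1)], of "norm w"] t(4)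
      by (simp add: mult_ac)
    also have "norm w = ?d (y + d)" by (simp add: h(2) w_def dist_norm)
    also have "?d (y + d) \<le> ?d y + norm d" using infdist_triangle[of "y + d" ?H y] by (simp add: dist_norm)
    finally have "?d z \<le> (?d y + norm d) / 2 + \<epsilon>" by simp
    then show ?thesis using t(3) \<epsilon> by argo
  qed
  have chain: "?d z \<le> ?d y / 2 + 4 * \<epsilon>" if "(two_sided_step \<Phi> R \<epsilon> T)\<^sup>+\<^sup>+ y z" "\<epsilon> > 0" for y z \<epsilon>
    using that(1)
  proof (induction rule: tranclp_induct)
    case (base z)
    then show ?case using contract[OF base that(2)] that(2) by simp
  next
    case (step w z)
    show ?case using contract[OF step(2) that(2)] step(3) infdist_nonneg[of y ?H] by simp
  qed
  have "?d x \<le> 0 + \<epsilon>" if "\<epsilon> > 0" for \<epsilon>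
    using chain[OF rec[OF _ T(1)], of "\<epsilon> / 8"] that by simp
  then have "?d x \<le> 0" by (rule field_le_epsilon)
  then have "?d x = 0" using infdist_nonneg[of x ?H] by simp
  then show ?thesis using in_closed_iff_infdist_zero[OF H H0] by simp
qed

theorem recurrent_in_chain_hull:
  assumes rec: "\<And>\<epsilon> T. \<epsilon> > 0 \<Longrightarrow> T > 0 \<Longrightarrow> (jump_step \<Phi> R \<epsilon> T)\<^sup>+\<^sup>+ x x"
  shows "x \<in> chain_hull \<Phi> R"
  unfolding chain_hull_def
proof
  show "x \<in> stable_hull \<Phi> R"
  proof (rule two_sided_recurrent_in_stable_hull)
    fix \<epsilon> T :: real assume *: "\<epsilon> > 0" "T > 0"
    have "jump_step \<Phi> R \<epsilon> T \<le> two_sided_step \<Phi> R \<epsilon> T"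
    proof (intro predicate2I)
      fix y z assume "jump_step \<Phi> R \<epsilon> T y z"
      then obtain t r where "t \<ge> T" "r \<in> R t" "norm (\<Phi> t y + r - z) < \<epsilon>" 
        unfolding jump_step_def by blast
      then show "two_sided_step \<Phi> R \<epsilon> T y z"
        unfolding two_sided_step_def using *
        by (intro exI[of _ t] conjI bexI[of _ r] exI[of _ 0] exI[of _ "z - (\<Phi> t y + r)"])
          (auto simp: norm_minus_commute)
    qed
    then show "(two_sided_step \<Phi> R \<epsilon> T)\<^sup>+\<^sup>+ x x" by (rule tranclp_le[OF rec[OF *]])
  qed
  interpret rev: reachability "backward \<Phi>" "backward_reach \<Phi> R" \<kappa> by (rule reversed)
  show "x \<in> stable_hull (backward \<Phi>) (backward_reach \<Phi> R)"
  proof (rule rev.two_sided_recurrent_in_stable_hull)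
    fix \<epsilon> T :: real assume *: "\<epsilon> > 0" "T > 0"
    let ?two = "two_sided_step (backward \<Phi>) (backward_reach \<Phi> R) \<epsilon> T"
    have "jump_step \<Phi> R \<epsilon> T \<le> ?two\<inverse>\<inverse>"
    proof (intro predicate2I conversepI)
      fix y z assume "jump_step \<Phi> R \<epsilon> T y z"
      then obtain t r where tr: "t \<ge> T" "r \<in> R t" "norm (\<Phi> t y + r - z) < \<epsilon>" 
        unfolding jump_step_def by blast
      have "y = backward \<Phi> t (z + (\<Phi> t y + r - z)) + - \<Phi> (- t) r + 0"
        by (simp add: backward_def linear_add[OF linear_group])
      moreover have "- \<Phi> (- t) r \<in> backward_reach \<Phi> R t" using tr(2) by (auto simp: backward_reach_def)
      ultimately show "?two z y" unfolding two_sided_step_def using * tr(1,3) by (metis norm_zero)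
    qed
    then have "(?two\<inverse>\<inverse>)\<^sup>+\<^sup>+ x x" by (rule tranclp_le[OF rec[OF *]])
    then show "?two\<^sup>+\<^sup>+ x x" by (simp add: tranclp_converse)
  qed
qed

lemma span_backward_reach_subset:
  "span (total_reach (backward_reach \<Phi> R)) \<subseteq> span (total_reach R)"
proof (rule span_minimal)
  show "total_reach (backward_reach \<Phi> R) \<subseteq> span (total_reach R)"
  proof
    fix x assume "x \<in> total_reach (backward_reach \<Phi> R)"
    then obtain t r where "0 \<le> t" "r \<in> R t" "x = - \<Phi> (- t) r"
      unfolding total_reach_def backward_reach_def by auto
    moreover have "r \<in> span (total_reach R)"
      using calculation unfolding total_reach_def by (intro span_base) auto
    ultimately show "x \<in> span (total_reach R)" using span_reach_invariant[of "- t"] by (auto intro!: span_neg)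
  qed
qed simp

text \<open>
  For a reachable point \<open>r\<close> the difference \<open>r - P r\<close> lies in \<open>V\<^sup>+\<close> and in the span of the reachable
  set, which are directions of invariance of the closed reachable set.
\<close>

lemma stable_part_in_closure_reach:
  assumes P: "linear P" "\<And>x. x - P x \<in> Vunst" "\<And>v. v \<in> Vunst \<Longrightarrow> P v = 0"
    "\<forall>C. subspace C \<longrightarrow> (\<forall>t. \<Phi> t ` C \<subseteq> C) \<longrightarrow> P ` C \<subseteq> C"
    and x: "x \<in> stable_hull \<Phi> R"
  shows "P x \<in> closure (total_reach R) \<inter> span (total_reach R)"
proof -
  let ?H = "{r + v |r v. r \<in> total_reach R \<and> v \<in> Vunst}"
  let ?K = "closure (total_reach R) \<inter> span (total_reach R)"
  have "P ` ?H \<subseteq> ?K"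
  proof clarify
    fix r v assume rv: "r \<in> total_reach R" "v \<in> Vunst"
    have eq: "P (r + v) = P r" by (simp add: linear_add[OF P(1)] P(3)[OF rv(2)])
    have PrC: "P r \<in> span (total_reach R)"
      using P(4)[rule_format, OF subspace_span span_reach_invariant] span_base[OF rv(1)] by blast
    have "r + - (r - P r) \<in> closure (total_reach R)"
    proof (rule mem_closure_add_subspace[of _ "span (total_reach R) \<inter> Vunst"])
      show "subspace (span (total_reach R) \<inter> Vunst)" by (intro subspace_inter subspace_span subspace_Vunst)
      show "span (total_reach R) \<inter> Vunst \<subseteq> closure (total_reach R)" using Vunst_in_closure_reach by blast
      show "r \<in> closure (total_reach R)" using rv closure_subset by blast
      have "r - P r \<in> span (total_reach R)" using PrC rv span_base span_diff by blast
      then show "- (r - P r) \<in> span (total_reach R) \<inter> Vunst"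
        using P(2)[of r] subspace_neg[OF subspace_Vunst] span_neg by blast
    qed (auto intro: convex_closure convex_reach)
    then show "P (r + v) \<in> ?K" using PrC by (simp add: eq)
  qed
  moreover have "closed ?K" by (intro closed_Int closed_closure closed_subspace subspace_span)
  ultimately have "closure (P ` ?H) \<subseteq> ?K" by (rule closure_minimal)
  moreover have "P ` closure ?H \<subseteq> closure (P ` ?H)"
    using linear_conv_bounded_linear P(1) by (intro closure_bounded_linear_image_subset) auto
  ultimately show ?thesis using x unfolding stable_hull_def by blast
qed

text \<open>
  The witness is the sum of the stable and the unstable part of \<open>x\<close>. It lies in both closures by
  translation invariance, and intersecting commutes with closure for convex sets whose relative
  interiors meet.
\<close>

theorem chain_hull_subset:
  assumes x: "x \<in> chain_hull \<Phi> R"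
  shows "\<exists>z\<in>closure (total_reach R \<inter> total_reach (backward_reach \<Phi> R)). x - z \<in> neutral_space \<Phi>"
proof -
  interpret rev: reachability "backward \<Phi>" "backward_reach \<Phi> R" \<kappa> by (rule reversed)
  let ?R = "total_reach R" and ?B = "total_reach (backward_reach \<Phi> R)"
  have "total_reach (backward_reach (backward \<Phi>) (backward_reach \<Phi> R)) = total_reach R"
    unfolding total_reach_def by (auto simp: backward_backward_reach)
  then have spans: "span ?B = span ?R"
    using span_backward_reach_subset rev.span_backward_reach_subset by auto
  obtain P where P: "linear P" "\<And>x. x - P x \<in> Vunst" "\<And>x. P x \<in> Lstab"
    "\<And>v. v \<in> Vunst \<Longrightarrow> P v = 0"
    "\<forall>C. subspace C \<longrightarrow> (\<forall>t. \<Phi> t ` C \<subseteq> C) \<longrightarrow> P ` C \<subseteq> C"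
    by (rule stable_projection) (rule that)
  obtain P' where P': "linear P'" "\<And>x. x - P' x \<in> subexponential_space \<Phi>"
    "\<And>x. P' x \<in> stable_space (backward \<Phi>)"
    "\<And>v. v \<in> subexponential_space \<Phi> \<Longrightarrow> P' v = 0"
    "\<forall>C. subspace C \<longrightarrow> (\<forall>t. backward \<Phi> t ` C \<subseteq> C) \<longrightarrow> P' ` C \<subseteq> C"
    by (rule rev.stable_projection[unfolded backward_backward]) (rule that)
  have Px: "P x \<in> closure ?R \<inter> span ?R"
    using x stable_part_in_closure_reach[OF P(1,2,4,5)] unfolding chain_hull_def by blast
  have P'x: "P' x \<in> closure ?B \<inter> span ?B"
    using x rev.stable_part_in_closure_reach[OF P'(1), unfolded backward_backward, OF P'(2,4,5)]
    unfolding chain_hull_def by blast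
  define z where "z = P x + P' x"
  have V: "P' x \<in> Vunst" "P x \<in> subexponential_space \<Phi>"
    using P(3) P'(3) stable_subset_subexponential by blast+
  have "z \<in> closure ?R"
    unfolding z_def
  proof (rule mem_closure_add_subspace[of _ "span ?R \<inter> Vunst"])
    show "subspace (span ?R \<inter> Vunst)" by (intro subspace_inter subspace_span subspace_Vunst)
    show "span ?R \<inter> Vunst \<subseteq> closure ?R" using Vunst_in_closure_reach by blast
  qed (use Px P'x V spans convex_reach in \<open>auto intro: convex_closure\<close>)
  moreover have "P' x + P x \<in> closure ?B"
  proof (rule mem_closure_add_subspace[of _ "span ?B \<inter> subexponential_space \<Phi>"])
    show "subspace (span ?B \<inter> subexponential_space \<Phi>)"
      using rev.subspace_Vunst by (intro subspace_inter subspace_span) auto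
    show "span ?B \<inter> subexponential_space \<Phi> \<subseteq> closure ?B"
      using rev.Vunst_in_closure_reach by auto
  qed (use Px P'x V spans rev.convex_reach in \<open>auto intro: convex_closure\<close>)
  then have "z \<in> closure ?B" by (simp add: z_def add.commute)
  moreover have "closure (\<Inter>{?R, ?B}) = \<Inter>(closure ` {?R, ?B})"
  proof (rule closure_Inter_convex)
    show "convex S" if "S \<in> {?R, ?B}" for S using that convex_reach rev.convex_reach by auto
    have "0 \<in> rel_interior ?R" by (rule zero_in_rel_interior[OF convex_reach zero_reach \<kappa> reach_sym])
    moreover have "0 \<in> rel_interior ?B"
      by (rule zero_in_rel_interior[OF rev.convex_reach rev.zero_reach \<kappa> rev.reach_sym])
    ultimately show "\<Inter> (rel_interior ` {?R, ?B}) \<noteq> {}" by auto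
  qed
  ultimately have "z \<in> closure (?R \<inter> ?B)" by simp
  moreover have "x - z \<in> neutral_space \<Phi>"
  proof -
    have "(x - P x) - P' x \<in> Vunst" by (rule subspace_diff[OF subspace_Vunst P(2) V(1)])
    moreover have "(x - P' x) - P x \<in> subexponential_space \<Phi>"
      using rev.subspace_Vunst P'(2) V(2) subspace_diff by auto
    ultimately show ?thesis unfolding neutral_space_def z_def by (simp add: algebra_simps)
  qed
  ultimately show ?thesis by blast
qed

lemma closed_chain_hull: "closed (chain_hull \<Phi> R)"
  unfolding chain_hull_def stable_hull_def by (intro closed_Int closed_closure)

lemma chain_hull_add_neutral:
  assumes "x \<in> chain_hull \<Phi> R" "v \<in> neutral_space \<Phi>"
  shows "x + v \<in> chain_hull \<Phi> R"
proof -
  interpret rev: reachability "backward \<Phi>" "backward_reach \<Phi> R" \<kappa> by (rule reversed)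
  have "x + v \<in> stable_hull \<Phi> R"
    using stable_hull_step[of 0 0 v x] zero_R[of 0] assms by (auto simp: chain_hull_def neutral_space_def)
  moreover have "backward \<Phi> 0 x + 0 + v \<in> stable_hull (backward \<Phi>) (backward_reach \<Phi> R)"
    using assms by (intro rev.stable_hull_step rev.zero_R) (auto simp: chain_hull_def neutral_space_def)
  ultimately show ?thesis by (simp add: chain_hull_def backward_def)
qed

lemma chain_hull_nonempty: "0 \<in> chain_hull \<Phi> R"
proof -
  interpret rev: reachability "backward \<Phi>" "backward_reach \<Phi> R" \<kappa> by (rule reversed)
  show ?thesis using zero_stable_hull rev.zero_stable_hull by (simp add: chain_hull_def)
qed

end

section \<open>Decomposition into generalized eigenvectors\<close>

text \<open>
  The vector \<open>p(M) v\<close>.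
\<close>

definition poly_action :: "complex^'n^'n \<Rightarrow> complex poly \<Rightarrow> complex^'n \<Rightarrow> complex^'n" where
  "poly_action M p v = (\<Sum>i\<le>degree p. coeff p i *s ((*v) M ^^ i) v)"

lemma poly_action_le:
  assumes "degree p \<le> n"
  shows "poly_action M p v = (\<Sum>i\<le>n. coeff p i *s ((*v) M ^^ i) v)"
  unfolding poly_action_def
  using assms by (intro sum.mono_neutral_left) (auto simp: coeff_eq_0)

lemma poly_action_linear_factor:
  "poly_action M ([:-\<mu>, 1:] * q) v = M *v poly_action M q v - \<mu> *s poly_action M q v"
proof -
  define n where "n = degree q"
  let ?g = "\<lambda>i. ((*v) M ^^ i) v"
  have eq: "[:-\<mu>, 1:] * q = pCons 0 q - smult \<mu> q" by simp
  have "degree ([:-\<mu>, 1:] * q) \<le> Suc n"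
    unfolding eq n_def by (intro degree_diff_le degree_pCons_le) (auto intro: order_trans[OF degree_smult_le])
  then have "poly_action M ([:-\<mu>, 1:] * q) v
      = (\<Sum>i\<le>Suc n. coeff (pCons 0 q) i *s ?g i) - (\<Sum>i\<le>Suc n. (\<mu> * coeff q i) *s ?g i)"
    by (simp add: poly_action_le eq vec.scale_left_diff_distrib sum_subtractf del: sum.atMost_Suc)
  also have "(\<Sum>i\<le>Suc n. coeff (pCons 0 q) i *s ?g i) = (\<Sum>i\<le>n. coeff q i *s ?g (Suc i))"
    by (simp add: sum.atMost_Suc_shift del: sum.atMost_Suc)
  also have "\<dots> = M *v poly_action M q v"
    by (simp add: poly_action_def n_def vec.linear_sum[OF matrix_vector_mul_linear_gen] vector_scalar_commute)
  also have "(\<Sum>i\<le>Suc n. (\<mu> * coeff q i) *s ?g i) = \<mu> *s poly_action M q v"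
    by (subst poly_action_le[of q "Suc n"])
      (auto simp: n_def vec.scale_sum_right vec.scale_right_distrib)
  finally show ?thesis .
qed

lemma of_real_scalar_mult: "complex_of_real r *s w = r *\<^sub>R w"
  by (auto simp: vec_eq_iff complex_eq_iff)

lemma annihilating_polynomial: "\<exists>p. p \<noteq> 0 \<and> poly_action M p v = 0"
proof -
  let ?g = "\<lambda>i. ((*v) M ^^ i) v"
  define N where "N = DIM(complex^'a)"
  have "\<exists>c. (\<exists>i\<le>N. c i \<noteq> 0) \<and> (\<Sum>i\<le>N. c i *\<^sub>R ?g i) = 0"
  proof (cases "inj_on ?g {..N}")
    case True
    have "dependent (?g ` {..N})"
      using card_image[OF True] by (intro dependent_biggerset) (simp add: N_def)
    then obtain u where u: "\<exists>x\<in>?g ` {..N}. u x \<noteq> 0" "(\<Sum>x\<in>?g ` {..N}. u x *\<^sub>R x) = 0"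
      by (auto simp: dependent_finite)
    then have "(\<Sum>i\<le>N. u (?g i) *\<^sub>R ?g i) = 0" by (simp add: sum.reindex[OF True])
    then show ?thesis using u(1) by (intro exI[of _ "\<lambda>i. u (?g i)"]) auto
  next
    case False
    then obtain i j where ij: "i \<le> N" "j \<le> N" "i \<noteq> j" "?g i = ?g j" by (auto simp: inj_on_def)
    let ?c = "\<lambda>k. if k = i then 1 else if k = j then -1 else (0::real)"
    have "(\<Sum>k\<le>N. ?c k *\<^sub>R ?g k) = (\<Sum>k\<le>N. (if k = i then ?g k else 0) + (if k = j then - ?g k else 0))"
      using ij(3) by (intro sum.cong) auto
    also have "\<dots> = 0" using ij by (simp add: sum.distrib)
    finally show ?thesis using ij(1) by (intro exI[of _ ?c]) auto
  qed
  then obtain c where c: "\<exists>i\<le>N. c i \<noteq> 0" "(\<Sum>i\<le>N. c i *\<^sub>R ?g i) = 0" by blast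
  define p where "p = (\<Sum>i\<le>N. monom (complex_of_real (c i)) i)"
  have coeff: "coeff p k = (if k \<le> N then complex_of_real (c k) else 0)" for k
    by (simp add: p_def coeff_sum)
  have "degree p \<le> N" by (rule degree_le) (simp add: coeff)
  then have "poly_action M p v = (\<Sum>i\<le>N. coeff p i *s ?g i)" by (rule poly_action_le)
  also have "\<dots> = (\<Sum>i\<le>N. c i *\<^sub>R ?g i)"
    by (rule sum.cong) (simp_all add: coeff of_real_scalar_mult)
  finally have "poly_action M p v = (\<Sum>i\<le>N. c i *\<^sub>R ?g i)" .
  moreover have "p \<noteq> 0" using c(1) coeff by (metis coeff_0 of_real_eq_0_iff)
  ultimately show ?thesis using c(2) by metis
qed

lemma shift_linear:
  fixes M :: "complex^'n^'n"
  shows "linear (\<lambda>w. M *v w - \<mu> *s w)"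
  by (rule linearI) (simp_all add: vec_eq_iff matrix_vector_mult_def algebra_simps sum.distrib sum_subtractf scaleR_sum_right)

lemma shift_funpow_scale:
  fixes M :: "complex^'n^'n"
  shows "((\<lambda>w. M *v w - \<mu> *s w) ^^ k) (c *s v) = c *s ((\<lambda>w. M *v w - \<mu> *s w) ^^ k) v"
  by (induction k) (simp_all add: vector_scalar_commute vec.scale_right_diff_distrib mult.commute)

lemma generalized_eigenspace_scale:
  "v \<in> generalized_eigenspace A \<mu> \<Longrightarrow> c *s v \<in> generalized_eigenspace A \<mu>"
  unfolding generalized_eigenspace_def by (auto simp: shift_funpow_scale)

lemma subspace_generalized_eigenspace: "subspace (generalized_eigenspace A \<mu>)"
proof -
  let ?S = "\<lambda>w. complexify A *v w - \<mu> *s w"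
  have lin: "linear (?S ^^ k)" for k
  proof (induction k)
    case 0
    show ?case unfolding funpow.simps by (rule linear_id)
  next
    case (Suc k)
    show ?case unfolding funpow.simps by (rule linear_compose[OF Suc shift_linear])
  qed
  have mono: "(?S ^^ (k + j)) v = 0" if "(?S ^^ k) v = 0" for k j v
  proof -
    have "(?S ^^ (j + k)) v = (?S ^^ j) ((?S ^^ k) v)" by (simp add: funpow_add)
    then show ?thesis using that linear_0[OF lin] by (simp add: add.commute)
  qed
  show ?thesis
    unfolding subspace_def generalized_eigenspace_def
  proof (safe, goal_cases)
    case 1
    then show ?case by (auto intro: exI[of _ 0])
  next
    case (2 x y j k)
    then have "(?S ^^ (j + k)) (x + y) = 0"
      using mono[of j x k] mono[of k y j] linear_add[OF lin] by (simp add: add.commute)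
    then show ?case by blast
  next
    case (3 c x k)
    then have "(?S ^^ k) (c *\<^sub>R x) = 0" using linear_scale[OF lin] by simp
    then show ?case by blast
  qed
qed

lemma generalized_eigenspace_shift_back:
  assumes "complexify A *v w - \<mu> *s w \<in> generalized_eigenspace A \<mu>"
  shows "w \<in> generalized_eigenspace A \<mu>"
proof -
  obtain k where "((\<lambda>w. complexify A *v w - \<mu> *s w) ^^ k) (complexify A *v w - \<mu> *s w) = 0"
    using assms by (auto simp: generalized_eigenspace_def)
  then have "((\<lambda>w. complexify A *v w - \<mu> *s w) ^^ (Suc k)) w = 0" by (simp only: funpow_Suc_right o_def)
  then show ?thesis unfolding generalized_eigenspace_def by blast
qed

text \<open>
  On the generalized eigenspace of \<open>\<nu>\<close> the map \<open>M - \<mu>\<close> is the invertible scalar \<open>\<nu> - \<mu>\<close> plus a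
  nilpotent map; the induction follows the finite geometric series of the inverse.
\<close>

lemma shift_surj_on_other_eigenspace:
  fixes A :: "real^'n^'n"
  assumes Z: "subspace Z" "\<And>c v. v \<in> Z \<Longrightarrow> c *s v \<in> Z" "\<And>v. v \<in> Z \<Longrightarrow> complexify A *v v \<in> Z"
    and ne: "\<mu> \<noteq> \<nu>"
    and v: "v \<in> Z" "((\<lambda>w. complexify A *v w - \<nu> *s w) ^^ k) v = 0"
  shows "\<exists>w \<in> Z \<inter> generalized_eigenspace A \<nu>. complexify A *v w - \<mu> *s w = v"
  using v
proof (induction k arbitrary: v)
  case 0
  then show ?case
    using subspace_0[OF Z(1)] subspace_0[OF subspace_generalized_eigenspace]
    by (intro bexI[of _ 0]) auto
next
  case (Suc k)
  let ?S = "\<lambda>w. complexify A *v w - \<nu> *s w"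
  define w0 where "w0 = (1 / (\<nu> - \<mu>)) *s v"
  have w0Z: "w0 \<in> Z" using Suc.prems Z(2) by (simp add: w0_def)
  have S0: "(?S ^^ Suc k) w0 = 0"
    unfolding w0_def shift_funpow_scale using Suc.prems(2) by simp
  then have w0G: "w0 \<in> generalized_eigenspace A \<nu>" unfolding generalized_eigenspace_def by blast
  have "?S w0 \<in> Z" using w0Z Z subspace_diff by blast
  moreover have "(?S ^^ k) (?S w0) = 0" using S0 by (simp only: funpow_Suc_right o_def)
  ultimately obtain w1 where w1: "w1 \<in> Z \<inter> generalized_eigenspace A \<nu>" "complexify A *v w1 - \<mu> *s w1 = ?S w0"
    using Suc.IH by blast
  have "v = (\<nu> - \<mu>) *s w0" using ne by (simp add: w0_def)
  then have "v = \<nu> *s w0 - \<mu> *s w0" by (simp only: vec.scale_left_diff_distrib)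
  then have "complexify A *v w0 - \<mu> *s w0 = v + ?S w0" by simp
  then have "complexify A *v (w0 - w1) - \<mu> *s (w0 - w1) = v"
    using w1(2) linear_diff[OF shift_linear[of "complexify A" \<mu>], of w0 w1] by simp
  moreover have "w0 - w1 \<in> Z \<inter> generalized_eigenspace A \<nu>"
    using w0Z w0G w1 subspace_diff[OF Z(1)] subspace_diff[OF subspace_generalized_eigenspace] by blast
  ultimately show ?case by blast
qed

text \<open>
  Let \<open>S\<close> be the span in question. If \<open>(M - \<mu>) w \<in> S\<close> then \<open>w \<in> S\<close>: the components of
  \<open>(M - \<mu>) w\<close> for other eigenvalues have preimages in \<open>S\<close>, and what remains is a generalized
  eigenvector for \<open>\<mu>\<close>. For \<open>v \<notin> S\<close> take a polynomial \<open>p\<close> of least degree with \<open>p(M) v \<in> S\<close>; splitting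
  off a linear factor contradicts minimality.
\<close>

theorem generalized_eigenvectors_span:
  fixes A :: "real^'n^'n"
  assumes Z: "subspace Z" "\<And>c v. v \<in> Z \<Longrightarrow> c *s v \<in> Z" "\<And>v. v \<in> Z \<Longrightarrow> complexify A *v v \<in> Z"
    and v: "v \<in> Z"
  shows "v \<in> span (Z \<inter> (\<Union>\<mu>. generalized_eigenspace A \<mu>))"
proof (rule ccontr)
  let ?M = "complexify A"
  let ?S = "span (Z \<inter> (\<Union>\<mu>. generalized_eigenspace A \<mu>))"
  assume nv: "v \<notin> ?S"
  have SZ: "?S \<subseteq> Z" by (rule span_minimal) (use Z in auto)
  have shiftZ: "?M *v w - \<mu> *s w \<in> Z" if "w \<in> Z" for w \<mu> using that Z subspace_diff by blast
  have step: "w \<in> ?S" if wZ: "w \<in> Z" and wS: "?M *v w - \<mu> *s w \<in> ?S" for w \<mu>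
  proof -
    let ?f = "\<lambda>w. ?M *v w - \<mu> *s w"
    define X where "X = {s. \<exists>w'\<in>?S. ?f w' - s \<in> Z \<inter> generalized_eigenspace A \<mu>}"
    have subG: "subspace (Z \<inter> generalized_eigenspace A \<mu>)"
      by (intro subspace_inter Z subspace_generalized_eigenspace)
    have "subspace X"
      unfolding subspace_def X_def
    proof (safe, goal_cases)
      case 1
      show ?case
        using subspace_0[OF subG] linear_0[OF shift_linear[of ?M \<mu>]] by (intro bexI[of _ 0]) (auto intro: span_zero)
    next
      case (2 x y a b)
      have "?f (a + b) - (x + y) = (?f a - x) + (?f b - y)" using linear_add[OF shift_linear[of ?M \<mu>], of a b] by simp
      moreover have "\<dots> \<in> Z \<inter> generalized_eigenspace A \<mu>" using 2 by (intro subspace_add[OF subG]) auto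
      moreover have "a + b \<in> ?S" using 2 by (intro span_add)
      ultimately show ?case by metis
    next
      case (3 c x a)
      have "?f (c *\<^sub>R a) - c *\<^sub>R x = c *\<^sub>R (?f a - x)" using linear_scale[OF shift_linear[of ?M \<mu>], of c a] by (simp add: scaleR_diff_right)
      moreover have "\<dots> \<in> Z \<inter> generalized_eigenspace A \<mu>" using 3 by (intro subspace_scale[OF subG]) auto
      moreover have "c *\<^sub>R a \<in> ?S" using 3 by (intro span_scale)
      ultimately show ?case by metis
    qed
    moreover have "Z \<inter> (\<Union>\<mu>. generalized_eigenspace A \<mu>) \<subseteq> X"
    proof clarify
      fix x \<nu> assume x: "x \<in> Z" "x \<in> generalized_eigenspace A \<nu>"
      show "x \<in> X"
      proof (cases "\<mu> = \<nu>")
        case True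
        then have "?f 0 - x \<in> Z \<inter> generalized_eigenspace A \<mu>"
          using x linear_0[OF shift_linear[of ?M \<mu>]] subspace_neg[OF subG, of x] by simp
        then show ?thesis unfolding X_def using span_zero by blast
      next
        case False
        obtain k where "((\<lambda>w. ?M *v w - \<nu> *s w) ^^ k) x = 0" using x(2) by (auto simp: generalized_eigenspace_def)
        from shift_surj_on_other_eigenspace[OF Z False x(1) this]
        obtain w where w: "w \<in> Z \<inter> generalized_eigenspace A \<nu>" "?f w = x" by blast
        then have "w \<in> ?S" by (intro span_base) blast
        moreover have "?f w - x \<in> Z \<inter> generalized_eigenspace A \<mu>" using w(2) subspace_0[OF subG] by simp
        ultimately show ?thesis unfolding X_def by blast
      qed
    qed
    ultimately have "?S \<subseteq> X" by (rule span_minimal[rotated])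
    then obtain w' where w': "w' \<in> ?S" "?f w' - ?f w \<in> Z \<inter> generalized_eigenspace A \<mu>"
      using wS unfolding X_def by blast
    have "?f (w' - w) \<in> generalized_eigenspace A \<mu>" using w'(2) unfolding linear_diff[OF shift_linear[of ?M \<mu>], of w' w] by blast
    then have "w' - w \<in> generalized_eigenspace A \<mu>" by (rule generalized_eigenspace_shift_back)
    moreover have "w' - w \<in> Z" using w'(1) SZ wZ subspace_diff[OF Z(1)] by blast
    ultimately have "w' - w \<in> ?S" by (intro span_base) blast
    then have "w' - (w' - w) \<in> ?S" by (rule span_diff[OF w'(1)])
    moreover have "w' - (w' - w) = w" by simp
    ultimately show ?thesis by metis
  qed
  have iterZ: "((*v) ?M ^^ i) v \<in> Z" for i using v Z(3) by (induction i) auto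
  have actZ: "poly_action ?M p v \<in> Z" for p
    unfolding poly_action_def by (intro subspace_sum[OF Z(1)] Z(2) iterZ)
  obtain p0 where p0: "p0 \<noteq> 0" "poly_action ?M p0 v = 0" using annihilating_polynomial by blast
  define P where "P = (\<lambda>p. p \<noteq> 0 \<and> poly_action ?M p v \<in> ?S)"
  have "P p0" using p0 by (simp add: P_def span_zero)
  then obtain p where p: "P p" "\<And>q. P q \<Longrightarrow> degree p \<le> degree q"
    using ex_has_least_nat[of P p0 degree] by blast
  have "degree p \<noteq> 0"
  proof
    assume "degree p = 0"
    then obtain a where a: "p = [:a:]" by (metis degree_eq_zeroE)
    then have "a \<noteq> 0" "a *s v \<in> ?S" using p(1) by (auto simp: P_def poly_action_def)
    have scS: "c *s w \<in> ?S" if "w \<in> ?S" for c w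
    proof -
      have lin: "linear ((*s) c :: complex^'n \<Rightarrow> _)"
        by (rule linearI) (simp_all add: vec_eq_iff algebra_simps)
      have "(*s) c ` (Z \<inter> (\<Union>\<mu>. generalized_eigenspace A \<mu>)) \<subseteq> Z \<inter> (\<Union>\<mu>. generalized_eigenspace A \<mu>)"
        by (auto intro: Z(2) generalized_eigenspace_scale)
      then have "span ((*s) c ` (Z \<inter> (\<Union>\<mu>. generalized_eigenspace A \<mu>))) \<subseteq> ?S" by (rule span_mono)
      then show ?thesis using that by (simp add: linear_span_image[OF lin] image_subset_iff)
    qed
    have "inverse a *s (a *s v) \<in> ?S" using scS \<open>a *s v \<in> ?S\<close> .
    then show False using nv \<open>a \<noteq> 0\<close> by simp
  qed
  then have "\<not> constant (poly p)" by (simp add: constant_degree)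
  then obtain \<mu> where "poly p \<mu> = 0" using fundamental_theorem_of_algebra by blast
  then obtain q where q: "p = [:-\<mu>, 1:] * q" by (metis poly_eq_0_iff_dvd dvdE)
  have "q \<noteq> 0" using p(1) q by (auto simp: P_def)
  have "degree p = Suc (degree q)" unfolding q using \<open>q \<noteq> 0\<close> by (subst degree_mult_eq) auto
  then have "\<not> P q" using p(2)[of q] by auto
  then have "poly_action ?M q v \<notin> ?S" using \<open>q \<noteq> 0\<close> by (simp add: P_def)
  moreover have "?M *v poly_action ?M q v - \<mu> *s poly_action ?M q v \<in> ?S"
    using p(1) unfolding P_def q poly_action_linear_factor by blast
  ultimately show False using step actZ by blast
qed

definition Re_vec :: "complex^'n \<Rightarrow> real^'n" where "Re_vec v = (\<chi> i. Re (v $ i))"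
definition Im_vec :: "complex^'n \<Rightarrow> real^'n" where "Im_vec v = (\<chi> i. Im (v $ i))"

lemma linear_Re_vec: "linear Re_vec" and linear_Im_vec: "linear Im_vec"
  by (auto intro!: linearI simp: Re_vec_def Im_vec_def vec_eq_iff)

lemma Re_vec_complexify: "Re_vec (complexify A *v v) = A *v Re_vec v"
  and Im_vec_complexify: "Im_vec (complexify A *v v) = A *v Im_vec v"
  by (simp_all add: Re_vec_def Im_vec_def complexify_def matrix_vector_mult_def vec_eq_iff)

lemma Re_vec_scale: "Re_vec (c *s v) = Re c *\<^sub>R Re_vec v - Im c *\<^sub>R Im_vec v"
  and Im_vec_scale: "Im_vec (c *s v) = Re c *\<^sub>R Im_vec v + Im c *\<^sub>R Re_vec v"
  by (simp_all add: Re_vec_def Im_vec_def vec_eq_iff)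

lemma norm_Re_vec_le: "norm (Re_vec v) \<le> norm v"
  unfolding norm_vec_def Re_vec_def by (intro L2_set_mono) (auto simp: abs_Re_le_cmod)

text \<open>
  Decompose in the complexification of \<open>C\<close>, which consists of the vectors with real and imaginary
  part in \<open>C\<close>, and take real parts.
\<close>

theorem invariant_subspace_spanned_by_Re_vec:
  fixes A :: "real^'n^'n"
  assumes C: "subspace C" "\<And>x. x \<in> C \<Longrightarrow> A *v x \<in> C" and x: "x \<in> C"
  shows "x \<in> span (C \<inter> (\<Union>\<mu>. Re_vec ` generalized_eigenspace A \<mu>))"
proof -
  define Z where "Z = {v. Re_vec v \<in> C \<and> Im_vec v \<in> C}"
  have Zeq: "Z = (Re_vec -` C) \<inter> (Im_vec -` C)" by (auto simp: Z_def)
  have subZ: "subspace Z"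
    unfolding Zeq by (intro subspace_inter linear_subspace_vimage linear_Re_vec linear_Im_vec C(1))
  define v :: "complex^'n" where "v = (\<chi> i. complex_of_real (x $ i))"
  have v: "Re_vec v = x" "Im_vec v = 0" by (simp_all add: v_def Re_vec_def Im_vec_def vec_eq_iff)
  have "v \<in> span (Z \<inter> (\<Union>\<mu>. generalized_eigenspace A \<mu>))"
  proof (rule generalized_eigenvectors_span[OF subZ])
    show "c *s w \<in> Z" if "w \<in> Z" for c w
      using that C(1)
      by (simp add: Z_def Re_vec_scale Im_vec_scale subspace_add subspace_diff subspace_scale)
    show "complexify A *v w \<in> Z" if "w \<in> Z" for w
      using that C(2) by (simp add: Z_def Re_vec_complexify Im_vec_complexify)
    show "v \<in> Z" using x subspace_0[OF C(1)] by (simp add: Z_def v)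
  qed
  then have "Re_vec v \<in> span (Re_vec ` (Z \<inter> (\<Union>\<mu>. generalized_eigenspace A \<mu>)))"
    using linear_span_image[OF linear_Re_vec] by blast
  also have "\<dots> \<subseteq> span (C \<inter> (\<Union>\<mu>. Re_vec ` generalized_eigenspace A \<mu>))"
    by (rule span_mono) (auto simp: Z_def)
  finally show ?thesis by (simp add: v)
qed

section \<open>The flow of a linear differential equation\<close>

definition solves_linear_ode :: "real^'n^'n \<Rightarrow> (real \<Rightarrow> real^'n) \<Rightarrow> bool" where
  "solves_linear_ode A y \<longleftrightarrow> (\<forall>t. (y has_vector_derivative A *v y t) (at t))"

text \<open>
  Gronwall's argument in both directions: \<open>e\<^sup>-\<^sup>2\<^sup>L\<^sup>\<sigma>\<^sup>t \<bar>d t\<bar>\<^sup>2\<close> is nonincreasing for \<open>\<sigma> = 1\<close> and nondecreasing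
  for \<open>\<sigma> = -1\<close>, where \<open>L\<close> bounds the norm of \<open>A\<close>.
\<close>

lemma linear_ode_zero:
  fixes A :: "real^'n^'n" and d :: "real \<Rightarrow> real^'n"
  assumes der: "\<And>t. t \<in> {a..b} \<Longrightarrow> (d has_vector_derivative A *v d t) (at t within {a..b})"
    and c: "c \<in> {a..b}" "d c = 0" and t: "t \<in> {a..b}"
  shows "d t = 0"
proof -
  obtain L where L: "L > 0" "\<And>x. norm (A *v x) \<le> norm x * L"
    using bounded_linear.pos_bounded[OF matrix_vector_mul_bounded_linear[of A]] by blast
  define \<psi> where "\<psi> \<sigma> s = exp (- (2 * L * \<sigma> * s)) * (d s \<bullet> d s)" for \<sigma> s
  have der\<psi>: "(\<psi> \<sigma> has_derivative
      (\<lambda>h. h * (exp (- (2 * L * \<sigma> * s)) * (2 * (d s \<bullet> (A *v d s)) - 2 * L * \<sigma> * (d s \<bullet> d s)))))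
      (at s within S)" if "s \<in> {a..b}" "S \<subseteq> {a..b}" for \<sigma> s S
  proof -
    have "(d has_derivative (\<lambda>h. h *\<^sub>R (A *v d s))) (at s within S)"
      using der[OF that(1)] that(2) unfolding has_vector_derivative_def by (rule has_derivative_subset)
    then show ?thesis
      unfolding \<psi>_def
      by (auto intro!: derivative_eq_intros simp: fun_eq_iff algebra_simps inner_commute)
  qed
  have est: "\<bar>d s \<bullet> (A *v d s)\<bar> \<le> L * (d s \<bullet> d s)" for s
  proof -
    have "\<bar>d s \<bullet> (A *v d s)\<bar> \<le> norm (d s) * norm (A *v d s)" by (rule Cauchy_Schwarz_ineq2)
    also have "\<dots> \<le> norm (d s) * (norm (d s) * L)" using L by (intro mult_left_mono) auto
    finally show ?thesis by (simp add: dot_square_norm power2_eq_square mult_ac)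
  qed
  have \<psi>_nonneg: "\<psi> \<sigma> s \<ge> 0" for \<sigma> s by (simp add: \<psi>_def)
  have \<psi>c: "\<psi> \<sigma> c = 0" for \<sigma> using c by (simp add: \<psi>_def)
  have "\<exists>\<sigma>. \<psi> \<sigma> t \<le> 0"
  proof (cases t c rule: linorder_cases)
    case less
    have "\<exists>\<xi>\<in>{t<..<c}. \<psi> (-1) c - \<psi> (-1) t
        = (c - t) * (exp (- (2 * L * (-1) * \<xi>)) * (2 * (d \<xi> \<bullet> (A *v d \<xi>)) - 2 * L * (-1) * (d \<xi> \<bullet> d \<xi>)))"
      by (rule mvt_simple[OF less der\<psi>]) (use t c in auto)
    then obtain \<xi> where \<xi>: "\<psi> (-1) c - \<psi> (-1) t
        = (c - t) * (exp (- (2 * L * (-1) * \<xi>)) * (2 * (d \<xi> \<bullet> (A *v d \<xi>)) - 2 * L * (-1) * (d \<xi> \<bullet> d \<xi>)))"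
      by blast
    have "0 \<le> (c - t) * (exp (- (2 * L * (-1) * \<xi>)) * (2 * (d \<xi> \<bullet> (A *v d \<xi>)) - 2 * L * (-1) * (d \<xi> \<bullet> d \<xi>)))"
      using less est[of \<xi>] by (intro mult_nonneg_nonneg) auto
    then have "\<psi> (-1) t \<le> 0" using \<xi> \<psi>c[of "-1"] by linarith
    then show ?thesis by blast
  next
    case greater
    have "\<exists>\<xi>\<in>{c<..<t}. \<psi> 1 t - \<psi> 1 c
        = (t - c) * (exp (- (2 * L * 1 * \<xi>)) * (2 * (d \<xi> \<bullet> (A *v d \<xi>)) - 2 * L * 1 * (d \<xi> \<bullet> d \<xi>)))"
      by (rule mvt_simple[OF greater der\<psi>]) (use t c in auto)
    then obtain \<xi> where \<xi>: "\<psi> 1 t - \<psi> 1 c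
        = (t - c) * (exp (- (2 * L * 1 * \<xi>)) * (2 * (d \<xi> \<bullet> (A *v d \<xi>)) - 2 * L * 1 * (d \<xi> \<bullet> d \<xi>)))"
      by blast
    have "(t - c) * (exp (- (2 * L * 1 * \<xi>)) * (2 * (d \<xi> \<bullet> (A *v d \<xi>)) - 2 * L * 1 * (d \<xi> \<bullet> d \<xi>))) \<le> 0"
      using greater est[of \<xi>] by (intro mult_nonneg_nonpos) auto
    then have "\<psi> 1 t \<le> 0" using \<xi> \<psi>c[of 1] by linarith
    then show ?thesis by blast
  qed (use \<psi>c in auto)
  then obtain \<sigma> where "\<psi> \<sigma> t = 0" using \<psi>_nonneg by (meson antisym)
  then show ?thesis by (simp add: \<psi>_def)
qed

lemma solves_linear_ode_unique:
  assumes "solves_linear_ode A y" "solves_linear_ode A z" "y 0 = z 0"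
  shows "y t = z t"
proof -
  define d where "d = (\<lambda>s. y s - z s)"
  have "(d has_vector_derivative A *v d s) (at s)" for s
    using assms(1,2) unfolding solves_linear_ode_def d_def matrix_vector_mult_diff_distrib
    by (intro has_vector_derivative_diff) auto
  then have der: "(d has_vector_derivative A *v d s) (at s within S)" for s S
    by (rule has_vector_derivative_at_within)
  have d0: "d 0 = 0" using assms(3) by (simp add: d_def)
  have "d t = 0" by (rule linear_ode_zero[of "- \<bar>t\<bar>" "\<bar>t\<bar>" d A 0 t, OF der _ d0]) auto
  then show ?thesis by (simp add: d_def)
qed

lemma power_div_fact_le_exp: "0 \<le> x \<Longrightarrow> x ^ j / fact j \<le> exp (x::real)"
proof -
  assume x: "0 \<le> x"
  have s: "(\<lambda>n. x ^ n / fact n) sums exp x"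
    using exp_converges[of x] by (simp add: field_simps)
  have "(\<Sum>n\<in>{j}. x ^ n / fact n) \<le> (\<Sum>n. x ^ n / fact n)"
    using x s by (intro sum_le_suminf) (auto simp: sums_iff)
  then show ?thesis using s by (simp add: sums_iff)
qed

lemma exponential_sum_derivative:
  fixes w :: "nat \<Rightarrow> 'a::real_normed_vector"
  shows "((\<lambda>t. \<Sum>j<Suc n. (t ^ j / fact j) *\<^sub>R w j) has_vector_derivative
    (\<Sum>j<n. (t ^ j / fact j) *\<^sub>R w (Suc j))) (at t)"
proof (induction n)
  case (Suc n)
  have "((\<lambda>t. t ^ Suc n / fact (Suc n)) has_real_derivative t ^ n / fact n) (at t)"
    by (auto intro!: derivative_eq_intros simp: divide_simps simp del: power_Suc)
  then have "((\<lambda>t. (t ^ Suc n / fact (Suc n)) *\<^sub>R w (Suc n)) has_vector_derivative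
      (t ^ n / fact n) *\<^sub>R w (Suc n)) (at t)"
    using has_vector_derivative_scaleR[OF _ has_vector_derivative_const[of "w (Suc n)"]] by fastforce
  from has_vector_derivative_add[OF Suc this] show ?case by simp
qed (auto intro: derivative_eq_intros)

lemma norm_vector_smult: "norm (c *s v) = norm c * norm v" for v :: "complex^'n"
  by (simp add: norm_vec_def norm_mult L2_set_right_distrib)

lemma bounded_bilinear_vector_smult: "bounded_bilinear (\<lambda>c (v::complex^'n). c *s v)"
  by unfold_locales
    (auto simp: vec_eq_iff algebra_simps norm_vector_smult intro!: exI[of _ 1])

text \<open>
  The solution is the real part of \<open>e\<^sup>\<mu>\<^sup>t \<Sum>\<^sub>j t\<^sup>j / j! (A - \<mu>)\<^sup>j v\<close>, a finite sum because \<open>v\<close> is a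
  generalized eigenvector, and \<open>\<bar>t\<bar>\<^sup>j / j!\<close> is at most \<open>exp (\<eta> \<bar>t\<bar>) / \<eta>\<^sup>j\<close>.
\<close>

lemma generalized_eigenvector_solution:
  fixes A :: "real^'n^'n"
  assumes v: "v \<in> generalized_eigenspace A \<mu>"
  shows "\<exists>y. y 0 = Re_vec v \<and> solves_linear_ode A y \<and>
    (\<forall>\<eta>>0. \<exists>D\<ge>0. \<forall>t. norm (y t) \<le> D * exp (t * Re \<mu> + \<eta> * \<bar>t\<bar>))"
proof -
  let ?M = "complexify A"
  let ?S = "\<lambda>w. ?M *v w - \<mu> *s w"
  obtain k where k: "(?S ^^ k) v = 0" using v unfolding generalized_eigenspace_def by blast
  define w where "w j = (?S ^^ j) v" for j
  have wk: "w (Suc k) = 0" using k linear_0[OF shift_linear[of ?M \<mu>]] by (simp add: w_def)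
  have Sw: "?S (w j) = w (Suc j)" for j by (simp add: w_def)
  define p where "p t = (\<Sum>j<Suc k. (t ^ j / fact j) *\<^sub>R w j)" for t :: real
  have Sp: "?S (p t) = (\<Sum>j<k. (t ^ j / fact j) *\<^sub>R w (Suc j))" for t
  proof -
    have "?S (p t) = (\<Sum>j<Suc k. (t ^ j / fact j) *\<^sub>R ?S (w j))"
      unfolding p_def linear_sum[OF shift_linear[of ?M \<mu>]] linear_scale[OF shift_linear[of ?M \<mu>]] ..
    also have "\<dots> = (\<Sum>j<Suc k. (t ^ j / fact j) *\<^sub>R w (Suc j))" by (simp only: Sw)
    finally show ?thesis by (simp add: wk)
  qed
  have p': "(p has_vector_derivative ?S (p t)) (at t)" for t
    unfolding Sp unfolding p_def by (rule exponential_sum_derivative)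
  define z where "z t = exp (t *\<^sub>R \<mu>) *s p t" for t
  have z': "(z has_vector_derivative ?M *v z t) (at t)" for t
  proof -
    have "(z has_vector_derivative exp (t *\<^sub>R \<mu>) *s ?S (p t) + (exp (t *\<^sub>R \<mu>) * \<mu>) *s p t) (at t)"
      unfolding z_def
      by (rule bounded_bilinear.has_vector_derivative[OF bounded_bilinear_vector_smult
            exp_scaleR_has_vector_derivative_right p'])
    also have "exp (t *\<^sub>R \<mu>) *s ?S (p t) + (exp (t *\<^sub>R \<mu>) * \<mu>) *s p t = ?M *v z t"
      by (simp add: z_def vector_scalar_commute vec.scale_right_diff_distrib)
    finally show ?thesis .
  qed
  define y where "y t = Re_vec (z t)" for t
  have "p 0 = v"
  proof -
    have "p 0 = (\<Sum>j<Suc k. if j = 0 then w j else 0)"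
      unfolding p_def by (rule sum.cong) auto
    then show ?thesis by (simp add: w_def)
  qed
  then have "y 0 = Re_vec v" by (simp add: y_def z_def)
  moreover have "solves_linear_ode A y"
    unfolding solves_linear_ode_def
  proof
    fix t
    have "bounded_linear (Re_vec :: complex^'n \<Rightarrow> real^'n)"
      using linear_Re_vec by (simp add: linear_conv_bounded_linear)
    from bounded_linear.has_vector_derivative[OF this z'[of t]]
    show "(y has_vector_derivative A *v y t) (at t)" unfolding y_def Re_vec_complexify .
  qed
  moreover have "\<exists>D\<ge>0. \<forall>t. norm (y t) \<le> D * exp (t * Re \<mu> + \<eta> * \<bar>t\<bar>)" if \<eta>: "\<eta> > 0" for \<eta>
  proof -
    define D where "D = (\<Sum>j<Suc k. norm (w j) / \<eta> ^ j)"
    have "norm (y t) \<le> D * exp (t * Re \<mu> + \<eta> * \<bar>t\<bar>)" for t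
    proof -
      have "norm (p t) \<le> (\<Sum>j<Suc k. exp (\<eta> * \<bar>t\<bar>) * (norm (w j) / \<eta> ^ j))"
        unfolding p_def
      proof (rule sum_norm_le)
        fix j
        have "\<bar>t\<bar> ^ j / fact j = ((\<eta> * \<bar>t\<bar>) ^ j / fact j) / \<eta> ^ j"
          using \<eta> by (simp add: power_mult_distrib)
        also have "\<dots> \<le> exp (\<eta> * \<bar>t\<bar>) / \<eta> ^ j"
          using \<eta> by (intro divide_right_mono power_div_fact_le_exp) auto
        finally have "\<bar>t\<bar> ^ j / fact j * norm (w j) \<le> exp (\<eta> * \<bar>t\<bar>) / \<eta> ^ j * norm (w j)"
          by (rule mult_right_mono) simp
        then show "norm ((t ^ j / fact j) *\<^sub>R w j) \<le> exp (\<eta> * \<bar>t\<bar>) * (norm (w j) / \<eta> ^ j)"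
          by (simp add: power_abs)
      qed
      then have "norm (p t) \<le> exp (\<eta> * \<bar>t\<bar>) * D" by (simp only: D_def sum_distrib_left)
      then have "exp (t * Re \<mu>) * norm (p t) \<le> exp (t * Re \<mu>) * (exp (\<eta> * \<bar>t\<bar>) * D)"
        by (rule mult_left_mono) simp
      moreover have "norm (y t) \<le> exp (t * Re \<mu>) * norm (p t)"
        using norm_Re_vec_le[of "z t"] by (simp add: y_def z_def norm_vector_smult)
      moreover have "exp (t * Re \<mu>) * (exp (\<eta> * \<bar>t\<bar>) * D) = D * exp (t * Re \<mu> + \<eta> * \<bar>t\<bar>)"
        by (simp add: exp_add)
      ultimately show ?thesis by linarith
    qed
    moreover have "D \<ge> 0" unfolding D_def using \<eta> by (intro sum_nonneg) auto
    ultimately show ?thesis by blast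
  qed
  ultimately show ?thesis by blast
qed

lemma solves_linear_ode_add:
  "solves_linear_ode A y \<Longrightarrow> solves_linear_ode A z \<Longrightarrow> solves_linear_ode A (\<lambda>t. y t + z t)"
  unfolding solves_linear_ode_def matrix_vector_right_distrib
  by (auto intro: has_vector_derivative_add)

lemma solves_linear_ode_scale:
  assumes "solves_linear_ode A y" shows "solves_linear_ode A (\<lambda>t. c *\<^sub>R y t)"
  unfolding solves_linear_ode_def
proof
  fix t
  have "(y has_vector_derivative A *v y t) (at t)" using assms unfolding solves_linear_ode_def by blast
  from bounded_linear.has_vector_derivative[OF bounded_linear_scaleR_right this, of c]
  show "((\<lambda>t. c *\<^sub>R y t) has_vector_derivative A *v (c *\<^sub>R y t)) (at t)"
    by (simp add: matrix_vector_mult_scaleR)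
qed

text \<open>
  The initial values that admit a global solution form a subspace, and it contains the spanning
  set of real parts of generalized eigenvectors.
\<close>

lemma linear_ode_solution_exists: "\<exists>y. y 0 = x \<and> solves_linear_ode A y"
proof -
  define X where "X = {x. \<exists>y. y 0 = x \<and> solves_linear_ode A y}"
  have "subspace X"
    unfolding subspace_def X_def
  proof (safe, goal_cases)
    case 1
    show ?case by (rule exI[of _ "\<lambda>_. 0"]) (simp add: solves_linear_ode_def)
  next
    case (2 _ _ y z)
    then show ?case by (intro exI[of _ "\<lambda>t. y t + z t"]) (simp add: solves_linear_ode_add)
  next
    case (3 c _ y)
    then show ?case by (intro exI[of _ "\<lambda>t. c *\<^sub>R y t"]) (simp add: solves_linear_ode_scale)
  qed
  moreover have "UNIV \<inter> (\<Union>\<mu>. Re_vec ` generalized_eigenspace A \<mu>) \<subseteq> X"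
    unfolding X_def using generalized_eigenvector_solution[of _ A] by blast
  ultimately have "span (UNIV \<inter> (\<Union>\<mu>. Re_vec ` generalized_eigenspace A \<mu>)) \<subseteq> X"
    by (rule span_minimal[rotated])
  moreover have "x \<in> span (UNIV \<inter> (\<Union>\<mu>. Re_vec ` generalized_eigenspace A \<mu>))"
    by (rule invariant_subspace_spanned_by_Re_vec) auto
  ultimately show ?thesis unfolding X_def by blast
qed

text \<open>
  The matrix exponential \<open>e\<^sup>t\<^sup>A\<close>, applied to \<open>x\<close>.
\<close>

definition free_flow :: "real^'n^'n \<Rightarrow> real \<Rightarrow> real^'n \<Rightarrow> real^'n" where
  "free_flow A t x = (SOME y. y 0 = x \<and> solves_linear_ode A y) t"

lemma free_flow_solves: "solves_linear_ode A (\<lambda>t. free_flow A t x)" and free_flow_0: "free_flow A 0 x = x"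
  using someI_ex[OF linear_ode_solution_exists[of x A]] by (simp_all add: free_flow_def)

lemma free_flow_eqI: "solves_linear_ode A y \<Longrightarrow> free_flow A t (y 0) = y t"
  by (rule solves_linear_ode_unique[OF free_flow_solves]) (auto simp: free_flow_0)

lemma linear_free_flow: "linear (free_flow A t)"
proof (rule linearI)
  show "free_flow A t (x + y) = free_flow A t x + free_flow A t y" for x y
    using free_flow_eqI[OF solves_linear_ode_add[OF free_flow_solves free_flow_solves], of A t x y]
    by (simp add: free_flow_0)
  show "free_flow A t (c *\<^sub>R x) = c *\<^sub>R free_flow A t x" for c x
    using free_flow_eqI[OF solves_linear_ode_scale[OF free_flow_solves], of A t c x]
    by (simp add: free_flow_0)
qed

lemma free_flow_add: "free_flow A (s + t) x = free_flow A s (free_flow A t x)"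
proof -
  have "solves_linear_ode A (\<lambda>s. free_flow A (s + t) x)"
    unfolding solves_linear_ode_def
  proof
    fix s
    have "((\<lambda>r. free_flow A r x) has_vector_derivative A *v free_flow A (s + t) x) (at (s + t))"
      using free_flow_solves unfolding solves_linear_ode_def by blast
    moreover have "((\<lambda>s. s + t) has_vector_derivative 1) (at s)"
      by (auto intro!: derivative_eq_intros)
    ultimately have "((\<lambda>r. free_flow A r x) \<circ> (\<lambda>s. s + t) has_vector_derivative
        1 *\<^sub>R (A *v free_flow A (s + t) x)) (at s)"
      by (intro vector_diff_chain_at)
    then show "((\<lambda>s. free_flow A (s + t) x) has_vector_derivative A *v free_flow A (s + t) x) (at s)"
      by (simp add: o_def)
  qed
  from free_flow_eqI[OF this, of s] show ?thesis by simp
qed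

lemma generalized_eigenvector_growth:
  assumes v: "v \<in> generalized_eigenspace A \<mu>" and \<eta>: "\<eta> > 0"
  shows "\<exists>D\<ge>0. \<forall>t. norm (free_flow A t (Re_vec v)) \<le> D * exp (t * Re \<mu> + \<eta> * \<bar>t\<bar>)"
proof -
  obtain y where y: "y 0 = Re_vec v" "solves_linear_ode A y"
    "\<forall>\<eta>>0. \<exists>D\<ge>0. \<forall>t. norm (y t) \<le> D * exp (t * Re \<mu> + \<eta> * \<bar>t\<bar>)"
    using generalized_eigenvector_solution[OF v] by blast
  have "free_flow A t (Re_vec v) = y t" for t using free_flow_eqI[OF y(2), of t] y(1) by simp
  then show ?thesis using y(3) \<eta> by simp
qed

lemma generalized_eigenvector_stable:
  assumes v: "v \<in> generalized_eigenspace A \<mu>" and "Re \<mu> < 0"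
  shows "Re_vec v \<in> stable_space (free_flow A)"
proof -
  have "- Re \<mu> / 2 > 0" using assms(2) by simp
  from generalized_eigenvector_growth[OF v this] obtain D where
    D: "\<And>t. norm (free_flow A t (Re_vec v)) \<le> D * exp (t * Re \<mu> + (- Re \<mu> / 2) * \<bar>t\<bar>)" by blast
  have "norm (free_flow A t (Re_vec v)) \<le> D * exp (- ((- Re \<mu> / 2) * t))" if "t \<ge> 0" for t
  proof -
    have "t * Re \<mu> + (- Re \<mu> / 2) * \<bar>t\<bar> = - ((- Re \<mu> / 2) * t)" using that by (simp add: field_simps)
    then show ?thesis using D[of t] by (simp only:)
  qed
  then show ?thesis unfolding stable_space_def using \<open>- Re \<mu> / 2 > 0\<close> by blast
qed

lemma generalized_eigenvector_unstable:
  assumes v: "v \<in> generalized_eigenspace A \<mu>" and "Re \<mu> > 0"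
  shows "Re_vec v \<in> stable_space (backward (free_flow A))"
proof -
  have "Re \<mu> / 2 > 0" using assms(2) by simp
  from generalized_eigenvector_growth[OF v this] obtain D where
    D: "\<And>t. norm (free_flow A t (Re_vec v)) \<le> D * exp (t * Re \<mu> + (Re \<mu> / 2) * \<bar>t\<bar>)" by blast
  have "norm (backward (free_flow A) t (Re_vec v)) \<le> D * exp (- ((Re \<mu> / 2) * t))" if "t \<ge> 0" for t
  proof -
    have "- t * Re \<mu> + (Re \<mu> / 2) * \<bar>- t\<bar> = - ((Re \<mu> / 2) * t)" using that by (simp add: field_simps)
    then show ?thesis using D[of "- t"] by (simp only: backward_def)
  qed
  then show ?thesis unfolding stable_space_def using \<open>Re \<mu> / 2 > 0\<close> by blast
qed

lemma generalized_eigenvector_neutral: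
  assumes v: "v \<in> generalized_eigenspace A \<mu>" and "Re \<mu> = 0"
  shows "Re_vec v \<in> neutral_space (free_flow A)"
proof -
  have *: "\<exists>D. \<forall>t. norm (free_flow A t (Re_vec v)) \<le> D * exp (\<eta> * \<bar>t\<bar>)" if "\<eta> > 0" for \<eta>
    using generalized_eigenvector_growth[OF v that] assms(2) by auto
  have "Re_vec v \<in> subexponential_space (free_flow A)"
    unfolding subexponential_space_def
  proof (intro CollectI allI impI)
    fix \<eta> :: real assume "\<eta> > 0"
    then obtain D where D: "\<And>t. norm (free_flow A t (Re_vec v)) \<le> D * exp (\<eta> * \<bar>t\<bar>)" using * by blast
    show "\<exists>C. \<forall>t\<ge>0. norm (free_flow A t (Re_vec v)) \<le> C * exp (\<eta> * t)"
    proof (intro exI allI impI)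
      fix t :: real assume "t \<ge> 0"
      then show "norm (free_flow A t (Re_vec v)) \<le> D * exp (\<eta> * t)" using D[of t] by simp
    qed
  qed
  moreover have "Re_vec v \<in> subexponential_space (backward (free_flow A))"
    unfolding subexponential_space_def
  proof (intro CollectI allI impI)
    fix \<eta> :: real assume "\<eta> > 0"
    then obtain D where D: "\<And>t. norm (free_flow A t (Re_vec v)) \<le> D * exp (\<eta> * \<bar>t\<bar>)" using * by blast
    show "\<exists>C. \<forall>t\<ge>0. norm (backward (free_flow A) t (Re_vec v)) \<le> C * exp (\<eta> * t)"
    proof (intro exI allI impI)
      fix t :: real assume "t \<ge> 0"
      then show "norm (backward (free_flow A) t (Re_vec v)) \<le> D * exp (\<eta> * t)"
        using D[of "- t"] by (simp add: backward_def)
    qed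
  qed
  ultimately show ?thesis unfolding neutral_space_def by blast
qed

lemma subspace_stable_free_flow:
  "subspace (stable_space (free_flow A))" "subspace (stable_space (backward (free_flow A)))"
  by (intro subspace_stable_space; simp add: backward_def linear_free_flow)+

lemma subspace_neutral_free_flow: "subspace (neutral_space (free_flow A))"
  unfolding neutral_space_def
  by (intro subspace_inter subspace_subexponential_space; simp add: backward_def linear_free_flow)

abbreviation center_eigenvectors :: "real^'n^'n \<Rightarrow> (real^'n) set" where
  "center_eigenvectors A \<equiv> (\<Union>\<mu>\<in>{\<mu>. Re \<mu> = 0}. Re_vec ` generalized_eigenspace A \<mu>)"

text \<open>
  A closed subspace invariant under the flow is invariant under \<open>A\<close>, the derivative of the flow
  at time \<open>0\<close>, hence spanned by the real parts of the generalized eigenvectors that it contains. They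
  are sorted by the sign of the real part of the eigenvalue.
\<close>

lemma free_flow_splitting:
  assumes C: "subspace C" "\<And>t. free_flow A t ` C \<subseteq> C" and x: "x \<in> C"
  shows "\<exists>s\<in>C \<inter> stable_space (free_flow A). \<exists>u\<in>C \<inter> stable_space (backward (free_flow A)).
    x - s - u \<in> span (center_eigenvectors A)"
proof -
  have AC: "A *v y \<in> C" if y: "y \<in> C" for y
  proof -
    have "((\<lambda>t. free_flow A t y) has_vector_derivative A *v free_flow A 0 y) (at 0)"
      using free_flow_solves[of A y] unfolding solves_linear_ode_def by blast
    then have lim: "((\<lambda>h. norm (free_flow A h y - y - h *\<^sub>R (A *v y)) / \<bar>h\<bar>) \<longlongrightarrow> 0) (at 0)"
      unfolding has_vector_derivative_def has_derivative_at by (simp add: free_flow_0)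
    have "((\<lambda>h. norm ((free_flow A h y - y) /\<^sub>R h - A *v y)) \<longlongrightarrow> 0) (at 0)"
    proof (rule Lim_transform_eventually[OF lim])
      have "norm (free_flow A h y - y - h *\<^sub>R (A *v y)) / \<bar>h\<bar> = norm ((free_flow A h y - y) /\<^sub>R h - A *v y)"
        if "h \<noteq> 0" for h
      proof -
        have "(free_flow A h y - y) /\<^sub>R h - A *v y = (free_flow A h y - y - h *\<^sub>R (A *v y)) /\<^sub>R h"
          using that by (simp add: scaleR_diff_right)
        then show ?thesis by (simp add: divide_inverse mult.commute)
      qed
      then show "\<forall>\<^sub>F h in at 0. norm (free_flow A h y - y - h *\<^sub>R (A *v y)) / \<bar>h\<bar>
          = norm ((free_flow A h y - y) /\<^sub>R h - A *v y)"
        by (auto simp: eventually_at_filter)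
    qed
    then have "((\<lambda>h. (free_flow A h y - y) /\<^sub>R h) \<longlongrightarrow> A *v y) (at 0)"
      by (rule LIM_zero_cancel[OF tendsto_norm_zero_cancel])
    moreover have "\<forall>\<^sub>F h in at (0::real). (free_flow A h y - y) /\<^sub>R h \<in> C"
      using C(2) y by (intro always_eventually allI subspace_scale[OF C(1)] subspace_diff[OF C(1)]) auto
    ultimately show ?thesis
      by (intro Lim_in_closed_set[OF closed_subspace[OF C(1)], of _ "at (0::real)"]) auto
  qed
  let ?G = "\<lambda>P. C \<inter> (\<Union>\<mu>\<in>{\<mu>. P (Re \<mu>)}. Re_vec ` generalized_eigenspace A \<mu>)"
  have "x \<in> span (C \<inter> (\<Union>\<mu>. Re_vec ` generalized_eigenspace A \<mu>))"
    by (rule invariant_subspace_spanned_by_Re_vec[OF C(1) AC x])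
  moreover have "C \<inter> (\<Union>\<mu>. Re_vec ` generalized_eigenspace A \<mu>)
      \<subseteq> ?G (\<lambda>r. r < 0) \<union> (?G (\<lambda>r. r > 0) \<union> ?G (\<lambda>r. r = 0))"
  proof
    fix w assume "w \<in> C \<inter> (\<Union>\<mu>. Re_vec ` generalized_eigenspace A \<mu>)"
    then obtain \<mu> where \<mu>: "w \<in> C" "w \<in> Re_vec ` generalized_eigenspace A \<mu>" by blast
    then show "w \<in> ?G (\<lambda>r. r < 0) \<union> (?G (\<lambda>r. r > 0) \<union> ?G (\<lambda>r. r = 0))"
      by (cases "Re \<mu>" "0::real" rule: linorder_cases) blast+
  qed
  ultimately have "x \<in> span (?G (\<lambda>r. r < 0) \<union> (?G (\<lambda>r. r > 0) \<union> ?G (\<lambda>r. r = 0)))"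
    by (rule subsetD[OF span_mono, rotated])
  then obtain s u z where suz: "x = s + (u + z)" "s \<in> span (?G (\<lambda>r. r < 0))"
    "u \<in> span (?G (\<lambda>r. r > 0))" "z \<in> span (?G (\<lambda>r. r = 0))"
    unfolding span_Un by blast
  have "span (?G (\<lambda>r. r < 0)) \<subseteq> C \<inter> stable_space (free_flow A)"
    using generalized_eigenvector_stable
    by (intro span_minimal subspace_inter C subspace_stable_free_flow) blast
  moreover have "span (?G (\<lambda>r. r > 0)) \<subseteq> C \<inter> stable_space (backward (free_flow A))"
    using generalized_eigenvector_unstable
    by (intro span_minimal subspace_inter C subspace_stable_free_flow) blast
  moreover have "span (?G (\<lambda>r. r = 0)) \<subseteq> span (center_eigenvectors A)" by (intro span_mono) blast
  moreover have "x - s - u = z" using suz(1) by simp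
  ultimately show ?thesis using suz by blast
qed

lemma center_eigenvectors_neutral: "span (center_eigenvectors A) \<subseteq> neutral_space (free_flow A)"
  using generalized_eigenvector_neutral by (intro span_minimal subspace_neutral_free_flow) blast

lemma linear_group_free_flow: "linear_group (free_flow A)"
proof
  fix C x assume "subspace C" "\<And>t. free_flow A t ` C \<subseteq> C" "x \<in> C"
  from free_flow_splitting[OF this] center_eigenvectors_neutral[of A]
  show "\<exists>s\<in>C \<inter> stable_space (free_flow A). \<exists>u\<in>C \<inter> stable_space (backward (free_flow A)).
      x - s - u \<in> neutral_space (free_flow A)" by blast
qed (simp_all add: linear_add[OF linear_free_flow] linear_scale[OF linear_free_flow] free_flow_0 free_flow_add)

text \<open>
  A neutral vector minus its component in the center space is a sum of a stable and an unstable
  vector. Each of these has subexponential growth in the direction in which it grows exponentially,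
  so it vanishes.
\<close>

theorem center_Lyapunov_space_eq: "center_Lyapunov_space A = neutral_space (free_flow A)"
proof
  show "center_Lyapunov_space A \<subseteq> neutral_space (free_flow A)"
    unfolding center_Lyapunov_space_def
  proof (intro span_minimal subspace_neutral_free_flow UN_least)
    fix \<mu> assume "\<mu> \<in> {\<mu> \<in> eigenvalues A. Re \<mu> = 0}"
    then have \<mu>: "Re \<mu> = 0" by simp
    have "(\<chi> i. Re (v $ i)) \<in> neutral_space (free_flow A)" "(\<chi> i. Im (v $ i)) \<in> neutral_space (free_flow A)"
      if v: "v \<in> generalized_eigenspace A \<mu>" for v
    proof -
      show "(\<chi> i. Re (v $ i)) \<in> neutral_space (free_flow A)"
        using generalized_eigenvector_neutral[OF v \<mu>] by (simp add: Re_vec_def)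
      have "Re_vec ((- \<i>) *s v) = (\<chi> i. Im (v $ i))" by (simp add: Re_vec_def vec_eq_iff)
      then show "(\<chi> i. Im (v $ i)) \<in> neutral_space (free_flow A)"
        using generalized_eigenvector_neutral[OF generalized_eigenspace_scale[OF v, of "- \<i>"] \<mu>] by simp
    qed
    then show "real_generalized_eigenspace A \<mu> \<subseteq> neutral_space (free_flow A)"
      unfolding real_generalized_eigenspace_def by (intro span_minimal subspace_neutral_free_flow) blast
  qed
next
  interpret linear_group "free_flow A" by (rule linear_group_free_flow)
  interpret rev: linear_group "backward (free_flow A)" by (rule reversed_group)
  have sub: "subspace (center_Lyapunov_space A)" unfolding center_Lyapunov_space_def by simp
  have gen: "center_eigenvectors A \<subseteq> center_Lyapunov_space A"
  proof clarify
    fix \<mu> v assume v: "v \<in> generalized_eigenspace A \<mu>" and \<mu>: "Re \<mu> = 0"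
    show "Re_vec v \<in> center_Lyapunov_space A"
    proof (cases "v = 0")
      case True
      then have "Re_vec v = 0" by (simp add: Re_vec_def vec_eq_iff)
      then show ?thesis using subspace_0[OF sub] by simp
    next
      case False
      let ?S = "\<lambda>w. complexify A *v w - \<mu> *s w"
      obtain k where "(?S ^^ k) v = 0" using v unfolding generalized_eigenspace_def by blast
      then obtain j where j: "(?S ^^ j) v = 0" "\<And>i. i < j \<Longrightarrow> (?S ^^ i) v \<noteq> 0"
        using exists_least_iff[of "\<lambda>k. (?S ^^ k) v = 0"] by blast
      then obtain i where i: "j = Suc i" using False by (cases j) auto
      have "(?S ^^ i) v \<noteq> 0" "?S ((?S ^^ i) v) = 0" using j i by auto
      then have "\<mu> \<in> eigenvalues A" unfolding eigenvalues_def by auto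
      moreover have "Re_vec v \<in> real_generalized_eigenspace A \<mu>"
        unfolding real_generalized_eigenspace_def Re_vec_def using v by (intro span_base) blast
      ultimately show ?thesis
        unfolding center_Lyapunov_space_def using \<mu> by (intro span_base) blast
    qed
  qed
  show "neutral_space (free_flow A) \<subseteq> center_Lyapunov_space A"
  proof
    fix x assume x: "x \<in> neutral_space (free_flow A)"
    obtain s u where su: "s \<in> stable_space (free_flow A)" "u \<in> stable_space (backward (free_flow A))"
      "x - s - u \<in> span (center_eigenvectors A)"
      using free_flow_splitting[of UNIV A x] by auto
    define z where "z = x - s - u"
    have z: "z \<in> neutral_space (free_flow A)" "z \<in> center_Lyapunov_space A"
      using su(3) center_eigenvectors_neutral span_minimal[OF gen sub] unfolding z_def by blast+
    have "x - z \<in> neutral_space (free_flow A)" using x z(1) subspace_diff[OF subspace_neutral_free_flow] by blast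
    then have xz: "x - z \<in> subexponential_space (free_flow A)" "x - z \<in> Vunst"
      unfolding neutral_space_def by blast+
    have "(x - z) - u \<in> Vunst"
      using su(2) stable_subset_subexponential[of "backward (free_flow A)"]
      by (intro subspace_diff[OF subspace_Vunst xz(2)]) auto
    then have "s = 0" using Lstab_Int_Vunst[OF su(1)] by (simp add: z_def)
    moreover have "(x - z) - s \<in> subexponential_space (free_flow A)"
      using su(1) stable_subset_subexponential[of "free_flow A"]
      by (intro subspace_diff[OF rev.subspace_Vunst[unfolded backward_backward] xz(1)]) auto
    then have "u = 0" using rev.Lstab_Int_Vunst[OF su(2)] by (simp add: z_def)
    ultimately show "x \<in> center_Lyapunov_space A" using z(2) by (simp add: z_def)
  qed
qed

section \<open>Trajectories of the control system\<close>

lemma primitive_exists: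
  fixes g :: "real \<Rightarrow> 'a::euclidean_space"
  assumes g: "\<And>a b. g integrable_on {a..b}"
  shows "\<exists>F. F 0 = 0 \<and> continuous_on UNIV F \<and> (\<forall>a b. a \<le> b \<longrightarrow> (g has_integral (F b - F a)) {a..b})"
proof -
  define F where "F t = integral {0..t} g - integral {t..0} g" for t
  have diff: "F b - F a = integral {a..b} g" if ab: "a \<le> b" for a b
  proof -
    consider "0 \<le> a" | "a < 0" "0 \<le> b" | "b < 0" by linarith
    then show ?thesis
    proof cases
      case 1
      have "integral {s..0} g = 0" if "0 \<le> s" for s
        using that by (cases "s = 0") auto
      then show ?thesis
        using Henstock_Kurzweil_Integration.integral_combine[OF 1 ab g] 1 ab by (simp add: F_def algebra_simps)
    next
      case 2
      have "integral {b..0} g = 0" using 2 by (cases "b = 0") auto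
      then show ?thesis
        using Henstock_Kurzweil_Integration.integral_combine[of a 0 b g] g 2 by (simp add: F_def add.commute)
    next
      case 3
      then show ?thesis
        using Henstock_Kurzweil_Integration.integral_combine[of a b 0 g] g ab by (simp add: F_def algebra_simps)
    qed
  qed
  have "isCont F t" for t
  proof -
    have "continuous_on {t - 1..t + 1} (\<lambda>s. F (t - 1) + integral {t - 1..s} g)"
      by (intro continuous_intros indefinite_integral_continuous_1 g)
    then have "continuous_on {t - 1..t + 1} F"
    proof (rule continuous_on_eq)
      show "F (t - 1) + integral {t - 1..s} g = F s" if "s \<in> {t - 1..t + 1}" for s
        using diff[of "t - 1" s] that by (simp add: diff_eq_eq add.commute)
    qed
    then show ?thesis by (rule continuous_on_interior) (simp add: interior_atLeastAtMost_real)
  qed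
  then have "continuous_on UNIV F" by (simp add: continuous_at_imp_continuous_on)
  moreover have "(g has_integral (F b - F a)) {a..b}" if "a \<le> b" for a b
    unfolding diff[OF that] using g by (rule integrable_integral)
  ultimately show ?thesis by (intro exI[of _ F]) (simp add: F_def)
qed

lemma free_flow_basis: "free_flow A t x = (\<Sum>b\<in>Basis. (x \<bullet> b) *\<^sub>R free_flow A t b)"
proof -
  have "free_flow A t x = free_flow A t (\<Sum>b\<in>Basis. (x \<bullet> b) *\<^sub>R b)" by (simp add: euclidean_representation)
  then show ?thesis by (simp add: linear_sum[OF linear_free_flow] linear_scale[OF linear_free_flow])
qed

lemma has_vector_derivative_free_flow:
  assumes w: "(w has_vector_derivative w') (at t)"
  shows "((\<lambda>t. free_flow A t (w t)) has_vector_derivative free_flow A t w' + A *v free_flow A t (w t)) (at t)"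
proof -
  have ff: "((\<lambda>t. free_flow A t b) has_vector_derivative A *v free_flow A t b) (at t)" for b
    using free_flow_solves unfolding solves_linear_ode_def by blast
  have wb: "((\<lambda>t. w t \<bullet> b) has_real_derivative w' \<bullet> b) (at t)" for b
    using bounded_linear.has_vector_derivative[OF bounded_linear_inner_left w]
    by (simp add: has_real_derivative_iff_has_vector_derivative)
  have "((\<lambda>t. \<Sum>b\<in>Basis. (w t \<bullet> b) *\<^sub>R free_flow A t b) has_vector_derivative
      (\<Sum>b\<in>Basis. (w t \<bullet> b) *\<^sub>R (A *v free_flow A t b) + (w' \<bullet> b) *\<^sub>R free_flow A t b)) (at t)"
    by (intro has_vector_derivative_sum has_vector_derivative_scaleR wb ff)
  moreover have "(\<lambda>t. \<Sum>b\<in>Basis. (w t \<bullet> b) *\<^sub>R free_flow A t b) = (\<lambda>t. free_flow A t (w t))"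
    by (simp add: free_flow_basis[symmetric])
  moreover have "(\<Sum>b\<in>Basis. (w t \<bullet> b) *\<^sub>R (A *v free_flow A t b) + (w' \<bullet> b) *\<^sub>R free_flow A t b)
      = free_flow A t w' + A *v free_flow A t (w t)"
    by (subst (3 4) free_flow_basis)
      (simp add: sum.distrib linear_sum[OF matrix_vector_mul_linear] matrix_vector_mult_scaleR)
  ultimately show ?thesis by simp
qed

lemma continuous_free_flow:
  assumes w: "isCont w t" and s: "isCont s t"
  shows "isCont (\<lambda>t. free_flow A (s t) (w t)) t"
proof -
  have ff: "isCont (\<lambda>t. free_flow A t b) r" for b r
    using free_flow_solves unfolding solves_linear_ode_def by (blast intro: has_vector_derivative_continuous)
  have "isCont (\<lambda>t. \<Sum>b\<in>Basis. (w t \<bullet> b) *\<^sub>R free_flow A (s t) b) t"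
    by (intro continuous_intros w isCont_o2[OF s ff])
  then show ?thesis by (simp only: free_flow_basis[symmetric])
qed

lemma integrable_control:
  fixes B :: "real^'m^'n"
  assumes u: "u \<in> admissible_controls U"
  shows "(\<lambda>s. B *v u s) integrable_on {a..b}"
proof -
  obtain C where C: "AE t in lebesgue. norm (u t) \<le> C" and m: "u \<in> borel_measurable lebesgue"
    using u unfolding admissible_controls_def by blast
  have "integrable lebesgue (\<lambda>x. indicator {a..b} x *\<^sub>R u x)"
    by (rule integrableI_bounded_set_indicator[where B = C]) (use C m in \<open>auto simp: emeasure_lborel_Icc_eq elim: eventually_mono\<close>)
  then have "u integrable_on {a..b}"
    by (intro set_lebesgue_integral_eq_integral(1)) (simp add: set_integrable_def)
  from integrable_linear[OF this matrix_vector_mul_bounded_linear[of B]] show ?thesis by (simp add: o_def)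
qed

text \<open>
  Let \<open>F\<close> be a primitive of the forcing term \<open>B u\<close>. A trajectory is \<open>y + F\<close>, where \<open>y\<close> solves
  \<open>y' = A y + A F\<close>; as \<open>F\<close> is continuous, variation of constants gives a classical solution \<open>y\<close>.
\<close>

lemma trajectory_exists:
  fixes A :: "real^'n^'n" and B :: "real^'m^'n"
  assumes u: "u \<in> admissible_controls U"
  shows "\<exists>x. is_trajectory A B x0 u x"
proof -
  obtain F where F: "F 0 = 0" "continuous_on UNIV F"
    "\<And>a b. a \<le> b \<Longrightarrow> ((\<lambda>s. B *v u s) has_integral (F b - F a)) {a..b}"
    using primitive_exists[OF integrable_control[OF u, of B]] by blast
  have contF: "isCont F t" for t using F(2) continuous_on_eq_continuous_at by blast
  have "isCont (\<lambda>s. free_flow A (- s) (A *v F s)) t" for t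
    by (intro continuous_free_flow continuous_intros contF
        linear_continuous_at[THEN isCont_o2[OF contF]] matrix_vector_mul_bounded_linear)
  then obtain G where G: "\<And>t. (G has_vector_derivative free_flow A (- t) (A *v F t)) (at t)"
    using einterval_antiderivative[of "-\<infinity>" \<infinity> "\<lambda>s. free_flow A (- s) (A *v F s)"] by auto
  define y where "y t = free_flow A t (x0 + (G t - G 0))" for t
  have inv: "free_flow A t (free_flow A (- t) z) = z" for t z
    using free_flow_add[of A t "- t" z] by (simp add: free_flow_0)
  have y': "(y has_vector_derivative A *v F t + A *v y t) (at t)" for t
  proof -
    have "((\<lambda>t. x0 + (G t - G 0)) has_vector_derivative free_flow A (- t) (A *v F t)) (at t)"
      by (auto intro!: derivative_eq_intros G)
    from has_vector_derivative_free_flow[OF this, of A] show ?thesis unfolding y_def inv .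
  qed
  have "is_trajectory A B x0 u (\<lambda>t. y t + F t)"
    unfolding is_trajectory_def
  proof (intro conjI allI impI)
    show "y 0 + F 0 = x0" by (simp add: y_def F(1) free_flow_0)
    fix a b :: real assume ab: "a \<le> b"
    have "((\<lambda>s. A *v F s + A *v y s) has_integral (y b - y a)) {a..b}"
      using ab y' by (intro fundamental_theorem_of_calculus) (auto intro: has_vector_derivative_at_within)
    from has_integral_add[OF this F(3)[OF ab]]
    show "((\<lambda>s. A *v (y s + F s) + B *v u s) has_integral (y b + F b - (y a + F a))) {a..b}"
      by (simp add: matrix_vector_right_distrib algebra_simps)
  qed
  then show ?thesis by blast
qed

lemma integral_ode_zero:
  fixes A :: "real^'n^'n" and d :: "real \<Rightarrow> real^'n"
  assumes int: "\<And>p q. a \<le> p \<Longrightarrow> p \<le> q \<Longrightarrow> q \<le> b \<Longrightarrow> ((\<lambda>s. A *v d s) has_integral (d q - d p)) {p..q}"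
    and c: "c \<in> {a..b}" "d c = 0" and t: "t \<in> {a..b}"
  shows "d t = 0"
proof -
  have d: "d s = d a + integral {a..s} (\<lambda>s. A *v d s)" if "s \<in> {a..b}" for s
    using int[of a s] that by (auto simp: integral_unique)
  have "(\<lambda>s. A *v d s) integrable_on {a..b}" using int[of a b] c by (auto simp: integrable_on_def)
  then have "continuous_on {a..b} (\<lambda>s. d a + integral {a..s} (\<lambda>s. A *v d s))"
    by (intro continuous_intros indefinite_integral_continuous_1)
  then have contd: "continuous_on {a..b} d" by (rule continuous_on_eq) (rule d[symmetric])
  have contAd: "continuous_on {a..b} (\<lambda>s. A *v d s)"
    by (rule bounded_linear.continuous_on[OF matrix_vector_mul_bounded_linear contd])
  have "(d has_vector_derivative A *v d s) (at s within {a..b})" if s: "s \<in> {a..b}" for s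
  proof (rule has_vector_derivative_transform[OF s])
    show "d r = d a + integral {a..r} (\<lambda>s. A *v d s)" if "r \<in> {a..b}" for r using d[OF that] .
    show "((\<lambda>r. d a + integral {a..r} (\<lambda>s. A *v d s)) has_vector_derivative A *v d s) (at s within {a..b})"
      using has_vector_derivative_add[OF has_vector_derivative_const integral_has_vector_derivative[OF contAd s]]
      by simp
  qed
  then show ?thesis by (rule linear_ode_zero[where d = d, OF _ c t])
qed

text \<open>
  Causality: the difference of the trajectories solves the homogeneous equation. The endpoint \<open>b\<close> is
  exempt from the comparison of the controls because the integral does not see it; this allows a
  switch of the control at time \<open>b\<close>.
\<close>

lemma trajectories_agree:
  assumes X: "is_trajectory A B x u X" and Y: "is_trajectory A B x w Y"
    and eq: "\<And>s. s \<in> {a..b} \<Longrightarrow> s \<noteq> b \<Longrightarrow> u s = w s" and ab: "a \<le> 0" "0 \<le> b" and t: "t \<in> {a..b}"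
  shows "X t = Y t"
proof -
  define d where "d = (\<lambda>s. X s - Y s)"
  have "((\<lambda>s. A *v d s) has_integral (d q - d p)) {p..q}" if pq: "a \<le> p" "p \<le> q" "q \<le> b" for p q
  proof -
    have "((\<lambda>s. (A *v X s + B *v u s) - (A *v Y s + B *v w s)) has_integral ((X q - X p) - (Y q - Y p))) {p..q}"
      using X Y pq(2) unfolding is_trajectory_def by (intro has_integral_diff) auto
    moreover have "(X q - X p) - (Y q - Y p) = d q - d p" by (simp add: d_def)
    ultimately have "((\<lambda>s. (A *v X s + B *v u s) - (A *v Y s + B *v w s)) has_integral (d q - d p)) {p..q}" by simp
    then show ?thesis
    proof (rule has_integral_spike_finite[rotated 2])
      show "finite {b}" by simp
      show "A *v d s = (A *v X s + B *v u s) - (A *v Y s + B *v w s)" if "s \<in> {p..q} - {b}" for s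
        using eq[of s] that pq by (simp add: d_def matrix_vector_mult_diff_distrib)
    qed
  qed
  moreover have "d 0 = 0" using X Y by (simp add: d_def is_trajectory_def)
  ultimately have "d t = 0" using integral_ode_zero[of a b A d 0 t] ab t by auto
  then show ?thesis by (simp add: d_def)
qed

lemma trajectory_unique:
  assumes "is_trajectory A B x u X" "is_trajectory A B x u Y"
  shows "X = Y"
proof
  fix t
  show "X t = Y t"
    by (rule trajectories_agree[OF assms, of "- \<bar>t\<bar>" "\<bar>t\<bar>"]) auto
qed

lemma flow_eqI: "is_trajectory A B x u X \<Longrightarrow> flow A B t x u = X t"
  unfolding flow_def by (metis the_equality trajectory_unique)

lemma flow_trajectory:
  assumes "u \<in> admissible_controls U"
  shows "is_trajectory A B x u (\<lambda>t. flow A B t x u)"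
proof -
  obtain X where X: "is_trajectory A B x u X" using trajectory_exists[OF assms] by blast
  then have "(\<lambda>t. flow A B t x u) = X" using flow_eqI by blast
  then show ?thesis using X by simp
qed

lemma trajectory_combination:
  assumes X: "is_trajectory A B x u X" and Y: "is_trajectory A B y v Y"
  shows "is_trajectory A B (p *\<^sub>R x + q *\<^sub>R y) (\<lambda>t. p *\<^sub>R u t + q *\<^sub>R v t) (\<lambda>t. p *\<^sub>R X t + q *\<^sub>R Y t)"
  unfolding is_trajectory_def
proof (intro conjI allI impI)
  show "p *\<^sub>R X 0 + q *\<^sub>R Y 0 = p *\<^sub>R x + q *\<^sub>R y" using X Y by (simp add: is_trajectory_def)
  fix a b :: real assume "a \<le> b"
  then have "((\<lambda>s. p *\<^sub>R (A *v X s + B *v u s) + q *\<^sub>R (A *v Y s + B *v v s)) has_integral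
      (p *\<^sub>R (X b - X a) + q *\<^sub>R (Y b - Y a))) {a..b}"
    using X Y unfolding is_trajectory_def by (intro has_integral_add has_integral_cmul) auto
  then show "((\<lambda>s. A *v (p *\<^sub>R X s + q *\<^sub>R Y s) + B *v (p *\<^sub>R u s + q *\<^sub>R v s)) has_integral
      (p *\<^sub>R X b + q *\<^sub>R Y b - (p *\<^sub>R X a + q *\<^sub>R Y a))) {a..b}"
    by (simp add: matrix_vector_right_distrib matrix_vector_mult_scaleR algebra_simps)
qed

lemma free_flow_trajectory: "is_trajectory A B x (\<lambda>_. 0) (\<lambda>t. free_flow A t x)"
  unfolding is_trajectory_def
proof (intro conjI allI impI)
  show "free_flow A 0 x = x" by (rule free_flow_0)
  fix a b :: real assume ab: "a \<le> b"
  have "((\<lambda>t. free_flow A t x) has_vector_derivative A *v free_flow A t x) (at t within {a..b})" for t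
    using free_flow_solves unfolding solves_linear_ode_def by (blast intro: has_vector_derivative_at_within)
  then have "((\<lambda>s. A *v free_flow A s x) has_integral (free_flow A b x - free_flow A a x)) {a..b}"
    using ab by (intro fundamental_theorem_of_calculus)
  then show "((\<lambda>s. A *v free_flow A s x + B *v 0) has_integral (free_flow A b x - free_flow A a x)) {a..b}"
    by simp
qed

lemma flow_decompose:
  assumes "u \<in> admissible_controls U"
  shows "flow A B t x u = free_flow A t x + flow A B t 0 u"
  using flow_eqI[OF trajectory_combination[OF free_flow_trajectory flow_trajectory[OF assms], of A B 1 x 1 0], of t]
  by simp

lemma flow_shift:
  assumes u: "u \<in> admissible_controls U"
  shows "flow A B (t + s) x u = flow A B t (flow A B s x u) (\<lambda>r. u (r + s))"
proof -
  let ?X = "\<lambda>t. flow A B t x u"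
  have "is_trajectory A B (?X s) (\<lambda>r. u (r + s)) (\<lambda>t. ?X (t + s))"
    unfolding is_trajectory_def
  proof (intro conjI allI impI)
    fix a b :: real assume "a \<le> b"
    then have "((\<lambda>r. A *v ?X r + B *v u r) has_integral (?X (b + s) - ?X (a + s))) {a + s..b + s}"
      using flow_trajectory[OF u, of A B x] by (simp add: is_trajectory_def)
    from has_integral_shift_real_ivl[OF this, of s]
    show "((\<lambda>r. A *v ?X (r + s) + B *v u (r + s)) has_integral (?X (b + s) - ?X (a + s))) {a..b}" by simp
  qed simp
  from flow_eqI[OF this, of t] show ?thesis by simp
qed

lemma flow_cong:
  assumes "u \<in> admissible_controls U" "w \<in> admissible_controls U" "0 \<le> t"
    and "\<And>s. 0 \<le> s \<Longrightarrow> s < t \<Longrightarrow> u s = w s"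
  shows "flow A B t x u = flow A B t x w"
  using trajectories_agree[OF flow_trajectory[OF assms(1)] flow_trajectory[OF assms(2)], of 0 t t A B x] assms(3,4)
  by auto

lemma zero_admissible: "0 \<in> U \<Longrightarrow> (\<lambda>_. 0) \<in> admissible_controls U"
  unfolding admissible_controls_def by auto

lemma AE_shift:
  fixes P :: "real \<Rightarrow> bool"
  assumes "AE t in lebesgue. P t"
  shows "AE t in lebesgue. P (t + s)"
proof -
  obtain N where N: "N \<in> null_sets lebesgue" "{t. \<not> P t} \<subseteq> N"
    using assms by (auto simp: eventually_ae_filter)
  then have "negligible ((+) (- s) ` N)"
    using negligible_translation[of N "- s"] by (simp add: negligible_iff_null_sets)
  then have "(+) (- s) ` N \<in> null_sets lebesgue" by (simp add: negligible_iff_null_sets)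
  moreover have "{t. \<not> P (t + s)} \<subseteq> (+) (- s) ` N"
  proof
    fix t assume "t \<in> {t. \<not> P (t + s)}"
    then have "t + s \<in> N" using N(2) by auto
    then show "t \<in> (+) (- s) ` N" by (intro image_eqI[of _ _ "t + s"]) auto
  qed
  ultimately show ?thesis by (auto simp: eventually_ae_filter)
qed

lemma shift_admissible:
  assumes u: "u \<in> admissible_controls U"
  shows "(\<lambda>r. u (r + s)) \<in> admissible_controls U"
proof -
  obtain C where C: "u \<in> borel_measurable lebesgue" "AE t in lebesgue. norm (u t) \<le> C"
    "AE t in lebesgue. u t \<in> U" using u unfolding admissible_controls_def by blast
  have "(\<lambda>r::real. s + (\<Sum>j\<in>Basis. (1 * (r \<bullet> j)) *\<^sub>R j)) \<in> lebesgue \<rightarrow>\<^sub>M lebesgue"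
    by (rule lebesgue_affine_measurable) auto
  then have "(\<lambda>r::real. r + s) \<in> lebesgue \<rightarrow>\<^sub>M lebesgue" by (simp add: add.commute)
  from measurable_compose[OF this C(1)] AE_shift[OF C(2)] AE_shift[OF C(3)]
  show ?thesis unfolding admissible_controls_def by blast
qed

lemma switch_admissible:
  assumes u: "u \<in> admissible_controls U" and v: "v \<in> admissible_controls U"
  shows "(\<lambda>r. if r < s then u r else v r) \<in> admissible_controls U"
proof -
  obtain C where C: "u \<in> borel_measurable lebesgue" "AE t in lebesgue. norm (u t) \<le> C"
    "AE t in lebesgue. u t \<in> U" using u unfolding admissible_controls_def by blast
  obtain D where D: "v \<in> borel_measurable lebesgue" "AE t in lebesgue. norm (v t) \<le> D"
    "AE t in lebesgue. v t \<in> U" using v unfolding admissible_controls_def by blast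
  have "{r::real. r < s} = {..<s}" by auto
  then have "(\<lambda>r. if r < s then u r else v r) \<in> borel_measurable lebesgue"
    using C(1) D(1) by (intro measurable_If) auto
  moreover have "AE t in lebesgue. norm (if t < s then u t else v t) \<le> max C D"
    using C(2) D(2) by eventually_elim auto
  moreover have "AE t in lebesgue. (if t < s then u t else v t) \<in> U"
    using C(3) D(3) by eventually_elim auto
  ultimately show ?thesis unfolding admissible_controls_def by blast
qed

lemma convex_combination_admissible:
  assumes "convex U" and u: "u \<in> admissible_controls U" and v: "v \<in> admissible_controls U"
    and pq: "0 \<le> p" "0 \<le> q" "p + q = 1"
  shows "(\<lambda>r. p *\<^sub>R u r + q *\<^sub>R v r) \<in> admissible_controls U"
proof -
  obtain C where C: "u \<in> borel_measurable lebesgue" "AE t in lebesgue. norm (u t) \<le> C"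
    "AE t in lebesgue. u t \<in> U" using u unfolding admissible_controls_def by blast
  obtain D where D: "v \<in> borel_measurable lebesgue" "AE t in lebesgue. norm (v t) \<le> D"
    "AE t in lebesgue. v t \<in> U" using v unfolding admissible_controls_def by blast
  have "(\<lambda>r. p *\<^sub>R u r + q *\<^sub>R v r) \<in> borel_measurable lebesgue" using C(1) D(1) by measurable
  moreover have "AE t in lebesgue. norm (p *\<^sub>R u t + q *\<^sub>R v t) \<le> p * C + q * D"
    using C(2) D(2)
  proof eventually_elim
    case (elim t)
    then have "norm (p *\<^sub>R u t) \<le> p * C" "norm (q *\<^sub>R v t) \<le> q * D"
      using pq by (auto intro: mult_left_mono)
    then show ?case by (rule norm_triangle_le[OF add_mono])
  qed
  moreover have "AE t in lebesgue. p *\<^sub>R u t + q *\<^sub>R v t \<in> U"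
    using C(3) D(3) by eventually_elim (use assms(1) pq in \<open>auto intro: convexD\<close>)
  ultimately show ?thesis unfolding admissible_controls_def by blast
qed

lemma reflect_admissible:
  assumes \<kappa>: "\<And>x. x \<in> U \<Longrightarrow> - (\<kappa> *\<^sub>R x) \<in> U" and u: "u \<in> admissible_controls U"
  shows "(\<lambda>r. - (\<kappa> *\<^sub>R u r)) \<in> admissible_controls U"
proof -
  obtain C where C: "u \<in> borel_measurable lebesgue" "AE t in lebesgue. norm (u t) \<le> C"
    "AE t in lebesgue. u t \<in> U" using u unfolding admissible_controls_def by blast
  have "(\<lambda>r. - (\<kappa> *\<^sub>R u r)) \<in> borel_measurable lebesgue" using C(1) by measurable
  moreover have "AE t in lebesgue. norm (- (\<kappa> *\<^sub>R u t)) \<le> \<bar>\<kappa>\<bar> * C"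
    using C(2) by eventually_elim (auto intro: mult_left_mono)
  moreover have "AE t in lebesgue. - (\<kappa> *\<^sub>R u t) \<in> U"
    using C(3) by eventually_elim (rule \<kappa>)
  ultimately show ?thesis unfolding admissible_controls_def by blast
qed

definition reach_from_zero :: "real^'n^'n \<Rightarrow> real^'m^'n \<Rightarrow> (real^'m) set \<Rightarrow> real \<Rightarrow> (real^'n) set" where
  "reach_from_zero A B U t = (\<lambda>u. flow A B t 0 u) ` admissible_controls U"

lemma flow_concat:
  assumes u: "u \<in> admissible_controls U" and v: "v \<in> admissible_controls U" and st: "0 \<le> s" "0 \<le> t"
  shows "\<exists>w\<in>admissible_controls U. (\<forall>r\<in>{0..s}. flow A B r x w = flow A B r x u) \<and>
    (\<forall>r\<ge>0. flow A B (r + s) x w = flow A B r (flow A B s x u) v)"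
proof -
  define w where "w = (\<lambda>r. if r < s then u r else v (r + - s))"
  have w: "w \<in> admissible_controls U" unfolding w_def by (rule switch_admissible[OF u shift_admissible[OF v]])
  have eq: "flow A B r x w = flow A B r x u" if "r \<in> {0..s}" for r
    by (rule flow_cong[OF w u]) (use that in \<open>auto simp: w_def\<close>)
  have "flow A B (r + s) x w = flow A B r (flow A B s x u) v" if "r \<ge> 0" for r
  proof -
    have "flow A B (r + s) x w = flow A B r (flow A B s x u) (\<lambda>r. w (r + s))"
      using flow_shift[OF w, of A B r s x] eq[of s] st by simp
    also have "\<dots> = flow A B r (flow A B s x u) v"
      by (rule flow_cong[OF shift_admissible[OF w] v that]) (simp add: w_def)
    finally show ?thesis .
  qed
  then show ?thesis using w eq by blast
qed

lemma reflection_factor: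
  fixes U :: "'a::euclidean_space set"
  assumes "compact U" "0 \<in> interior U"
  shows "\<exists>\<kappa>>0. \<forall>x\<in>U. - (\<kappa> *\<^sub>R x) \<in> U"
proof -
  obtain e where e: "e > 0" "ball 0 e \<subseteq> U" using assms(2) mem_interior by blast
  obtain M where M: "M > 0" "\<And>x. x \<in> U \<Longrightarrow> norm x \<le> M"
    using compact_imp_bounded[OF assms(1)] unfolding bounded_pos by blast
  have "- ((e / (2 * M)) *\<^sub>R x) \<in> U" if "x \<in> U" for x
  proof -
    have "e / (2 * M) * norm x \<le> e / (2 * M) * M" using M e that by (intro mult_left_mono) auto
    also have "\<dots> < e" using e M by simp
    finally show ?thesis using e M by (intro subsetD[OF e(2)]) auto
  qed
  then show ?thesis using e M by (intro exI[of _ "e / (2 * M)"]) auto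
qed

text \<open>
  The sets reached from the origin fit the abstract setting: convexity and \<open>- \<kappa> R t \<subseteq> R t\<close> come from
  the same properties of the control range by linearity, the formula for \<open>R (s + t)\<close> from cutting and
  concatenating controls.
\<close>

theorem reachability_flow:
  assumes U: "compact U" "convex U" "0 \<in> interior U"
  shows "\<exists>\<kappa>. reachability (free_flow A) (reach_from_zero A B U) \<kappa>"
proof -
  obtain \<kappa> where \<kappa>: "\<kappa> > 0" "\<And>x. x \<in> U \<Longrightarrow> - (\<kappa> *\<^sub>R x) \<in> U" using reflection_factor[OF U(1,3)] by blast
  have U0: "0 \<in> U" using U(3) interior_subset by blast
  interpret linear_group "free_flow A" by (rule linear_group_free_flow)
  let ?R = "reach_from_zero A B U"
  have "reachability (free_flow A) ?R \<kappa>"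
  proof
    show "0 < \<kappa>" by (rule \<kappa>)
    fix t :: real assume t: "0 \<le> t"
    show "convex (?R t)"
      unfolding convex_def
    proof (intro ballI allI impI)
      fix x y and p q :: real
      assume xy: "x \<in> ?R t" "y \<in> ?R t" and pq: "0 \<le> p" "0 \<le> q" "p + q = 1"
      then obtain u v where uv: "u \<in> admissible_controls U" "x = flow A B t 0 u"
        "v \<in> admissible_controls U" "y = flow A B t 0 v" unfolding reach_from_zero_def by blast
      have "flow A B t 0 (\<lambda>r. p *\<^sub>R u r + q *\<^sub>R v r) = p *\<^sub>R x + q *\<^sub>R y"
        using flow_eqI[OF trajectory_combination[OF flow_trajectory[OF uv(1)] flow_trajectory[OF uv(3)],
            of A B p 0 q 0], of t] uv(2,4) by simp
      then show "p *\<^sub>R x + q *\<^sub>R y \<in> ?R t"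
        using convex_combination_admissible[OF U(2) uv(1,3) pq] unfolding reach_from_zero_def by force
    qed
    have "flow A B t 0 (\<lambda>_. 0) = 0"
      using flow_eqI[OF free_flow_trajectory, of A B t 0] linear_0[OF linear_free_flow] by simp
    then show "0 \<in> ?R t" using zero_admissible[OF U0] unfolding reach_from_zero_def by force
    fix r assume "r \<in> ?R t"
    then obtain u where u: "u \<in> admissible_controls U" "r = flow A B t 0 u" unfolding reach_from_zero_def by blast
    have "flow A B t 0 (\<lambda>r. - (\<kappa> *\<^sub>R u r)) = - (\<kappa> *\<^sub>R r)"
      using flow_eqI[OF trajectory_combination[OF flow_trajectory[OF u(1)] flow_trajectory[OF u(1)],
            of A B "- \<kappa>" 0 0 0], of t] u(2) by simp
    then show "- (\<kappa> *\<^sub>R r) \<in> ?R t"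
      using reflect_admissible[OF \<kappa>(2) u(1)] unfolding reach_from_zero_def by force
  next
    fix s t :: real assume st: "0 \<le> s" "0 \<le> t"
    show "?R (s + t) = {free_flow A t a + b |a b. a \<in> ?R s \<and> b \<in> ?R t}"
    proof (intro equalityI subsetI)
      fix x assume "x \<in> ?R (s + t)"
      then obtain u where u: "u \<in> admissible_controls U" "x = flow A B (t + s) 0 u"
        unfolding reach_from_zero_def by (auto simp: add.commute)
      then have "x = free_flow A t (flow A B s 0 u) + flow A B t 0 (\<lambda>r. u (r + s))"
        unfolding flow_shift[OF u(1)] by (simp add: flow_decompose[OF shift_admissible[OF u(1)], of A B t "flow A B s 0 u"])
      then show "x \<in> {free_flow A t a + b |a b. a \<in> ?R s \<and> b \<in> ?R t}"
        using u(1) shift_admissible[OF u(1)] unfolding reach_from_zero_def by blast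
    next
      fix x assume "x \<in> {free_flow A t a + b |a b. a \<in> ?R s \<and> b \<in> ?R t}"
      then obtain u v where uv: "u \<in> admissible_controls U" "v \<in> admissible_controls U"
        "x = free_flow A t (flow A B s 0 u) + flow A B t 0 v" unfolding reach_from_zero_def by blast
      obtain w where w: "w \<in> admissible_controls U"
        "\<And>r. r \<ge> 0 \<Longrightarrow> flow A B (r + s) 0 w = flow A B r (flow A B s 0 u) v"
        using flow_concat[OF uv(1,2) st, of A B 0] by blast
      have "flow A B (s + t) 0 w = x"
        using w(2)[OF st(2)] uv(3) flow_decompose[OF uv(2), of A B t "flow A B s 0 u"] by (simp add: add.commute)
      then show "x \<in> ?R (s + t)" using w(1) unfolding reach_from_zero_def by blast
    qed
  qed
  then show ?thesis by blast
qed

section \<open>Control sets and chain control sets\<close>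

lemma is_norm_equivalent:
  fixes N :: "'a::euclidean_space \<Rightarrow> real"
  assumes N: "is_norm N"
  shows "\<exists>c>0. \<forall>x. N x \<le> c * norm x \<and> norm x \<le> c * N x"
proof -
  have zero: "N x = 0 \<longleftrightarrow> x = 0" and tri: "N (x + y) \<le> N x + N y"
    and scale: "N (a *\<^sub>R x) = \<bar>a\<bar> * N x" for x y a
    using N unfolding is_norm_def by blast+
  have minus: "N (- x) = N x" for x using scale[of "-1" x] by simp
  have nonneg: "0 \<le> N x" for x using tri[of x "- x"] zero[of 0] minus[of x] by simp
  define K where "K = (\<Sum>b\<in>Basis. N b)"
  have sum_le: "N (\<Sum>b\<in>S. f b) \<le> (\<Sum>b\<in>S. N (f b))" if "finite S" for S and f :: "'a \<Rightarrow> 'a"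
    using that
  proof (induction S)
    case (insert b S)
    then show ?case using tri[of "f b" "sum f S"] by simp
  qed (use zero[of 0] in simp)
  have upper: "N x \<le> K * norm x" for x
  proof -
    have "N x = N (\<Sum>b\<in>Basis. (x \<bullet> b) *\<^sub>R b)" by (simp add: euclidean_representation)
    also have "\<dots> \<le> (\<Sum>b\<in>Basis. N ((x \<bullet> b) *\<^sub>R b))" by (rule sum_le) simp
    also have "\<dots> \<le> (\<Sum>b\<in>Basis. norm x * N b)"
      unfolding scale by (intro sum_mono mult_right_mono Basis_le_norm nonneg)
    finally show ?thesis by (simp add: K_def sum_distrib_left mult.commute)
  qed
  have K: "K \<ge> 0" unfolding K_def by (intro sum_nonneg nonneg)
  have lip: "\<bar>N x - N y\<bar> \<le> K * norm (x - y)" for x y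
    using tri[of "x - y" y] tri[of "y - x" x] upper[of "x - y"] minus[of "x - y"] by simp
  have "continuous_on (sphere 0 1) N"
    by (rule lipschitz_on_continuous_on[of K], rule lipschitz_onI) (simp_all add: dist_norm lip K)
  moreover have "sphere (0::'a) 1 \<noteq> {}" by simp
  ultimately obtain e where e: "norm e = 1" "\<And>y. norm y = 1 \<Longrightarrow> N e \<le> N y"
    using continuous_attains_inf[OF compact_sphere, of 0 1 N] by auto
  have "N e > 0" using nonneg[of e] zero[of e] e(1) by (cases "N e = 0") auto
  have lower: "N e * norm x \<le> N x" for x
  proof (cases "x = 0")
    case False
    have "N e \<le> N ((1 / norm x) *\<^sub>R x)" using False by (intro e(2)) simp
    then show ?thesis using False by (simp add: scale field_simps)
  qed (use nonneg in simp)
  define c where "c = max (K + 1) (1 / N e)"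
  have "N x \<le> c * norm x \<and> norm x \<le> c * N x" for x
  proof
    have "K * norm x \<le> c * norm x" by (intro mult_right_mono) (auto simp: c_def)
    then show "N x \<le> c * norm x" using upper[of x] by simp
    have "norm x \<le> (1 / N e) * N x" using lower[of x] \<open>N e > 0\<close> by (simp add: field_simps)
    also have "\<dots> \<le> c * N x" by (intro mult_right_mono nonneg) (simp add: c_def)
    finally show "norm x \<le> c * N x" .
  qed
  moreover have "c > 0" using K by (simp add: c_def)
  ultimately show ?thesis by blast
qed

lemma jump_step_flow:
  "jump_step (free_flow A) (reach_from_zero A B U) \<epsilon> T x y \<longleftrightarrow>
    (\<exists>u\<in>admissible_controls U. \<exists>t\<ge>T. norm (flow A B t x u - y) < \<epsilon>)"
  unfolding jump_step_def reach_from_zero_def using flow_decompose[of _ U A B _ x] by auto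

lemma controlled_chain_tranclp:
  "controlled_chain N A B U \<epsilon> T x y \<longleftrightarrow>
    (\<lambda>x y. \<exists>u\<in>admissible_controls U. \<exists>t\<ge>T. N (flow A B t x u - y) < \<epsilon>)\<^sup>+\<^sup>+ x y"
  (is "_ \<longleftrightarrow> ?S\<^sup>+\<^sup>+ x y")
proof -
  have choice: "(\<exists>u t. \<forall>j<k. u j \<in> admissible_controls U \<and> T \<le> t j \<and> N (flow A B (t j) (p j) (u j) - p (Suc j)) < \<epsilon>)
      \<longleftrightarrow> (\<forall>j<k. ?S (p j) (p (Suc j)))" for k :: nat and p
  proof
    assume "\<forall>j<k. ?S (p j) (p (Suc j))"
    then have "\<forall>j. \<exists>u t. j < k \<longrightarrow> u \<in> admissible_controls U \<and> T \<le> t \<and> N (flow A B t (p j) u - p (Suc j)) < \<epsilon>"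
      by blast
    then show "\<exists>u t. \<forall>j<k. u j \<in> admissible_controls U \<and> T \<le> t j \<and> N (flow A B (t j) (p j) (u j) - p (Suc j)) < \<epsilon>"
      by metis
  qed blast
  have "controlled_chain N A B U \<epsilon> T x y \<longleftrightarrow> (\<exists>k\<ge>1. \<exists>p. p 0 = x \<and> p k = y \<and>
      (\<exists>u t. \<forall>j<k. u j \<in> admissible_controls U \<and> T \<le> t j \<and> N (flow A B (t j) (p j) (u j) - p (Suc j)) < \<epsilon>))"
    unfolding controlled_chain_def by simp
  also have "\<dots> \<longleftrightarrow> (\<exists>k\<ge>1. \<exists>p. p 0 = x \<and> p k = y \<and> (\<forall>j<k. ?S (p j) (p (Suc j))))"
    unfolding choice ..
  also have "\<dots> \<longleftrightarrow> (\<exists>k>0. \<exists>p. p 0 = x \<and> p k = y \<and> (\<forall>j<k. ?S (p j) (p (Suc j))))"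
    by (simp add: Suc_le_eq)
  finally show ?thesis unfolding tranclp_power relpowp_fun_conv .
qed

locale bounded_control =
  fixes A :: "real^'n^'n" and B :: "real^'m^'n" and U :: "(real^'m) set"
  assumes U: "compact U" "convex U" "0 \<in> interior U"
begin

abbreviation "\<Phi> \<equiv> free_flow A"
abbreviation "R \<equiv> reach_from_zero A B U"
abbreviation "loop_set \<equiv> total_reach R \<inter> total_reach (backward_reach \<Phi> R)"

lemma zero_control: "(\<lambda>_. 0) \<in> admissible_controls U"
  using U(3) interior_subset by (intro zero_admissible) blast

lemma flow_zero_control: "flow A B t x (\<lambda>_. 0) = \<Phi> t x"
  by (rule flow_eqI[OF free_flow_trajectory])

lemma free_flow_zero: "free_flow A t 0 = 0"
  by (rule linear_0[OF linear_free_flow])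

lemma in_backward_reach_iff:
  "x \<in> total_reach (backward_reach \<Phi> R) \<longleftrightarrow> (\<exists>t\<ge>0. \<exists>u\<in>admissible_controls U. flow A B t x u = 0)"
proof -
  interpret linear_group \<Phi> by (rule linear_group_free_flow)
  have "x = - \<Phi> (- t) r \<longleftrightarrow> \<Phi> t x + r = 0" for t r
  proof
    assume "\<Phi> t x + r = 0"
    then have "r = - \<Phi> t x" by (simp add: eq_neg_iff_add_eq_0 add.commute)
    then show "x = - \<Phi> (- t) r" by (simp add: linear_neg[OF linear_free_flow])
  qed (simp add: linear_neg[OF linear_free_flow])
  then show ?thesis
    unfolding total_reach_def backward_reach_def reach_from_zero_def
    by (auto simp: flow_decompose[of _ U A B _ x])
qed

lemma in_reach_iff:
  "x \<in> total_reach R \<longleftrightarrow> (\<exists>t\<ge>0. \<exists>u\<in>admissible_controls U. x = flow A B t 0 u)"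
  unfolding total_reach_def reach_from_zero_def by auto

lemma zero_in_loop_set: "0 \<in> loop_set"
  using zero_control flow_zero_control[of 0 0] free_flow_zero
  unfolding Int_iff in_reach_iff in_backward_reach_iff by (metis order_refl)

text \<open>
  Every trajectory from the origin to the origin stays among such loops, and two points on loops
  are joined through the origin. After its return to the origin a trajectory is kept there by the zero
  control.
\<close>

lemma loop_set_pre_control_set: "pre_control_set A B U loop_set"
  unfolding pre_control_set_def
proof (intro conjI ballI subsetI)
  obtain \<kappa> where "reachability \<Phi> R \<kappa>" using reachability_flow[OF U] by blast
  then interpret reachability \<Phi> R \<kappa> .
  fix x assume x: "x \<in> loop_set"
  then obtain \<tau> u where u: "\<tau> \<ge> 0" "u \<in> admissible_controls U" "flow A B \<tau> x u = 0"
    unfolding Int_iff in_backward_reach_iff by blast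
  show "\<exists>u\<in>admissible_controls U. \<forall>t\<ge>0. flow A B t x u \<in> loop_set"
  proof -
    obtain w where w: "w \<in> admissible_controls U" "\<And>r. r \<in> {0..\<tau>} \<Longrightarrow> flow A B r x w = flow A B r x u"
      "\<And>r. r \<ge> 0 \<Longrightarrow> flow A B (r + \<tau>) x w = flow A B r (flow A B \<tau> x u) (\<lambda>_. 0)"
      using flow_concat[OF u(2) zero_control u(1) order_refl, of A B x] by blast
    have "flow A B t x w \<in> loop_set" if t: "t \<ge> 0" for t
    proof (cases "t \<le> \<tau>")
      case True
      have 1: "flow A B t x w = flow A B t x u" using w(2) t True by simp
      have "flow A B t x u = \<Phi> t x + flow A B t 0 u" by (rule flow_decompose[OF u(2)])
      moreover have "\<dots> \<in> total_reach R"
        using x t u(2) by (intro reach_step) (auto simp: reach_from_zero_def)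
      ultimately have 2: "flow A B t x u \<in> total_reach R" by simp
      have "flow A B (\<tau> - t) (flow A B t x u) (\<lambda>r. u (r + t)) = 0"
        using flow_shift[OF u(2), of A B "\<tau> - t" t x] u(3) by simp
      then have "flow A B t x u \<in> total_reach (backward_reach \<Phi> R)"
        unfolding in_backward_reach_iff using shift_admissible[OF u(2)] True
        by (intro exI[of _ "\<tau> - t"]) auto
      then show ?thesis using 1 2 by simp
    next
      case False
      then have "flow A B t x w = 0"
        using w(3)[of "t - \<tau>"] u(3) flow_zero_control free_flow_zero by simp
      then show ?thesis using zero_in_loop_set by simp
    qed
    then show ?thesis using w(1) by blast
  qed
  fix y assume "y \<in> loop_set"
  then obtain s where s: "0 \<le> s" "y \<in> R s" unfolding total_reach_def by auto
  \<comment> \<open>Waiting at the origin makes the travel time positive, as the reachable set demands.\<close>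
  then have "y \<in> R (s + 1)" using R_mono[of s "s + 1"] by auto
  then obtain v where v: "v \<in> admissible_controls U" "y = flow A B (s + 1) 0 v" unfolding reach_from_zero_def by blast
  obtain w where w: "w \<in> admissible_controls U"
    "\<And>r. r \<ge> 0 \<Longrightarrow> flow A B (r + \<tau>) x w = flow A B r (flow A B \<tau> x u) v"
    using flow_concat[OF u(2) v(1) u(1) order_refl, of A B x] by blast
  have "y = flow A B ((s + 1) + \<tau>) x w" using w(2)[of "s + 1"] s(1) u(3) v(2) by simp
  then have "y \<in> reachable_set A B U x"
    unfolding reachable_set_def using w(1) s(1) u(1) by (auto intro!: bexI[of _ w] exI[of _ "s + 1 + \<tau>"])
  then show "y \<in> closure (reachable_set A B U x)" using closure_subset by blast
qed

text \<open>
  Continuous dependence on the initial value: a control that steers \<open>z\<close> close to \<open>y\<close> also steers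
  points near \<open>z\<close> close to \<open>y\<close>.
\<close>

lemma reachable_closure_trans:
  assumes z: "z \<in> closure (reachable_set A B U x)" and y: "y \<in> closure (reachable_set A B U z)"
  shows "y \<in> closure (reachable_set A B U x)"
  unfolding closure_approachable
proof (intro allI impI)
  fix \<epsilon> :: real assume \<epsilon>: "\<epsilon> > 0"
  then have "\<epsilon> / 2 > 0" by simp
  then obtain v s where v: "v \<in> admissible_controls U" "s > 0" "dist (flow A B s z v) y < \<epsilon> / 2"
    using y unfolding closure_approachable reachable_set_def by blast
  obtain K where K: "K > 0" "\<And>y. norm (\<Phi> s y) \<le> norm y * K"
    using bounded_linear.pos_bounded[OF linear_conv_bounded_linear[THEN iffD1, OF linear_free_flow[of A s]]]
    by blast
  have "\<epsilon> / (2 * K) > 0" using \<epsilon> K by simp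
  then obtain u T where u: "u \<in> admissible_controls U" "T > 0" "dist (flow A B T x u) z < \<epsilon> / (2 * K)"
    using z unfolding closure_approachable reachable_set_def by blast
  obtain w where w: "w \<in> admissible_controls U"
    "\<And>r. r \<ge> 0 \<Longrightarrow> flow A B (r + T) x w = flow A B r (flow A B T x u) v"
    using flow_concat[OF u(1) v(1) less_imp_le[OF u(2)] order_refl, of A B x] by blast
  let ?p = "flow A B (s + T) x w"
  have "?p - flow A B s z v = \<Phi> s (flow A B T x u - z)"
    using w(2)[of s] v(1,2) by (simp add: flow_decompose[OF v(1), of A B s "flow A B T x u"]
        flow_decompose[OF v(1), of A B s z] linear_diff[OF linear_free_flow])
  then have "dist ?p (flow A B s z v) \<le> dist (flow A B T x u) z * K"
    using K(2) by (simp add: dist_norm)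
  also have "\<dots> < \<epsilon> / 2" using u(3) K(1) by (simp add: field_simps)
  finally have "dist ?p y < \<epsilon>" using v(3) dist_triangle[of ?p y "flow A B s z v"] by simp
  moreover have "?p \<in> reachable_set A B U x"
    unfolding reachable_set_def using w(1) u(2) v(2) by (auto intro!: bexI[of _ w] exI[of _ "s + T"])
  ultimately show "\<exists>p\<in>reachable_set A B U x. dist p y < \<epsilon>" by blast
qed

text \<open>
  All these sets contain the origin, so any two of their points are approximately joined through
  it. The union is therefore the largest such set, that is, the control set of the origin.
\<close>

lemma Union_pre_control_sets:
  "pre_control_set A B U (\<Union>{D. pre_control_set A B U D \<and> 0 \<in> D})"
proof -
  define V where "V = \<Union>{D. pre_control_set A B U D \<and> 0 \<in> D}"
  have "pre_control_set A B U V"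
    unfolding pre_control_set_def
  proof (intro conjI ballI subsetI)
    fix x assume "x \<in> V"
    then obtain D where D: "pre_control_set A B U D" "0 \<in> D" "x \<in> D" unfolding V_def by blast
    show "\<exists>u\<in>admissible_controls U. \<forall>t\<ge>0. flow A B t x u \<in> V"
    proof -
      obtain u where u: "u \<in> admissible_controls U" "\<forall>t\<ge>0. flow A B t x u \<in> D"
        using D unfolding pre_control_set_def by blast
      moreover have "D \<subseteq> V" unfolding V_def using D by blast
      ultimately show ?thesis by blast
    qed
    fix y assume "y \<in> V"
    then obtain D' where D': "pre_control_set A B U D'" "0 \<in> D'" "y \<in> D'" unfolding V_def by blast
    have "0 \<in> closure (reachable_set A B U x)" using D unfolding pre_control_set_def by blast
    moreover have "y \<in> closure (reachable_set A B U 0)" using D' unfolding pre_control_set_def by blast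
    ultimately show "y \<in> closure (reachable_set A B U x)" by (rule reachable_closure_trans)
  qed
  then show ?thesis by (simp add: V_def)
qed

lemma zero_control_set_eq: "zero_control_set A B U = \<Union>{D. pre_control_set A B U D \<and> 0 \<in> D}" (is "_ = ?D")
  unfolding zero_control_set_def
proof (rule the_equality)
  have "0 \<in> ?D" using loop_set_pre_control_set zero_in_loop_set by blast
  then show "control_set A B U ?D \<and> 0 \<in> ?D"
    unfolding control_set_def using Union_pre_control_sets by blast
  show "D = ?D" if "control_set A B U D \<and> 0 \<in> D" for D
    using that Union_pre_control_sets unfolding control_set_def by blast
qed

lemma loop_set_subset: "loop_set \<subseteq> zero_control_set A B U"
  unfolding zero_control_set_eq using loop_set_pre_control_set zero_in_loop_set by blast

text \<open>
  By the first property of control sets a trajectory can be kept in the set for time \<open>T\<close>; from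
  there the starting point is approximately reachable. This is a closed chain with one jump, whose
  step lasts at least \<open>T\<close>.
\<close>

lemma zero_control_set_subset: "zero_control_set A B U \<subseteq> chain_hull \<Phi> R"
proof
  obtain \<kappa> where "reachability \<Phi> R \<kappa>" using reachability_flow[OF U] by blast
  then interpret reachability \<Phi> R \<kappa> .
  let ?D = "zero_control_set A B U"
  have D: "pre_control_set A B U ?D" unfolding zero_control_set_eq by (rule Union_pre_control_sets)
  fix x assume x: "x \<in> ?D"
  show "x \<in> chain_hull \<Phi> R"
  proof (rule recurrent_in_chain_hull)
    fix \<epsilon> T :: real assume *: "\<epsilon> > 0" "T > 0"
    obtain u where u: "u \<in> admissible_controls U" "flow A B T x u \<in> ?D"
      using D x * unfolding pre_control_set_def by (meson less_imp_le)
    then have "x \<in> closure (reachable_set A B U (flow A B T x u))"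
      using D x unfolding pre_control_set_def by blast
    then obtain v s where v: "v \<in> admissible_controls U" "s > 0"
      "dist (flow A B s (flow A B T x u) v) x < \<epsilon>"
      using *(1) unfolding closure_approachable reachable_set_def by blast
    obtain w where w: "w \<in> admissible_controls U"
      "\<And>r. r \<ge> 0 \<Longrightarrow> flow A B (r + T) x w = flow A B r (flow A B T x u) v"
      using flow_concat[OF u(1) v(1) less_imp_le[OF *(2)] order_refl, of A B x] by blast
    have "norm (flow A B (s + T) x w - x) < \<epsilon>" using w(2)[of s] v(2,3) by (simp add: dist_norm)
    then have "jump_step \<Phi> R \<epsilon> T x x"
      unfolding jump_step_flow using w(1) v(2) by (intro bexI[of _ w] exI[of _ "s + T"]) auto
    then show "(jump_step \<Phi> R \<epsilon> T)\<^sup>+\<^sup>+ x x" by blast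
  qed
qed

lemma chain_hull_eq: "chain_hull \<Phi> R = closure (zero_control_set A B U) + center_Lyapunov_space A"
proof
  obtain \<kappa> where "reachability \<Phi> R \<kappa>" using reachability_flow[OF U] by blast
  then interpret reachability \<Phi> R \<kappa> .
  show "chain_hull \<Phi> R \<subseteq> closure (zero_control_set A B U) + center_Lyapunov_space A"
  proof
    fix x assume "x \<in> chain_hull \<Phi> R"
    then obtain z where z: "z \<in> closure loop_set" "x - z \<in> neutral_space \<Phi>" using chain_hull_subset by blast
    have "z \<in> closure (zero_control_set A B U)" using z(1) closure_mono[OF loop_set_subset] by blast
    then have "z + (x - z) \<in> closure (zero_control_set A B U) + center_Lyapunov_space A"
      unfolding center_Lyapunov_space_eq using z(2) by (rule set_plus_intro)
    then show "x \<in> closure (zero_control_set A B U) + center_Lyapunov_space A" by simp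
  qed
  show "closure (zero_control_set A B U) + center_Lyapunov_space A \<subseteq> chain_hull \<Phi> R"
  proof
    fix x assume "x \<in> closure (zero_control_set A B U) + center_Lyapunov_space A"
    then obtain z v where "x = z + v" "z \<in> closure (zero_control_set A B U)" "v \<in> neutral_space \<Phi>"
      unfolding center_Lyapunov_space_eq by (rule set_plus_elim)
    moreover have "closure (zero_control_set A B U) \<subseteq> chain_hull \<Phi> R"
      by (rule closure_minimal[OF zero_control_set_subset closed_chain_hull])
    ultimately show "x \<in> chain_hull \<Phi> R" using chain_hull_add_neutral by blast
  qed
qed

lemma chain_control_set_iff:
  assumes N: "is_norm N"
  shows "chain_control_set N A B U E \<longleftrightarrow> E = chain_hull \<Phi> R"
proof -
  obtain \<kappa> where "reachability \<Phi> R \<kappa>" using reachability_flow[OF U] by blast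
  then interpret reachability \<Phi> R \<kappa> .
  obtain c where c: "c > 0" "\<And>x. N x \<le> c * norm x" "\<And>x. norm x \<le> c * N x"
    using is_norm_equivalent[OF N] by blast
  have trans: "chain_transitive N A B U (chain_hull \<Phi> R)"
    unfolding chain_transitive_def controlled_chain_tranclp
  proof (intro ballI allI impI)
    fix x y and \<epsilon> T :: real
    assume xy: "x \<in> chain_hull \<Phi> R" "y \<in> chain_hull \<Phi> R" and *: "\<epsilon> > 0" "T > 0"
    have "\<epsilon> / c > 0" using *(1) c(1) by simp
    have "(jump_step \<Phi> R (\<epsilon> / c) T)\<^sup>+\<^sup>+ x y"
      by (rule chain_hull_chain_transitive[OF *(2) \<open>\<epsilon> / c > 0\<close> xy])
    then show "(\<lambda>x y. \<exists>u\<in>admissible_controls U. \<exists>t\<ge>T. N (flow A B t x u - y) < \<epsilon>)\<^sup>+\<^sup>+ x y"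
    proof (rule tranclp_le, intro predicate2I)
      fix a b assume "jump_step \<Phi> R (\<epsilon> / c) T a b"
      then obtain u t where "u \<in> admissible_controls U" "t \<ge> T" "norm (flow A B t a u - b) < \<epsilon> / c"
        unfolding jump_step_flow by blast
      moreover have "N (flow A B t a u - b) < \<epsilon>"
        using c(2)[of "flow A B t a u - b"] calculation(3) c(1) by (simp add: field_simps)
      ultimately show "\<exists>u\<in>admissible_controls U. \<exists>t\<ge>T. N (flow A B t a u - b) < \<epsilon>" by blast
    qed
  qed
  have sub: "E' \<subseteq> chain_hull \<Phi> R" if E': "chain_transitive N A B U E'" for E'
  proof
    fix x assume x: "x \<in> E'"
    show "x \<in> chain_hull \<Phi> R"
    proof (rule recurrent_in_chain_hull)
      fix \<epsilon> T :: real assume *: "\<epsilon> > 0" "T > 0"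
      have "\<epsilon> / c > 0" using *(1) c(1) by simp
      then have "(\<lambda>x y. \<exists>u\<in>admissible_controls U. \<exists>t\<ge>T. N (flow A B t x u - y) < \<epsilon> / c)\<^sup>+\<^sup>+ x x"
        using E' x *(2) unfolding chain_transitive_def controlled_chain_tranclp by blast
      then show "(jump_step \<Phi> R \<epsilon> T)\<^sup>+\<^sup>+ x x"
      proof (rule tranclp_le, intro predicate2I)
        fix a b assume "\<exists>u\<in>admissible_controls U. \<exists>t\<ge>T. N (flow A B t a u - b) < \<epsilon> / c"
        then obtain u t where "u \<in> admissible_controls U" "t \<ge> T" "N (flow A B t a u - b) < \<epsilon> / c" by blast
        moreover have "norm (flow A B t a u - b) < \<epsilon>"
          using c(3)[of "flow A B t a u - b"] calculation(3) c(1) by (simp add: field_simps)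
        ultimately show "jump_step \<Phi> R \<epsilon> T a b" unfolding jump_step_flow by blast
      qed
    qed
  qed
  show ?thesis
  proof
    assume "chain_control_set N A B U E"
    then show "E = chain_hull \<Phi> R" using trans sub unfolding chain_control_set_def by metis
  next
    assume "E = chain_hull \<Phi> R"
    moreover have "chain_hull \<Phi> R \<noteq> {}" using chain_hull_nonempty by blast
    ultimately show "chain_control_set N A B U E"
      using trans sub unfolding chain_control_set_def by blast
  qed
qed

end

theorem theorem4p8:
  fixes A :: "real^'n^'n" and B :: "real^'m^'n" and U :: "(real^'m) set"
    and N :: "real^'n \<Rightarrow> real"
  assumes "compact U" and "convex U" and "0 \<in> interior U"
    and "is_norm N"
  shows "(\<exists>!E. chain_control_set N A B U E) \<and>
    (\<forall>E. chain_control_set N A B U E \<longrightarrow>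
      E = closure (zero_control_set A B U) + center_Lyapunov_space A)"
proof -
  interpret bounded_control A B U by unfold_locales (fact assms)+
  show ?thesis unfolding chain_control_set_iff[OF assms(4)] chain_hull_eq by blast
qed

end
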